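(* Let $H\in C^2(\mathbb{T}^n\times\mathbb{R}^n)$ satisfy (H1') and (H2), with ergodic constant $0$. For $u_0\in\mathrm{Lip}(\mathbb{T}^n)$ let $u^\infty[u_0]$ be the asymptotic profile, i.e. the uniform limit as $t\to\infty$ of the viscosity solution $u(\cdot,t)$ of $u_t+H(x,Du)=0$ in $\mathbb{T}^n\times(0,\infty)$, $u(\cdot,0)=u_0$. Then: (i) $u^\infty[u_0](y)=u_0^-(y)$ for all $y\in\mathcal{M}$; (ii) $u^\infty[u_0](x)=\min\{d(x,y)+u_0^-(y):y\in\mathcal{M}\}$ for all $x\in\mathbb{T}^n$.
   Context: $\mathbb{T}^n$ is the $n$-dimensional flat torus. (H1'): there is $\gamma>0$ with $D^2_{pp}H(x,p)\ge\gamma I_n$ for all $(x,p)$. (H2): uniformly in $x$, $\lim_{|p|\to\infty}H(x,p)/|p|=+\infty$ and $\lim_{|p|\to\infty}(\tfrac12H(x,p)^2+D_xH(x,p)\cdot p)=+\infty$. Ergodic constant: the unique $c$ such that $H(x,Dw)=c$ has a viscosity solution on $\mathbb{T}^n$; assumed $c=0$; under these assumptions the asymptotic profile exists and is a viscosity solution of $H(x,Dw)=0$. Definitions: $u_0^-(x)=\sup\{v(x): v\le u_0\text{ on }\mathbb{T}^n,\ v\text{ a viscosity subsolution of }H(x,Dv)=0\}$; $d(x,y)=\sup\{v(x)-v(y): v\text{ a viscosity subsolution of }H(x,Dv)=0\}$. $L(x,v)=\sup_p(p\cdot v-H(x,p))$; $\mathcal{F}=\{\mu\in\mathcal{P}(\mathbb{T}^n\times\mathbb{R}^n):\iint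 v\cdot D\phi\,d\mu=0\ \forall\phi\in C^1(\mathbb{T}^n)\}$; Mather measures $\widetilde{\mathcal{M}}$ are minimizers of $\iint L\,d\mu$ over $\mathcal{F}$; projected Mather set $\mathcal{M}=\overline{\bigcup_{\mu\in\widetilde{\mathcal{M}}}\operatorname{supp}(\operatorname{proj}_{\mathbb{T}^n}\mu)}$. *)

theory Defs
  imports "HOL-Analysis.Analysis" "HOL-Probability.Probability"
begin

text \<open>The flat torus T^n = R^n / Z^n is represented through Z^n-periodic objects on
  real^'n.  A point of T^n is represented by any of its lifts in real^'n.\<close>

definition Zlat :: "(real^'n) set" where
  "Zlat = {k. \<forall>i. k $ i \<in> \<int>}"

definition periodic_fun :: "(real^'n \<Rightarrow> 'b) \<Rightarrow> bool" where
  "periodic_fun f \<longleftrightarrow> (\<forall>x. \<forall>k\<in>Zlat. f (x + k) = f x)"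

definition unit_cube :: "(real^'n) set" where
  "unit_cube = {x. \<forall>i. 0 \<le> x $ i \<and> x $ i < 1}"

definition C1_grad :: "(real^'n \<Rightarrow> real) \<Rightarrow> (real^'n \<Rightarrow> real^'n) \<Rightarrow> bool" where
  "C1_grad \<phi> g \<longleftrightarrow> (\<forall>x. (\<phi> has_derivative (\<lambda>h. g x \<bullet> h)) (at x)) \<and> continuous_on UNIV g"

definition C1_grad_time ::
  "(real^'n \<Rightarrow> real \<Rightarrow> real) \<Rightarrow> (real^'n \<Rightarrow> real \<Rightarrow> real^'n) \<Rightarrow> (real^'n \<Rightarrow> real \<Rightarrow> real) \<Rightarrow> bool" where
  "C1_grad_time \<phi> gx gt \<longleftrightarrow>
     (\<forall>x t. ((\<lambda>z. \<phi> (fst z) (snd z)) has_derivative (\<lambda>z. gx x t \<bullet> fst z + gt x t * snd z)) (at (x, t)))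
     \<and> continuous_on UNIV (\<lambda>z. gx (fst z) (snd z)) \<and> continuous_on UNIV (\<lambda>z. gt (fst z) (snd z))"

definition C2_with ::
  "('a::real_normed_vector \<Rightarrow> real) \<Rightarrow> ('a \<Rightarrow> 'a \<Rightarrow>\<^sub>L real) \<Rightarrow> ('a \<Rightarrow> 'a \<Rightarrow>\<^sub>L ('a \<Rightarrow>\<^sub>L real)) \<Rightarrow> bool" where
  "C2_with f Df D2f \<longleftrightarrow>
     (\<forall>z. (f has_derivative blinfun_apply (Df z)) (at z))
     \<and> (\<forall>z. (Df has_derivative blinfun_apply (D2f z)) (at z))
     \<and> continuous_on UNIV D2f"

definition visc_sub :: "(real^'n \<Rightarrow> real^'n \<Rightarrow> real) \<Rightarrow> (real^'n \<Rightarrow> real) \<Rightarrow> bool" where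
  "visc_sub H v \<longleftrightarrow> periodic_fun v \<and> continuous_on UNIV v \<and>
     (\<forall>\<phi> g x. C1_grad \<phi> g \<and>
        (\<exists>e>0. \<forall>y. dist y x < e \<longrightarrow> v y - \<phi> y \<le> v x - \<phi> x)
        \<longrightarrow> H x (g x) \<le> 0)"

definition visc_super :: "(real^'n \<Rightarrow> real^'n \<Rightarrow> real) \<Rightarrow> (real^'n \<Rightarrow> real) \<Rightarrow> bool" where
  "visc_super H v \<longleftrightarrow> periodic_fun v \<and> continuous_on UNIV v \<and>
     (\<forall>\<phi> g x. C1_grad \<phi> g \<and>
        (\<exists>e>0. \<forall>y. dist y x < e \<longrightarrow> v y - \<phi> y \<ge> v x - \<phi> x)
        \<longrightarrow> H x (g x) \<ge> 0)"

definition visc_sol :: "(real^'n \<Rightarrow> real^'n \<Rightarrow> real) \<Rightarrow> (real^'n \<Rightarrow> real) \<Rightarrow> bool" where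
  "visc_sol H v \<longleftrightarrow> visc_sub H v \<and> visc_super H v"

definition visc_sol_cauchy ::
  "(real^'n \<Rightarrow> real^'n \<Rightarrow> real) \<Rightarrow> (real^'n \<Rightarrow> real) \<Rightarrow> (real^'n \<Rightarrow> real \<Rightarrow> real) \<Rightarrow> bool" where
  "visc_sol_cauchy H u0 u \<longleftrightarrow>
     continuous_on (UNIV \<times> {0..}) (\<lambda>z. u (fst z) (snd z))
     \<and> (\<forall>t\<ge>0. periodic_fun (\<lambda>x. u x t))
     \<and> (\<forall>x. u x 0 = u0 x)
     \<and> (\<forall>\<phi> gx gt x t. C1_grad_time \<phi> gx gt \<and> t > 0 \<and>
          (\<exists>e>0. \<forall>y s. s > 0 \<and> dist (y, s) (x, t) < e \<longrightarrow> u y s - \<phi> y s \<le> u x t - \<phi> x t)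
          \<longrightarrow> gt x t + H x (gx x t) \<le> 0)
     \<and> (\<forall>\<phi> gx gt x t. C1_grad_time \<phi> gx gt \<and> t > 0 \<and>
          (\<exists>e>0. \<forall>y s. s > 0 \<and> dist (y, s) (x, t) < e \<longrightarrow> u y s - \<phi> y s \<ge> u x t - \<phi> x t)
          \<longrightarrow> gt x t + H x (gx x t) \<ge> 0)"

definition u0_minus :: "(real^'n \<Rightarrow> real^'n \<Rightarrow> real) \<Rightarrow> (real^'n \<Rightarrow> real) \<Rightarrow> real^'n \<Rightarrow> real" where
  "u0_minus H u0 x = Sup {v x | v. visc_sub H v \<and> (\<forall>y. v y \<le> u0 y)}"

definition dH :: "(real^'n \<Rightarrow> real^'n \<Rightarrow> real) \<Rightarrow> real^'n \<Rightarrow> real^'n \<Rightarrow> real" where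
  "dH H x y = Sup {v x - v y | v. visc_sub H v}"

definition Lag :: "(real^'n \<Rightarrow> real^'n \<Rightarrow> real) \<Rightarrow> real^'n \<Rightarrow> real^'n \<Rightarrow> real" where
  "Lag H x v = (SUP p. p \<bullet> v - H x p)"

text \<open>Probability measures on T^n x R^n, represented as probability measures on
  R^n x R^n concentrated on unit_cube x R^n.\<close>
definition torus_prob :: "((real^'n) \<times> (real^'n)) measure \<Rightarrow> bool" where
  "torus_prob \<mu> \<longleftrightarrow> prob_space \<mu> \<and> sets \<mu> = sets borel \<and>
     emeasure \<mu> (- (unit_cube \<times> UNIV)) = 0"

definition closed_measures :: "((real^'n) \<times> (real^'n)) measure set" where
  "closed_measures = {\<mu>. torus_prob \<mu> \<and>
     (\<forall>\<phi> g. periodic_fun \<phi> \<and> C1_grad \<phi> g \<longrightarrow>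
        integrable \<mu> (\<lambda>z. snd z \<bullet> g (fst z)) \<and> (\<integral>z. snd z \<bullet> g (fst z) \<partial>\<mu>) = 0)}"

definition mather_measures :: "(real^'n \<Rightarrow> real^'n \<Rightarrow> real) \<Rightarrow> ((real^'n) \<times> (real^'n)) measure set" where
  "mather_measures H = {\<mu>. \<mu> \<in> closed_measures \<and> integrable \<mu> (\<lambda>z. Lag H (fst z) (snd z)) \<and>
     (\<forall>\<nu>\<in>closed_measures. integrable \<nu> (\<lambda>z. Lag H (fst z) (snd z)) \<longrightarrow>
        (\<integral>z. Lag H (fst z) (snd z) \<partial>\<mu>) \<le> (\<integral>z. Lag H (fst z) (snd z) \<partial>\<nu>))}"

text \<open>Support of the projection of mu to T^n (as a periodic subset of R^n).\<close>
definition proj_supp :: "((real^'n) \<times> (real^'n)) measure \<Rightarrow> (real^'n) set" where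
  "proj_supp \<mu> = {x. \<forall>e>0. emeasure \<mu> {z. \<exists>k\<in>Zlat. dist (fst z + k) x < e} > 0}"

definition mather_set :: "(real^'n \<Rightarrow> real^'n \<Rightarrow> real) \<Rightarrow> (real^'n) set" where
  "mather_set H = closure (\<Union>\<mu>\<in>mather_measures H. proj_supp \<mu>)"

end

theory Submission
  imports Defs
begin

text \<open>
  A continuous periodic function is a viscosity subsolution iff it is dominated by the action along
  straight segments, a property that passes to infima; convexity makes its mollifications almost
  classical subsolutions, which can be tested against closed measures.

  For (i), \<open>V(x,t) = inf\<^sub>s\<^sub>\<ge>\<^sub>t u(x,s)\<close> is again a subsolution of the Cauchy problem, nondecreasing in \<open>t\<close>,
  and \<open>V(\<cdot>,0)\<close> is a stationary subsolution below \<open>u\<^sub>0\<close>, so \<open>V(\<cdot>,0) \<le> u\<^sub>0\<^sup>- \<le> u\<^sup>\<infinity>\<close>. Integrals of subsolutions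
  of the Cauchy problem against a Mather measure are nonincreasing in time, while \<open>V(\<cdot>,t)\<close> tends to
  \<open>u\<^sup>\<infinity>\<close>; hence \<open>V(\<cdot>,0) = u\<^sup>\<infinity>\<close> on the support.

  For (ii), inf-convolutions of \<open>u\<^sup>\<infinity>\<close> produce, from any \<open>x\<close>, long discrete curves that are almost
  calibrated. Their empirical measures converge to a Mather measure on whose support
  \<open>u\<^sup>\<infinity>(x) - u\<^sup>\<infinity>(y) = d(x,y)\<close>.
\<close>

section \<open>The Lagrangian of a superlinear convex Hamiltonian\<close>

text \<open>The only curves are straight segments and chains of short segments; minimizing curves
  and a Lax-Oleinik formula are replaced by them. The price is an error at each step, which has to
  be small compared with the step so that it can be summed over long times. This requirement fixes
  most of the constants.

  The minimal action over closed measures is zero: \<open>uinf\<close> is itself a stationary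
  subsolution, which makes every action nonnegative, and the calibrated chains yield a closed
  measure of nonpositive action. Hence "closed, with action \<le> 0" is the working form of being a
  Mather measure in both assertions.

  The supersolution half of the equation is used at two places, for the comparison with
  \<open>u0_minus\<close> and for the calibration. Both times the competitor is made smooth
  beforehand, a mollified subsolution or a quadratic, and serves directly as a test function, so
  variables are never doubled.\<close>

definition frac_vec :: "real^'n \<Rightarrow> real^'n" where
  "frac_vec x = (\<chi> i. frac (x $ i))"

lemma frac_vec_in_unit_cube: "frac_vec x \<in> unit_cube"
  by (simp add: frac_vec_def unit_cube_def frac_lt_1)

lemma diff_frac_vec_in_Zlat: "x - frac_vec x \<in> Zlat"
  by (simp add: frac_vec_def Zlat_def frac_def)

lemma Zlat_uminus: "k \<in> Zlat \<Longrightarrow> - k \<in> Zlat"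
  by (simp add: Zlat_def)

lemma periodic_frac_vec: "periodic_fun f \<Longrightarrow> f (frac_vec x) = f x"
  using diff_frac_vec_in_Zlat[of x] unfolding periodic_fun_def
  by (metis add.commute diff_add_cancel)

lemma unit_cube_subset_cbox: "unit_cube \<subseteq> cbox 0 1"
  by (force simp: unit_cube_def mem_box_cart intro: less_imp_le)

lemma frac_vec_in_cbox: "frac_vec x \<in> cbox 0 1"
  using frac_vec_in_unit_cube unit_cube_subset_cbox by blast

lemma periodic_continuous_bounded:
  fixes f :: "real^'n \<Rightarrow> real"
  assumes "continuous_on UNIV f" "periodic_fun f"
  obtains B where "\<And>x. \<bar>f x\<bar> \<le> B"
proof -
  have "compact (f ` cbox 0 1)"
    using assms(1) by (intro compact_continuous_image) (auto intro: continuous_on_subset)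
  then obtain B where B: "\<And>y. y \<in> f ` cbox 0 1 \<Longrightarrow> \<bar>y\<bar> \<le> B"
    by (meson bounded_real compact_imp_bounded)
  have "\<bar>f x\<bar> \<le> B" for x
    using B[OF imageI[OF frac_vec_in_cbox[of x]]] periodic_frac_vec[OF assms(2), of x] by simp
  then show ?thesis by (rule that)
qed

text \<open>Uniform continuity of a periodic function needs both points of a close pair in one
  compact set. Reducing the first point to the unit cube may leave the second one outside, so the
  cube is enlarged by one on each side.\<close>

lemma common_translate:
  fixes x y :: "real^'n"
  assumes "dist x y < 1"
  obtains k where "k \<in> Zlat" "x + k \<in> cbox (-1) 2" "y + k \<in> cbox (-1) 2"
proof -
  define k where "k = - (x - frac_vec x)"
  have c: "0 \<le> frac_vec x $ i \<and> frac_vec x $ i \<le> 1" for i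
    using frac_vec_in_cbox[of x] by (simp add: mem_box_cart)
  have xk: "x + k = frac_vec x" by (simp add: k_def)
  have "\<bar>(y + k) $ i - frac_vec x $ i\<bar> < 1" for i
  proof -
    have "\<bar>(y + k - (x + k)) $ i\<bar> \<le> norm (y + k - (x + k))" by (rule component_le_norm_cart)
    also have "\<dots> < 1" using assms by (simp add: dist_norm norm_minus_commute)
    finally show ?thesis unfolding xk by simp
  qed
  then have yk: "-1 \<le> (y + k) $ i \<and> (y + k) $ i \<le> 2" for i
    using c[of i] by (smt (verit))
  have "-1 \<le> (x + k) $ i \<and> (x + k) $ i \<le> 2" for i using c[of i] unfolding xk by (smt (verit))
  moreover have "k \<in> Zlat" unfolding k_def by (intro Zlat_uminus diff_frac_vec_in_Zlat)
  ultimately show ?thesis using yk by (intro that[of k]) (simp_all add: mem_box_cart)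
qed

lemma periodic_uniformly_continuous:
  fixes f :: "real^'n \<Rightarrow> 'b::metric_space"
  assumes f: "continuous_on UNIV f" "periodic_fun f" and e: "e > 0"
  obtains d where "d > 0" "\<And>x y. dist x y < d \<Longrightarrow> dist (f x) (f y) < e"
proof -
  have "uniformly_continuous_on (cbox (-1) 2) f"
    using f(1) by (intro compact_uniformly_continuous) (auto intro: continuous_on_subset)
  then obtain d where d: "d > 0" "\<And>x y. x \<in> cbox (-1) 2 \<Longrightarrow> y \<in> cbox (-1) 2 \<Longrightarrow> dist x y < d \<Longrightarrow> dist (f x) (f y) < e"
    using e unfolding uniformly_continuous_on_def by metis
  have "dist (f x) (f y) < e" if xy: "dist x y < min d 1" for x y
  proof -
    obtain k where k: "k \<in> Zlat" "x + k \<in> cbox (-1) 2" "y + k \<in> cbox (-1) 2"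
      using common_translate[of x y] xy by auto
    have "dist (f (x + k)) (f (y + k)) < e" using xy by (intro d(2) k) (simp add: dist_norm)
    then show ?thesis using f(2) k(1) by (simp add: periodic_fun_def)
  qed
  then show ?thesis using d(1) by (intro that[of "min d 1"]) auto
qed

section \<open>Convex duality with constants uniform in the base point\<close>

locale superlinear_hamiltonian =
  fixes H :: "real^'n \<Rightarrow> real^'n \<Rightarrow> real"
  assumes H_cont: "continuous_on UNIV (\<lambda>z. H (fst z) (snd z))"
    and H_periodic: "\<And>p. periodic_fun (\<lambda>x. H x p)"
    and H_subgrad: "\<And>x p. \<exists>q. \<forall>p'. H x p + q \<bullet> (p' - p) \<le> H x p'"
    and H_superlinear: "\<And>M. \<exists>R. \<forall>x p. norm p \<ge> R \<longrightarrow> H x p \<ge> M * norm p"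
begin

abbreviation "L \<equiv> Lag H"

lemma H_bounded:
  obtains B where "\<And>x p. norm p \<le> K \<Longrightarrow> \<bar>H x p\<bar> \<le> B"
proof -
  have "compact ((\<lambda>z. H (fst z) (snd z)) ` (cbox 0 1 \<times> cball 0 K))"
    using H_cont
    by (intro compact_continuous_image compact_Times) (auto intro: continuous_on_subset)
  then obtain B where B: "\<And>y. y \<in> (\<lambda>z. H (fst z) (snd z)) ` (cbox 0 1 \<times> cball 0 K) \<Longrightarrow> \<bar>y\<bar> \<le> B"
    by (meson bounded_real compact_imp_bounded)
  have "\<bar>H x p\<bar> \<le> B" if "norm p \<le> K" for x p
  proof -
    have "H (frac_vec x) p \<in> (\<lambda>z. H (fst z) (snd z)) ` (cbox 0 1 \<times> cball 0 K)"
      using frac_vec_in_cbox[of x] that by (intro image_eqI[where x="(frac_vec x, p)"]) auto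
    then show ?thesis using B periodic_frac_vec[OF H_periodic, of x p] by metis
  qed
  then show ?thesis by (rule that)
qed

lemma H_uniform:
  assumes "e > 0"
  obtains d where "d > 0" "\<And>x y p. norm p \<le> K \<Longrightarrow> dist x y < d \<Longrightarrow> \<bar>H x p - H y p\<bar> < e"
proof -
  let ?C = "cbox (-1) 2 \<times> cball 0 K :: ((real^'n) \<times> (real^'n)) set"
  have "uniformly_continuous_on ?C (\<lambda>z. H (fst z) (snd z))"
    using H_cont by (intro compact_uniformly_continuous compact_Times) (auto intro: continuous_on_subset)
  then obtain d where d: "d > 0" "\<And>z z'. z \<in> ?C \<Longrightarrow> z' \<in> ?C \<Longrightarrow> dist z' z < d \<Longrightarrow>
      dist (H (fst z') (snd z')) (H (fst z) (snd z)) < e"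
    using assms unfolding uniformly_continuous_on_def by metis
  have "\<bar>H x p - H y p\<bar> < e" if p: "norm p \<le> K" and xy: "dist x y < min d 1" for x y p
  proof -
    obtain k where k: "k \<in> Zlat" "x + k \<in> cbox (-1) 2" "y + k \<in> cbox (-1) 2"
      using common_translate[of x y] xy by auto
    have "dist (H (x + k) p) (H (y + k) p) < e"
      using d(2)[of "(y + k, p)" "(x + k, p)"] k p xy by (simp add: dist_norm norm_Pair)
    then show ?thesis using H_periodic[of p] k(1) by (simp add: periodic_fun_def dist_real_def)
  qed
  then show ?thesis using d(1) by (intro that[of "min d 1"]) auto
qed

text \<open>Makes the \<open>SUP\<close> in \<open>Lag\<close> a genuine supremum rather than a
  default value. Superlinearity with slope \<open>norm q\<close> makes the expression nonpositive
  outside a ball.\<close>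

lemma Lag_bdd_above: "bdd_above (range (\<lambda>p. p \<bullet> q - H x p))"
proof -
  obtain R where R: "\<And>x p. norm p \<ge> R \<Longrightarrow> H x p \<ge> norm q * norm p" using H_superlinear by meson
  obtain B where B: "\<And>x p. norm p \<le> R \<Longrightarrow> \<bar>H x p\<bar> \<le> B" using H_bounded by blast
  have "p \<bullet> q - H x p \<le> max 0 (R * norm q + B)" for p
  proof (cases "norm p \<ge> R")
    case True
    then show ?thesis using R[of p x] norm_cauchy_schwarz[of p q] by (simp add: mult.commute)
  next
    case False
    then have "p \<bullet> q \<le> R * norm q"
      using norm_cauchy_schwarz[of p q] by (smt (verit) mult_right_mono norm_ge_zero)
    then show ?thesis using B[of p x] False by auto
  qed
  then show ?thesis by (intro bdd_aboveI2)
qed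

lemma fenchel: "p \<bullet> q \<le> L x q + H x p"
  using cSUP_upper[OF _ Lag_bdd_above, of p q x] unfolding Lag_def by simp

lemma Lag_least: "(\<And>p. p \<bullet> q - H x p \<le> c) \<Longrightarrow> L x q \<le> c"
  unfolding Lag_def by (intro cSUP_least) auto

lemma Lag_periodic: "periodic_fun (\<lambda>x. L x q)"
  unfolding periodic_fun_def Lag_def using H_periodic unfolding periodic_fun_def by simp

text \<open>A subgradient of \<open>H x\<close> at \<open>p\<close>, supplied by
  \<open>H_subgrad\<close>, attains equality in Fenchel's inequality. Testing the subgradient
  inequality at \<open>p + sgn q\<close> bounds \<open>norm q\<close> by the oscillation of
  \<open>H\<close> on a ball, hence uniformly in \<open>x\<close>.\<close>

lemma Lag_conj:
  obtains R where "\<And>x p. norm p \<le> K \<Longrightarrow> \<exists>q. norm q \<le> R \<and> H x p + L x q \<le> p \<bullet> q"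
proof -
  obtain B where B: "\<And>x p. norm p \<le> K + 1 \<Longrightarrow> \<bar>H x p\<bar> \<le> B" using H_bounded by blast
  have "\<exists>q. norm q \<le> 2 * B \<and> H x p + L x q \<le> p \<bullet> q" if p: "norm p \<le> K" for x p
  proof -
    obtain q where q: "\<And>p'. H x p + q \<bullet> (p' - p) \<le> H x p'" using H_subgrad by meson
    have "norm q \<le> 2 * B"
    proof -
      have "norm (p + sgn q) \<le> K + 1"
        using norm_triangle_ineq[of p "sgn q"] p by (simp add: norm_sgn split: if_splits)
      moreover have "q \<bullet> sgn q = norm q"
        by (cases "q = 0") (simp_all add: sgn_div_norm power2_norm_eq_inner[symmetric] power2_eq_square)
      ultimately show ?thesis
        using q[of "p + sgn q"] B[of p x] B[of "p + sgn q" x] p by simp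
    qed
    moreover have "L x q \<le> p \<bullet> q - H x p"
      using q by (intro Lag_least) (simp add: algebra_simps inner_commute)
    ultimately show ?thesis by (intro exI[of _ q]) auto
  qed
  then show ?thesis by (rule that)
qed

text \<open>The slope \<open>R + 1\<close> beats the velocity bound \<open>R\<close> with
  \<open>norm p\<close> to spare, which pushes the value below \<open>- H y 0\<close>, a lower bound
  of \<open>L y q'\<close>. So only bounded momenta count when values of \<open>L\<close> are
  compared, and moduli of \<open>H\<close> on compact sets carry over to \<open>L\<close>.\<close>

lemma Lag_effective_momenta:
  obtains P where "\<And>x y p q q'. norm q \<le> R \<Longrightarrow> norm p > P \<Longrightarrow> p \<bullet> q - H x p \<le> L y q'"
proof -
  obtain B where B: "\<And>x p. norm p \<le> 0 \<Longrightarrow> \<bar>H x p\<bar> \<le> B" using H_bounded by blast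
  obtain P where P: "\<And>x p. norm p \<ge> P \<Longrightarrow> H x p \<ge> (R + 1) * norm p" using H_superlinear by meson
  have "p \<bullet> q - H x p \<le> L y q'" if "norm q \<le> R" "norm p > max P B" for x y p q q'
  proof -
    have "p \<bullet> q \<le> R * norm p"
      using norm_cauchy_schwarz[of p q] that(1)
      by (smt (verit) mult.commute mult_right_mono norm_ge_zero)
    moreover have "H x p \<ge> (R + 1) * norm p" using P that by simp
    moreover have "- B \<le> L y q'" using fenchel[of 0 q' y] B[of 0 y] by simp
    ultimately show ?thesis using that(2) by (simp add: algebra_simps)
  qed
  then show ?thesis by (rule that)
qed

lemma Lag_uniform:
  assumes "e > 0"
  obtains d where "d > 0" "\<And>x y q. norm q \<le> R \<Longrightarrow> dist x y < d \<Longrightarrow> L x q \<le> L y q + e"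
proof -
  obtain P where P: "\<And>x y p q q'. norm q \<le> R \<Longrightarrow> norm p > P \<Longrightarrow> p \<bullet> q - H x p \<le> L y q'"
    using Lag_effective_momenta by metis
  obtain d where d: "d > 0" "\<And>x y p. norm p \<le> P \<Longrightarrow> dist x y < d \<Longrightarrow> \<bar>H x p - H y p\<bar> < e"
    using H_uniform assms by blast
  have "L x q \<le> L y q + e" if "norm q \<le> R" "dist x y < d" for x y q
  proof (rule Lag_least)
    fix p
    show "p \<bullet> q - H x p \<le> L y q + e"
      using P[OF that(1), of p x y q] d(2)[of p x y] that(2) fenchel[of p q y] assms
      by (cases "norm p > P") auto
  qed
  then show ?thesis using d(1) that by blast
qed

lemma Lag_lipschitz_velocity:
  obtains P where "P \<ge> 0" "\<And>x q q'. norm q \<le> R \<Longrightarrow> L x q \<le> L x q' + P * norm (q - q')"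
proof -
  obtain P where P: "\<And>x y p q q'. norm q \<le> R \<Longrightarrow> norm p > P \<Longrightarrow> p \<bullet> q - H x p \<le> L y q'"
    using Lag_effective_momenta by metis
  have "L x q \<le> L x q' + max 0 P * norm (q - q')" if "norm q \<le> R" for x q q'
  proof (rule Lag_least)
    fix p
    have nn: "0 \<le> max 0 P * norm (q - q')" by simp
    show "p \<bullet> q - H x p \<le> L x q' + max 0 P * norm (q - q')"
    proof (cases "norm p > P")
      case True
      then show ?thesis using P[OF that True, of x x q'] nn by linarith
    next
      case False
      have "p \<bullet> q = p \<bullet> q' + p \<bullet> (q - q')" by (simp add: inner_diff_right)
      moreover have "norm p * norm (q - q') \<le> max 0 P * norm (q - q')"
        using False by (intro mult_right_mono) auto
      ultimately show ?thesis
        using fenchel[of p q' x] norm_cauchy_schwarz[of p "q - q'"] by linarith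
    qed
  qed
  then show ?thesis using that[of "max 0 P"] by simp
qed

lemma Lag_bounded:
  obtains B where "\<And>x q. norm q \<le> R \<Longrightarrow> \<bar>L x q\<bar> \<le> B"
proof -
  obtain B where B: "\<And>x p. norm p \<le> 0 \<Longrightarrow> \<bar>H x p\<bar> \<le> B" using H_bounded by blast
  obtain P where P: "\<And>x p. norm p \<ge> P \<Longrightarrow> H x p \<ge> R * norm p" using H_superlinear by meson
  obtain B' where B': "\<And>x p. norm p \<le> P \<Longrightarrow> \<bar>H x p\<bar> \<le> B'" using H_bounded by blast
  have "\<bar>L x q\<bar> \<le> max B (max 0 (P * R + B'))" if q: "norm q \<le> R" for x q
  proof -
    have "L x q \<le> max 0 (P * R + B')"
    proof (rule Lag_least)
      fix p
      have pq: "p \<bullet> q \<le> norm p * R"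
        using norm_cauchy_schwarz[of p q] q by (smt (verit) mult_left_mono norm_ge_zero)
      have R0: "R \<ge> 0" using q norm_ge_zero[of q] by linarith
      show "p \<bullet> q - H x p \<le> max 0 (P * R + B')"
      proof (cases "norm p \<ge> P")
        case True then show ?thesis using P[of p x] pq by (simp add: mult.commute)
      next
        case False
        then have "norm p * R \<le> P * R" using R0 by (intro mult_right_mono) auto
        then show ?thesis using pq B'[of p x] False by auto
      qed
    qed
    moreover have "- B \<le> L x q" using fenchel[of 0 q x] B[of 0 x] by simp
    ultimately show ?thesis by (smt (verit))
  qed
  then show ?thesis by (rule that)
qed

text \<open>Joint continuity makes \<open>L\<close> an admissible integrand for weak limits of
  empirical measures of points and velocities.\<close>

lemma Lag_cont: "continuous_on UNIV (\<lambda>z. L (fst z) (snd z))"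
proof -
  have "\<exists>d>0. \<forall>z'. dist z' z < d \<longrightarrow> dist (L (fst z') (snd z')) (L (fst z) (snd z)) < e"
    if e: "e > 0" for z e
  proof -
    let ?R = "norm (snd z) + 1"
    obtain d where d: "d > 0" "\<And>x y q. norm q \<le> ?R \<Longrightarrow> dist x y < d \<Longrightarrow> L x q \<le> L y q + e/4"
      using Lag_uniform[of "e/4" ?R] e by auto
    obtain P where P: "P \<ge> 0" "\<And>x q q'. norm q \<le> ?R \<Longrightarrow> L x q \<le> L x q' + P * norm (q - q')"
      using Lag_lipschitz_velocity by blast
    have "dist (L (fst z') (snd z')) (L (fst z) (snd z)) < e"
      if z': "dist z' z < min d (min 1 (e / (4 * (P + 1))))" for z'
    proof -
      have a: "dist (fst z') (fst z) < d" "dist (snd z') (snd z) < 1" "dist (snd z') (snd z) < e / (4 * (P + 1))"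
        using z' dist_fst_le[of z' z] dist_snd_le[of z' z] by auto
      have n: "norm (snd z') \<le> ?R" "norm (snd z) \<le> ?R"
        using a(2) norm_triangle_sub[of "snd z'" "snd z"] by (auto simp: dist_norm)
      have "P * norm (snd z' - snd z) \<le> (P + 1) * (e / (4 * (P + 1)))"
        using a(3) P(1) by (intro mult_mono) (auto simp: dist_norm)
      also have "\<dots> = e / 4" using P(1) by (simp add: field_simps)
      finally have s: "P * norm (snd z' - snd z) \<le> e/4" .
      have "L (fst z') (snd z') \<le> L (fst z) (snd z') + e/4" "L (fst z) (snd z') \<le> L (fst z') (snd z') + e/4"
        using d(2)[OF n(1)] a(1) by (auto simp: dist_commute)
      moreover have "L (fst z) (snd z') \<le> L (fst z) (snd z) + e/4" "L (fst z) (snd z) \<le> L (fst z) (snd z') + e/4"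
        using P(2)[OF n(1), of "fst z" "snd z"] P(2)[OF n(2), of "fst z" "snd z'"] s by (auto simp: norm_minus_commute)
      ultimately show ?thesis using e unfolding dist_real_def by linarith
    qed
    then show ?thesis
      using d(1) P(1) e by (intro exI[of _ "min d (min 1 (e / (4 * (P + 1))))"]) auto
  qed
  then show ?thesis unfolding continuous_on_iff by simp
qed

end

section \<open>Subsolutions and domination along segments\<close>

lemma has_derivative_quadratic_bound:
  fixes f :: "'a::real_normed_vector \<Rightarrow> 'b::real_normed_vector"
  assumes "bounded_linear D" "\<And>h. norm (f (x + h) - f x - D h) \<le> C * (norm h)\<^sup>2"
  shows "(f has_derivative D) (at x)"
proof -
  have "((\<lambda>h. norm (f (x + h) - f x - D h) / norm h) \<longlongrightarrow> 0) (at 0)"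
  proof (rule Lim_null_comparison)
    show "\<forall>\<^sub>F h in at 0. norm (norm (f (x + h) - f x - D h) / norm h) \<le> C * norm h"
    proof (rule eventually_at_filter[THEN iffD2], rule always_eventually, intro allI impI)
      fix h :: 'a assume "h \<noteq> 0"
      then show "norm (norm (f (x + h) - f x - D h) / norm h) \<le> C * norm h"
        using assms(2)[of h] by (simp add: divide_le_eq power2_eq_square mult.assoc)
    qed
    show "((\<lambda>h. C * norm h) \<longlongrightarrow> 0) (at 0)" by (auto intro!: tendsto_eq_intros)
  qed
  then show ?thesis using assms(1) by (simp add: has_derivative_at)
qed

text \<open>A C^1 function that vanishes up to a threshold and grows after it: the one-sided time
  barrier of the viscosity tests, and the profile of the mollification kernel.\<close>

lemma has_derivative_max0_power2 [derivative_intros]: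
  fixes g :: "'a::real_normed_vector \<Rightarrow> real"
  assumes "(g has_derivative g') (at x within S)"
  shows "((\<lambda>x. (max 0 (g x))\<^sup>2) has_derivative (\<lambda>h. 2 * max 0 (g x) * g' h)) (at x within S)"
proof -
  have "((\<lambda>s::real. (max 0 s)\<^sup>2) has_derivative (\<lambda>h. 2 * max 0 t * h)) (at t)" for t
  proof (rule has_derivative_quadratic_bound[where C=1])
    show "bounded_linear (\<lambda>h. 2 * max 0 t * h)" by (intro bounded_linear_mult_right)
    fix h :: real
    have 1: "(t + h)\<^sup>2 - t\<^sup>2 - 2 * t * h = h\<^sup>2" by (simp add: power2_eq_square algebra_simps)
    have 2: "t\<^sup>2 \<le> h\<^sup>2" "- t\<^sup>2 - 2 * t * h \<le> h\<^sup>2" "0 \<le> - t\<^sup>2 - 2 * t * h" if "t \<ge> 0" "t + h \<le> 0"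
    proof -
      show "t\<^sup>2 \<le> h\<^sup>2" using that by (intro abs_le_square_iff[THEN iffD1]) simp
      show "- t\<^sup>2 - 2 * t * h \<le> h\<^sup>2" using 1 zero_le_power2[of "t+h"] by linarith
      have "t * (t + 2 * h) \<le> 0" using that by (intro mult_nonneg_nonpos) auto
      then show "0 \<le> - t\<^sup>2 - 2 * t * h" by (simp add: power2_eq_square algebra_simps)
    qed
    have 3: "(t + h)\<^sup>2 \<le> h\<^sup>2" if "t \<le> 0" "t + h \<ge> 0"
      using that by (intro abs_le_square_iff[THEN iffD1]) simp
    show "norm ((max 0 (t + h))\<^sup>2 - (max 0 t)\<^sup>2 - 2 * max 0 t * h) \<le> 1 * (norm h)\<^sup>2"
      using 1 2 3 by (cases "t \<ge> 0"; cases "t + h \<ge> 0") (auto simp: max_def)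
  qed
  from has_derivative_compose[OF assms this] show ?thesis by simp
qed

text \<open>A bound \<open>c\<close> for \<open>L\<close> on the whole segment replaces the action
  integral, so curves never have to be integrated. There are two functions because \<open>a\<close>
  and \<open>b\<close> may be slices of an evolution at different times.\<close>

definition step_dom ::
  "(real^'n \<Rightarrow> real^'n \<Rightarrow> real) \<Rightarrow> real \<Rightarrow> (real^'n \<Rightarrow> real) \<Rightarrow> (real^'n \<Rightarrow> real) \<Rightarrow> bool" where
  "step_dom H t a b \<longleftrightarrow>
     (\<forall>x q c. (\<forall>s\<in>{0..t}. Lag H (x + s *\<^sub>R q) q \<le> c) \<longrightarrow> b (x + t *\<^sub>R q) \<le> a x + c * t)"

definition dominated :: "(real^'n \<Rightarrow> real^'n \<Rightarrow> real) \<Rightarrow> (real^'n \<Rightarrow> real) \<Rightarrow> bool" where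
  "dominated H v \<longleftrightarrow> (\<forall>t\<ge>0. step_dom H t v v)"

text \<open>The subsolution half of \<open>visc_sol_cauchy\<close>, isolated so that
  time-independent subsolutions fall under the same domination argument.\<close>

definition cauchy_sub ::
  "(real^'n \<Rightarrow> real^'n \<Rightarrow> real) \<Rightarrow> (real^'n \<Rightarrow> real \<Rightarrow> real) \<Rightarrow> bool" where
  "cauchy_sub H u \<longleftrightarrow>
     continuous_on (UNIV \<times> {0..}) (\<lambda>z. u (fst z) (snd z))
     \<and> (\<forall>\<phi> gx gt x t. C1_grad_time \<phi> gx gt \<and> t > 0 \<and>
          (\<exists>e>0. \<forall>y s. s > 0 \<and> dist (y, s) (x, t) < e \<longrightarrow> u y s - \<phi> y s \<le> u x t - \<phi> x t)
          \<longrightarrow> gt x t + H x (gx x t) \<le> 0)"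

lemma step_domD:
  "step_dom H t a b \<Longrightarrow> (\<And>s. 0 \<le> s \<Longrightarrow> s \<le> t \<Longrightarrow> Lag H (x + s *\<^sub>R q) q \<le> c) \<Longrightarrow> b (x + t *\<^sub>R q) \<le> a x + c * t"
  unfolding step_dom_def by simp

context superlinear_hamiltonian
begin

text \<open>In the frame moving with velocity \<open>q\<close>, failure means that \<open>u\<close>
  minus \<open>(c + \<eta>) * s\<close> is larger at \<open>s = \<tau>\<close> than at
  \<open>s = 0\<close>. A penalized maximum then lies inside a thin tube around the segment, where
  the viscosity inequality and \<open>fenchel\<close> force \<open>L \<ge> c + \<eta>\<close>,
  against the choice of the tube.\<close>

lemma cauchy_sub_step_pos:
  assumes u: "cauchy_sub H u" and t0: "t0 > 0" and \<tau>: "\<tau> > 0"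
    and c: "\<And>s. 0 \<le> s \<Longrightarrow> s \<le> \<tau> \<Longrightarrow> L (x0 + s *\<^sub>R q) q \<le> c"
  shows "u (x0 + \<tau> *\<^sub>R q) (t0 + \<tau>) \<le> u x0 t0 + c * \<tau>"
proof (rule ccontr)
  assume neg: "\<not> ?thesis"
  \<comment> \<open>Half of the excess; the other half pays for raising the slope from
    \<open>c\<close> to \<open>c + \<eta>\<close>.\<close>
  define \<beta> where "\<beta> = (u (x0 + \<tau> *\<^sub>R q) (t0 + \<tau>) - u x0 t0 - c * \<tau>) / 2"
  define \<eta> where "\<eta> = \<beta> / \<tau>"
  have \<beta>: "\<beta> > 0" using neg by (simp add: \<beta>_def)
  have \<eta>: "\<eta> > 0" using \<beta> \<tau> by (simp add: \<eta>_def)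
  have fin: "u (x0 + \<tau> *\<^sub>R q) (t0 + \<tau>) - (c + \<eta>) * \<tau> = u x0 t0 + \<beta>"
    using \<tau> by (simp add: \<eta>_def \<beta>_def field_simps)
  have ucont: "continuous_on (UNIV \<times> {0..}) (\<lambda>z. u (fst z) (snd z))"
    using u by (simp add: cauchy_sub_def)
  obtain d where d: "d > 0" "\<And>x y q'. norm q' \<le> norm q \<Longrightarrow> dist x y < d \<Longrightarrow> L x q' \<le> L y q' + \<eta>/2"
    using Lag_uniform[of "\<eta>/2" "norm q"] \<eta> by auto
  obtain d' where d': "d' > 0" "\<And>y. dist y x0 < d' \<Longrightarrow> dist (u y t0) (u x0 t0) < \<beta>"
  proof -
    obtain e where "e > 0" and e: "\<And>z. z \<in> UNIV \<times> {0..} \<Longrightarrow> dist z (x0, t0) < e \<Longrightarrow>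
        dist (u (fst z) (snd z)) (u (fst (x0,t0)) (snd (x0,t0))) < \<beta>"
      using ucont[unfolded continuous_on_iff, rule_format, of "(x0,t0)" \<beta>] t0 \<beta> by auto
    show thesis
      using e[of "(_, t0)"] t0 \<open>e > 0\<close> by (intro that[of e]) (auto simp: dist_Pair_Pair)
  qed
  \<comment> \<open>The tube has radius \<open>r\<close> and overshoots the final time by
    \<open>r\<close>. The first bound keeps \<open>L\<close> below \<open>c + \<eta>\<close> in it,
    the second controls its initial face.\<close>
  define r where "r = min (d / (2 * (1 + norm q))) (d' / 2)"
  have nq: "1 + norm q > 0" by (smt (verit) norm_ge_zero)
  have r: "r > 0" "r < d'" "r * (1 + norm q) < d"
  proof -
    show "r > 0" "r < d'" using d(1) d'(1) nq by (auto simp: r_def)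
    have "r * (1 + norm q) \<le> d / (2 * (1 + norm q)) * (1 + norm q)"
      unfolding r_def using nq by (intro mult_right_mono) auto
    also have "\<dots> = d / 2" using nq by (simp add: field_simps)
    finally show "r * (1 + norm q) < d" using d(1) by simp
  qed
  have Lc: "L (x0 + s *\<^sub>R q + z) q < c + \<eta>" if "0 \<le> s" "s \<le> \<tau> + r" "norm z \<le> r" for s z
  proof -
    have "dist (x0 + s *\<^sub>R q + z) (x0 + (min s \<tau>) *\<^sub>R q) = norm (z + (s - min s \<tau>) *\<^sub>R q)"
      by (simp add: dist_norm algebra_simps)
    also have "\<dots> \<le> norm z + \<bar>s - min s \<tau>\<bar> * norm q"
      using norm_triangle_ineq[of z "(s - min s \<tau>) *\<^sub>R q"] by simp
    also have "\<dots> \<le> r + r * norm q"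
      using that r(1) by (intro add_mono mult_right_mono) (auto simp: min_def)
    also have "\<dots> < d" using r(3) by (simp add: algebra_simps)
    finally have "L (x0 + s *\<^sub>R q + z) q \<le> L (x0 + (min s \<tau>) *\<^sub>R q) q + \<eta>/2" by (intro d(2)) auto
    also have "\<dots> \<le> c + \<eta>/2" using c[of "min s \<tau>"] that \<tau> by simp
    finally show ?thesis using \<eta> by simp
  qed
  let ?C = "cball 0 r \<times> {0..\<tau> + r} :: ((real^'n) \<times> real) set"
  let ?f = "\<lambda>w. u (x0 + snd w *\<^sub>R q + fst w) (t0 + snd w) - (c + \<eta>) * snd w"
  have fcont: "continuous_on ?C ?f"
  proof -
    have "continuous_on ?C (\<lambda>w. (\<lambda>z. u (fst z) (snd z)) (x0 + snd w *\<^sub>R q + fst w, t0 + snd w))"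
      by (rule continuous_on_compose2[OF ucont]) (use t0 in \<open>auto intro!: continuous_intros\<close>)
    then show ?thesis by (auto intro!: continuous_intros)
  qed
  have Ccomp: "compact ?C" by (intro compact_Times) auto
  obtain B where B: "\<And>w. w \<in> ?C \<Longrightarrow> \<bar>?f w\<bar> \<le> B"
    using compact_imp_bounded[OF compact_continuous_image[OF fcont Ccomp]] unfolding bounded_real by blast
  \<comment> \<open>On the lateral and on the final face the penalty equals
    \<open>2 * B + 1\<close>, more than the oscillation of \<open>?f\<close>.\<close>
  define A where "A = (2 * B + 1) / r\<^sup>2"
  have "(0, \<tau>) \<in> ?C" using r \<tau> by simp
  from B[OF this] have B0: "B \<ge> 0" by linarith
  have A: "A > 0" "A * r\<^sup>2 = 2 * B + 1" using r B0 by (auto simp: A_def)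
  let ?P = "\<lambda>w. ?f w - A * (norm (fst w))\<^sup>2 - A * (max 0 (snd w - \<tau>))\<^sup>2"
  have "continuous_on ?C ?P" by (intro continuous_intros fcont)
  then obtain w where w: "w \<in> ?C" "\<And>w'. w' \<in> ?C \<Longrightarrow> ?P w' \<le> ?P w"
    using continuous_attains_sup[OF Ccomp, of ?P] \<open>(0, \<tau>) \<in> ?C\<close> by blast
  obtain z s where zs: "w = (z, s)" by force
  have in1: "norm z \<le> r" "0 \<le> s" "s \<le> \<tau> + r" using w(1) zs by auto
  have low: "?P w \<ge> u x0 t0 + \<beta>" using w(2)[OF \<open>(0, \<tau>) \<in> ?C\<close>] fin by simp
  have fin': "u x0 t0 + \<beta> \<ge> - B" using B[OF \<open>(0, \<tau>) \<in> ?C\<close>] fin by simp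
  have An: "A * (norm z)\<^sup>2 \<ge> 0" "A * (max 0 (s - \<tau>))\<^sup>2 \<ge> 0" using A(1) by auto
  have "s \<noteq> 0"
  proof
    assume s0: "s = 0"
    have "dist (u (x0 + z) t0) (u x0 t0) < \<beta>" using in1 r by (intro d'(2)) (simp add: dist_norm)
    then show False using low An unfolding zs s0 by (auto simp: dist_real_def)
  qed
  then have s0: "s > 0" using in1 by simp
  have fB: "?f w \<le> B" using B[OF w(1)] by linarith
  have "s \<noteq> \<tau> + r"
  proof
    assume "s = \<tau> + r"
    then have "A * (max 0 (s - \<tau>))\<^sup>2 = 2 * B + 1" using A r by simp
    then show False using low An fB fin' unfolding zs by simp
  qed
  then have s1: "s < \<tau> + r" using in1 by simp
  have "norm z \<noteq> r"
  proof
    assume "norm z = r"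
    then have "A * (norm z)\<^sup>2 = 2 * B + 1" using A by simp
    then show False using low An fB fin' unfolding zs by simp
  qed
  then have z1: "norm z < r" using in1 by simp
  \<comment> \<open>The penalties, written back in the coordinates at rest.\<close>
  define \<phi> where "\<phi> = (\<lambda>y t. (c + \<eta>) * (t - t0) + A * ((y - x0 - (t - t0) *\<^sub>R q) \<bullet> (y - x0 - (t - t0) *\<^sub>R q))
      + A * (max 0 (t - t0 - \<tau>))\<^sup>2)"
  define gx where "gx = (\<lambda>y t. (2 * A) *\<^sub>R (y - x0 - (t - t0) *\<^sub>R q))"
  define gt where "gt = (\<lambda>y t. (c + \<eta>) - 2 * A * ((y - x0 - (t - t0) *\<^sub>R q) \<bullet> q) + 2 * A * max 0 (t - t0 - \<tau>))"
  have C1: "C1_grad_time \<phi> gx gt"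
    unfolding C1_grad_time_def
  proof (intro conjI allI)
    fix y :: "real^'n" and t :: real
    show "((\<lambda>z. \<phi> (fst z) (snd z)) has_derivative (\<lambda>z. gx y t \<bullet> fst z + gt y t * snd z)) (at (y, t))"
      unfolding \<phi>_def gx_def gt_def
      by (rule derivative_eq_intros refl | simp)+
         (auto simp: fun_eq_iff algebra_simps inner_diff_left inner_diff_right inner_commute)
  qed (auto simp: gx_def gt_def intro!: continuous_intros)
  let ?y = "x0 + s *\<^sub>R q + z"
  \<comment> \<open>A shift by less than \<open>e\<close> in space and in time moves a point by at
    most \<open>e * (1 + norm q)\<close> in the moving frame, so it stays in the tube.\<close>
  define e where "e = min (min s (\<tau> + r - s)) ((r - norm z) / (1 + norm q))"
  have e: "e > 0" using s0 s1 z1 nq by (simp add: e_def)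
  have "gt ?y (t0 + s) + H ?y (gx ?y (t0 + s)) \<le> 0"
  proof -
    have "u y t - \<phi> y t \<le> u ?y (t0 + s) - \<phi> ?y (t0 + s)" if "dist (y, t) (?y, t0 + s) < e" for y t
    proof -
      let ?z = "y - x0 - (t - t0) *\<^sub>R q"
      have dt: "\<bar>t - t0 - s\<bar> < e" and dy: "norm (y - ?y) < e"
        using that dist_fst_le[of "(y,t)" "(?y, t0+s)"] dist_snd_le[of "(y,t)" "(?y, t0+s)"]
        by (auto simp: dist_norm algebra_simps)
      have "?z = z + (y - ?y) - (t - t0 - s) *\<^sub>R q" by (simp add: algebra_simps)
      then have "norm ?z \<le> norm z + norm (y - ?y) + \<bar>t - t0 - s\<bar> * norm q"
        by (metis (no_types, lifting) norm_scaleR norm_triangle_ineq4 norm_triangle_ineq add.commute add_left_mono order_trans)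
      also have "\<dots> \<le> norm z + e + e * norm q" using dt dy by (intro add_mono mult_right_mono) auto
      also have "\<dots> \<le> r"
      proof -
        have "e \<le> (r - norm z) / (1 + norm q)" unfolding e_def by simp
        then have "e * (1 + norm q) \<le> r - norm z" using nq by (simp add: pos_le_divide_eq)
        then show ?thesis by (simp add: algebra_simps)
      qed
      finally have "(?z, t - t0) \<in> ?C" using dt by (auto simp: e_def)
      from w(2)[OF this] show ?thesis
        unfolding zs \<phi>_def by (simp add: power2_norm_eq_inner algebra_simps)
    qed
    then show ?thesis
      using u C1 e t0 s0 unfolding cauchy_sub_def by (smt (verit, best))
  qed
  then have "c + \<eta> + 2 * A * max 0 (s - \<tau>) \<le> ((2 * A) *\<^sub>R z) \<bullet> q - H ?y ((2 * A) *\<^sub>R z)"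
    unfolding gt_def gx_def by simp
  also have "\<dots> \<le> L ?y q" using fenchel[of "(2 * A) *\<^sub>R z" q ?y] by simp
  also have "\<dots> < c + \<eta>" using Lc in1 by simp
  finally show False using A(1) by (smt (verit) mult_nonneg_nonneg)
qed

text \<open>The starting time \<open>0\<close> is reached by shifting both ends of the time interval
  by \<open>1/(n+1)\<close> and using continuity up to \<open>t = 0\<close>.\<close>

lemma cauchy_sub_step:
  assumes u: "cauchy_sub H u" and t0: "t0 \<ge> 0" and \<tau>: "\<tau> \<ge> 0"
  shows "step_dom H \<tau> (\<lambda>x. u x t0) (\<lambda>x. u x (t0 + \<tau>))"
  unfolding step_dom_def
proof (intro allI impI)
  fix x q c
  assume c: "\<forall>s\<in>{0..\<tau>}. L (x + s *\<^sub>R q) q \<le> c"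
  show "u (x + \<tau> *\<^sub>R q) (t0 + \<tau>) \<le> u x t0 + c * \<tau>"
  proof (cases "\<tau> = 0")
    case False
    then have \<tau>': "\<tau> > 0" using \<tau> by simp
    have ucont: "continuous_on (UNIV \<times> {0..}) (\<lambda>z. u (fst z) (snd z))"
      using u by (simp add: cauchy_sub_def)
    have lim: "(\<lambda>n. u y (t + inverse (real (Suc n)))) \<longlonglongrightarrow> u y t" if "t \<ge> 0" for y t
    proof -
      have "(\<lambda>n. (\<lambda>z. u (fst z) (snd z)) (y, t + inverse (real (Suc n)))) \<longlonglongrightarrow> (\<lambda>z. u (fst z) (snd z)) (y, t + 0)"
        using that LIMSEQ_inverse_real_of_nat
        by (intro continuous_on_tendsto_compose[OF ucont] tendsto_intros) (auto intro!: always_eventually)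
      then show ?thesis by simp
    qed
    have "u (x + \<tau> *\<^sub>R q) ((t0 + \<tau>) + inverse (real (Suc n))) \<le> u x (t0 + inverse (real (Suc n))) + c * \<tau>" for n
      using cauchy_sub_step_pos[OF u, of "t0 + inverse (real (Suc n))" \<tau> x q c] t0 \<tau>' c
      by (simp add: add_ac add_nonneg_pos)
    moreover have "(\<lambda>n. u x (t0 + inverse (real (Suc n))) + c * \<tau>) \<longlonglongrightarrow> u x t0 + c * \<tau>"
      by (intro tendsto_intros lim t0)
    ultimately show ?thesis
      using LIMSEQ_le[OF lim[of "t0 + \<tau>" "x + \<tau> *\<^sub>R q"]] t0 \<tau> by auto
  qed simp
qed

text \<open>Freezing \<open>t\<close> leaves a test function in space. In time the touched function
  is constant, so \<open>\<phi> x\<close> has a local minimum at \<open>t\<close> and the time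
  derivative vanishes.\<close>

lemma visc_sub_imp_cauchy_sub:
  assumes "visc_sub H v"
  shows "cauchy_sub H (\<lambda>x t. v x)"
  unfolding cauchy_sub_def
proof (intro conjI allI impI)
  have vc: "continuous_on UNIV v" using assms by (simp add: visc_sub_def)
  show "continuous_on (UNIV \<times> {0..}) (\<lambda>z. v (fst z))"
    by (rule continuous_on_compose2[OF vc]) (auto intro!: continuous_intros)
next
  fix \<phi> gx gt and x :: "real^'n" and t :: real
  assume a: "C1_grad_time \<phi> gx gt \<and> 0 < t \<and>
    (\<exists>e>0. \<forall>y s. 0 < s \<and> dist (y, s) (x, t) < e \<longrightarrow> v y - \<phi> y s \<le> v x - \<phi> x t)"
  then have C1: "C1_grad_time \<phi> gx gt" and t: "t > 0" by auto
  obtain e where e: "e > 0" "\<And>y s. 0 < s \<Longrightarrow> dist (y, s) (x, t) < e \<Longrightarrow> v y - \<phi> y s \<le> v x - \<phi> x t"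
    using a by auto
  have der: "((\<lambda>z. \<phi> (fst z) (snd z)) has_derivative (\<lambda>z. gx y s \<bullet> fst z + gt y s * snd z)) (at (y, s))" for y s
    using C1 by (simp add: C1_grad_time_def)
  have "((\<lambda>y. \<phi> y t) has_derivative (\<lambda>h. gx y t \<bullet> h)) (at y)" for y
    using has_derivative_compose[of "\<lambda>y. (y, t)" "\<lambda>h. (h, 0)" y UNIV, OF _ der]
    by (simp add: has_derivative_Pair)
  moreover have "continuous_on UNIV (\<lambda>y. gx y t)"
  proof -
    have "continuous_on UNIV (\<lambda>z. gx (fst z) (snd z))" using C1 by (simp add: C1_grad_time_def)
    from continuous_on_compose2[OF this, of UNIV "\<lambda>y. (y, t)"] show ?thesis
      by (simp add: continuous_on_Pair)
  qed
  ultimately have "C1_grad (\<lambda>y. \<phi> y t) (\<lambda>y. gx y t)" by (simp add: C1_grad_def)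
  moreover have "\<exists>e>0. \<forall>y. dist y x < e \<longrightarrow> v y - \<phi> y t \<le> v x - \<phi> x t"
    using e t by (intro exI[of _ e]) (auto simp: dist_Pair_Pair)
  ultimately have "H x (gx x t) \<le> 0" using assms unfolding visc_sub_def by blast
  moreover have "gt x t = 0"
  proof (rule DERIV_local_min)
    have "((\<lambda>s. \<phi> x s) has_derivative (\<lambda>h. gt x t * h)) (at t)"
      using has_derivative_compose[of "\<lambda>s. (x, s)" "\<lambda>h. (0, h)" t UNIV, OF _ der]
      by (simp add: has_derivative_Pair)
    then show "DERIV (\<lambda>s. \<phi> x s) t :> gt x t" by (simp add: has_field_derivative_def)
    show "0 < min e t" using e t by simp
    show "\<forall>y. \<bar>t - y\<bar> < min e t \<longrightarrow> \<phi> x t \<le> \<phi> x y"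
      using e(2)[of _ x] by (auto simp: dist_Pair_Pair dist_real_def)
  qed
  ultimately show "gt x t + H x (gx x t) \<le> 0" by simp
qed

lemma visc_sub_imp_dominated: "visc_sub H v \<Longrightarrow> dominated H v"
  using cauchy_sub_step[OF visc_sub_imp_cauchy_sub, of v 0] by (auto simp: dominated_def)

text \<open>The segment from \<open>y\<close> to \<open>x\<close> is run at unit speed, at a cost
  rate bounded by \<open>L\<close> on the unit ball. The constant depends on \<open>H\<close> alone,
  so that one mollification serves all dominated functions at once.\<close>

lemma dominated_lipschitz:
  obtains K where "K \<ge> 0" "\<And>v x y. dominated H v \<Longrightarrow> \<bar>v x - v y\<bar> \<le> K * norm (x - y)"
proof -
  obtain B where B: "\<And>x q. norm q \<le> 1 \<Longrightarrow> \<bar>L x q\<bar> \<le> B" using Lag_bounded by blast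
  have le: "v x \<le> v y + B * norm (x - y)" if "dominated H v" for v x y
  proof -
    have "norm (sgn (x - y)) \<le> 1" by (simp add: norm_sgn)
    then have "\<And>z. L z (sgn (x - y)) \<le> B" using B abs_le_D1 by blast
    then have "v (y + norm (x - y) *\<^sub>R sgn (x - y)) \<le> v y + B * norm (x - y)"
      using that unfolding dominated_def by (intro step_domD) auto
    then show ?thesis by (cases "x = y") (simp_all add: sgn_div_norm)
  qed
  have "B \<ge> 0" using B[of 0 undefined] by simp
  moreover have "\<bar>v x - v y\<bar> \<le> B * norm (x - y)" if "dominated H v" for v x y
    using le[OF that, of x y] le[OF that, of y x] by (simp add: norm_minus_commute abs_le_iff)
  ultimately show ?thesis by (rule that)
qed

lemma dominated_continuous: assumes "dominated H v" shows "continuous_on UNIV v"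
proof -
  obtain K where K: "K \<ge> 0" "\<And>v x y. dominated H v \<Longrightarrow> \<bar>v x - v y\<bar> \<le> K * norm (x - y)"
    using dominated_lipschitz by blast
  have "K-lipschitz_on UNIV v"
    using K assms by (intro lipschitz_onI) (auto simp: dist_norm)
  then show ?thesis by (rule lipschitz_on_continuous_on)
qed

text \<open>At a point touched from above, domination along short segments arriving with velocity
  \<open>q\<close> gives \<open>g x \<bullet> q \<le> L x q\<close>. The single velocity conjugate
  to \<open>g x\<close> suffices, since it turns this into \<open>H x (g x) \<le> 0\<close>.\<close>

lemma dominated_imp_visc_sub:
  assumes dom: "dominated H v" and per: "periodic_fun v"
  shows "visc_sub H v"
  unfolding visc_sub_def
proof (intro conjI allI impI)
  fix \<phi> g x
  assume a: "C1_grad \<phi> g \<and> (\<exists>e>0. \<forall>y. dist y x < e \<longrightarrow> v y - \<phi> y \<le> v x - \<phi> x)"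
  then obtain e where e: "e > 0" "\<And>y. dist y x < e \<Longrightarrow> v y - \<phi> y \<le> v x - \<phi> x" by auto
  have der: "(\<phi> has_derivative (\<lambda>h. g x \<bullet> h)) (at x)" using a by (simp add: C1_grad_def)
  obtain q where q: "H x (g x) + L x q \<le> g x \<bullet> q" using Lag_conj[of "norm (g x)"] by blast
  have "g x \<bullet> q \<le> L x q"
  proof (rule field_le_epsilon)
    fix \<eta> :: real assume \<eta>: "\<eta> > 0"
    obtain d where d: "d > 0" "\<And>x y q'. norm q' \<le> norm q \<Longrightarrow> dist x y < d \<Longrightarrow> L x q' \<le> L y q' + \<eta>"
      using Lag_uniform[of \<eta> "norm q"] \<eta> by auto
    show "g x \<bullet> q \<le> L x q + \<eta>"
    proof (rule ccontr)
      assume n: "\<not> ?thesis"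
      \<comment> \<open>If this function increases at 0, then backwards along the segment
        \<open>\<phi>\<close> falls faster than domination allows \<open>v\<close> to fall, although
        \<open>\<phi>\<close> touches \<open>v\<close> from above.\<close>
      let ?f = "\<lambda>t. - \<phi> (x - t *\<^sub>R q) - (L x q + \<eta>) * t"
      have "((\<lambda>t. \<phi> (x - t *\<^sub>R q)) has_derivative (\<lambda>t. g x \<bullet> (- t *\<^sub>R q))) (at 0)"
        using der by (intro has_derivative_compose[of "\<lambda>t. x - t *\<^sub>R q" "\<lambda>t. - t *\<^sub>R q" 0 UNIV \<phi>])
          (auto intro!: derivative_eq_intros)
      then have "DERIV ?f 0 :> g x \<bullet> q - (L x q + \<eta>)"
        unfolding has_field_derivative_def by (auto intro!: derivative_eq_intros simp: algebra_simps)
      from DERIV_pos_inc_right[OF this] n obtain d' where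
        d': "d' > 0" "\<And>h. h > 0 \<Longrightarrow> h < d' \<Longrightarrow> ?f h > ?f 0" by auto
      \<comment> \<open>Small enough for the segment to stay where \<open>\<phi>\<close> touches
        \<open>v\<close> (radius \<open>e\<close>) and where \<open>L\<close> varies by at most
        \<open>\<eta>\<close> (radius \<open>d\<close>).\<close>
      define h where "h = min (d'/2) (min d e / (2 * (norm q + 1)))"
      have nq: "norm q + 1 > 0" by (smt (verit) norm_ge_zero)
      have h: "h > 0" "h < d'" using d'(1) d(1) e(1) nq by (auto simp: h_def)
      have hq: "h * norm q < min d e"
      proof -
        have "h * norm q \<le> h * (norm q + 1)" using h by (intro mult_left_mono) auto
        also have "\<dots> \<le> min d e / (2 * (norm q + 1)) * (norm q + 1)"
          using nq unfolding h_def by (intro mult_right_mono) auto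
        also have "\<dots> = min d e / 2" using nq by (simp add: field_simps)
        also have "\<dots> < min d e" using d(1) e(1) by (simp add: min_def)
        finally show ?thesis .
      qed
      have "v ((x - h *\<^sub>R q) + h *\<^sub>R q) \<le> v (x - h *\<^sub>R q) + (L x q + \<eta>) * h"
      proof (rule step_domD)
        show "step_dom H h v v" using dom h by (simp add: dominated_def)
        fix s assume s: "0 \<le> s" "s \<le> h"
        have "dist (x - h *\<^sub>R q + s *\<^sub>R q) x = (h - s) * norm q"
          using s by (simp add: dist_norm algebra_simps flip: scaleR_diff_left)
        also have "\<dots> \<le> h * norm q" using s by (intro mult_right_mono) auto
        finally show "L (x - h *\<^sub>R q + s *\<^sub>R q) q \<le> L x q + \<eta>" using hq by (intro d(2)) auto
      qed
      moreover have "v (x - h *\<^sub>R q) - \<phi> (x - h *\<^sub>R q) \<le> v x - \<phi> x"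
        using hq h by (intro e(2)) (simp add: dist_norm)
      ultimately show False using d'(2)[OF h] by simp
    qed
  qed
  then show "H x (g x) \<le> 0" using q by simp
qed (use assms dominated_continuous in auto)

end

section \<open>Mollification\<close>

text \<open>A C^1 kernel is enough: one derivative on the kernel and the Lipschitz bound on the
  function together give a Lipschitz gradient. Integrals are taken over a cube containing the
  support.\<close>

locale mollifier =
  fixes k :: "real^'n \<Rightarrow> real" and dk :: "real^'n \<Rightarrow> real^'n" and \<epsilon> :: real
  assumes eps_pos: "\<epsilon> > 0"
    and k_nonneg: "\<And>z. k z \<ge> 0"
    and k_supp: "\<And>z. norm z \<ge> \<epsilon> \<Longrightarrow> k z = 0"
    and dk_supp: "\<And>z. norm z \<ge> \<epsilon> \<Longrightarrow> dk z = 0"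
    and k_deriv: "\<And>z. (k has_derivative (\<lambda>h. dk z \<bullet> h)) (at z)"
    and dk_cont: "continuous_on UNIV dk"
    and k_int: "integral (cbox (- \<epsilon> *\<^sub>R One) (\<epsilon> *\<^sub>R One)) k = 1"
begin

abbreviation "Q \<equiv> cbox (- \<epsilon> *\<^sub>R One) (\<epsilon> *\<^sub>R One) :: (real^'n) set"

definition moll :: "(real^'n \<Rightarrow> real) \<Rightarrow> real^'n \<Rightarrow> real" where
  "moll a x = integral Q (\<lambda>z. k z * a (x + z))"

text \<open>The minus sign comes from the substitution \<open>y = x + z\<close>, which moves the
  dependence on \<open>x\<close> into \<open>k (y - x)\<close>.\<close>

definition moll_grad :: "(real^'n \<Rightarrow> real) \<Rightarrow> real^'n \<Rightarrow> real^'n" where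
  "moll_grad a x = - integral Q (\<lambda>z. a (x + z) *\<^sub>R dk z)"

lemma k_cont: "continuous_on UNIV k"
  by (intro continuous_at_imp_continuous_on ballI has_derivative_continuous[OF k_deriv])

lemma outside_Q: "z \<notin> Q \<Longrightarrow> norm z \<ge> \<epsilon>"
proof (rule ccontr)
  assume z: "z \<notin> Q" and n: "\<not> norm z \<ge> \<epsilon>"
  have "- \<epsilon> \<le> z \<bullet> b \<and> z \<bullet> b \<le> \<epsilon>" if "b \<in> Basis" for b
    using Basis_le_norm[OF that, of z] n by linarith
  then show False using z by (auto simp: mem_box)
qed

lemma cont_shift: "continuous_on UNIV a \<Longrightarrow> continuous_on S (\<lambda>z. a (x + z))"
  for a :: "real^'n \<Rightarrow> 'b::topological_space"
  by (rule continuous_on_compose2[of UNIV a]) (auto intro!: continuous_intros)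

text \<open>Differentiation under the integral sign needs a domain that does not move with
  \<open>x\<close>. For \<open>x\<close> near \<open>x0\<close> the shifted cube lies in a cube of
  twice the size around \<open>x0\<close>, and the integrand vanishes on the difference.\<close>

lemma kernel_integral_shift:
  fixes F :: "real^'n \<Rightarrow> real^'n \<Rightarrow> 'b::euclidean_space"
  assumes F: "continuous_on UNIV (\<lambda>z. F z (x + z))" "\<And>z y. norm z \<ge> \<epsilon> \<Longrightarrow> F z y = 0"
    and x: "norm (x - x0) \<le> \<epsilon>"
  shows "integral Q (\<lambda>z. F z (x + z))
       = integral (cbox (x0 - (2 * \<epsilon>) *\<^sub>R One) (x0 + (2 * \<epsilon>) *\<^sub>R One)) (\<lambda>y. F (y - x) y)"
proof -
  let ?I = "integral Q (\<lambda>z. F z (x + z))"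
  have "(\<lambda>z. F z (x + z)) integrable_on Q"
    using F(1) by (intro integrable_continuous) (auto intro: continuous_on_subset)
  then have "((\<lambda>z. F z (x + z)) has_integral ?I) Q" by (rule integrable_integral)
  from has_integral_shift_cbox[OF this, of "-x"]
  have "((\<lambda>y. F (y - x) y) has_integral ?I) (cbox (- \<epsilon> *\<^sub>R One + x) (\<epsilon> *\<^sub>R One + x))" by simp
  then have "((\<lambda>y. F (y - x) y) has_integral ?I)
      (cbox (x0 - (2 * \<epsilon>) *\<^sub>R One) (x0 + (2 * \<epsilon>) *\<^sub>R One))"
  proof (rule has_integral_on_superset)
    fix y assume y: "y \<notin> cbox (- \<epsilon> *\<^sub>R One + x) (\<epsilon> *\<^sub>R One + x)"
    have "y - x \<notin> Q"
    proof
      assume "y - x \<in> Q"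
      then have "y \<in> cbox (- \<epsilon> *\<^sub>R One + x) (\<epsilon> *\<^sub>R One + x)"
        unfolding mem_box by (auto simp: algebra_simps)
      then show False using y by simp
    qed
    from F(2)[OF outside_Q[OF this]] show "F (y - x) y = 0" .
  next
    show "cbox (- \<epsilon> *\<^sub>R One + x) (\<epsilon> *\<^sub>R One + x) \<subseteq> cbox (x0 - (2 * \<epsilon>) *\<^sub>R One) (x0 + (2 * \<epsilon>) *\<^sub>R One)"
    proof
      fix y assume y: "y \<in> cbox (- \<epsilon> *\<^sub>R One + x) (\<epsilon> *\<^sub>R One + x)"
      have "(x0 - (2 * \<epsilon>) *\<^sub>R One) \<bullet> b \<le> y \<bullet> b \<and> y \<bullet> b \<le> (x0 + (2 * \<epsilon>) *\<^sub>R One) \<bullet> b"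
        if b: "b \<in> Basis" for b :: "real^'n"
      proof -
        have "\<bar>x \<bullet> b - x0 \<bullet> b\<bar> \<le> \<epsilon>"
          using Basis_le_norm[OF b, of "x - x0"] x by (simp add: inner_diff_left)
        moreover have "- \<epsilon> + x \<bullet> b \<le> y \<bullet> b" "y \<bullet> b \<le> \<epsilon> + x \<bullet> b"
          using y b by (auto simp: mem_box inner_add_left inner_diff_left)
        moreover have "(x0 - (2 * \<epsilon>) *\<^sub>R One) \<bullet> b = x0 \<bullet> b - 2 * \<epsilon>" "(x0 + (2 * \<epsilon>) *\<^sub>R One) \<bullet> b = x0 \<bullet> b + 2 * \<epsilon>"
          using b by (simp_all add: inner_diff_left inner_add_left)
        ultimately show ?thesis by linarith
      qed
      then show "y \<in> cbox (x0 - (2 * \<epsilon>) *\<^sub>R One) (x0 + (2 * \<epsilon>) *\<^sub>R One)" by (simp add: mem_box)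
    qed
  qed
  then show ?thesis by (simp add: integral_unique)
qed

lemma moll_has_derivative:
  assumes a: "continuous_on UNIV a"
  shows "(moll a has_derivative (\<lambda>h. moll_grad a x0 \<bullet> h)) (at x0)"
proof -
  let ?Q' = "cbox (x0 - (2 * \<epsilon>) *\<^sub>R One) (x0 + (2 * \<epsilon>) *\<^sub>R One)"
  let ?w = "\<lambda>x y. - (a y *\<^sub>R dk (y - x))"
  have m: "moll a x = integral ?Q' (\<lambda>y. k (y - x) * a y)" if "x \<in> ball x0 \<epsilon>" for x
    unfolding moll_def using that k_supp
    by (intro kernel_integral_shift) (auto intro!: continuous_intros k_cont cont_shift a simp: dist_norm norm_minus_commute)
  have g: "moll_grad a x0 = integral ?Q' (\<lambda>y. ?w x0 y)"
  proof -
    have "integral Q (\<lambda>z. a (x0 + z) *\<^sub>R dk z) = integral ?Q' (\<lambda>y. a y *\<^sub>R dk (y - x0))"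
      using dk_supp eps_pos
      by (intro kernel_integral_shift) (auto intro!: continuous_intros dk_cont cont_shift a)
    then show ?thesis unfolding moll_grad_def by simp
  qed
  have dk_shift: "continuous_on S (\<lambda>w. dk (snd w - fst w))" for S
    by (rule continuous_on_compose2[OF dk_cont]) (auto intro!: continuous_intros)
  have dk_shift': "continuous_on S (\<lambda>y. dk (y - x))" for S x
    by (rule continuous_on_compose2[OF dk_cont]) (auto intro!: continuous_intros)
  have k_shift': "continuous_on S (\<lambda>y. k (y - x))" for S x
    by (rule continuous_on_compose2[OF k_cont]) (auto intro!: continuous_intros)
  have a_snd: "continuous_on S (\<lambda>w. a (snd w))" for S :: "((real^'n) \<times> (real^'n)) set"
    by (rule continuous_on_compose2[OF a]) (auto intro!: continuous_intros)
  have a': "continuous_on S a" for S using a by (auto intro: continuous_on_subset)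
  have "((\<lambda>x. integral ?Q' (\<lambda>y. k (y - x) * a y)) has_derivative
      integral ?Q' (\<lambda>y. blinfun_inner_right (?w x0 y))) (at x0 within ball x0 \<epsilon>)"
  proof (rule leibniz_rule)
    fix x y
    have "((\<lambda>x. k (y - x)) has_derivative (\<lambda>h. dk (y - x) \<bullet> (- h))) (at x within ball x0 \<epsilon>)"
      by (rule has_derivative_compose[OF _ k_deriv]) (auto intro!: derivative_eq_intros)
    then show "((\<lambda>x. k (y - x) * a y) has_derivative blinfun_apply (blinfun_inner_right (?w x y))) (at x within ball x0 \<epsilon>)"
      by (auto intro!: derivative_eq_intros simp: fun_eq_iff)
  next
    show "continuous_on (ball x0 \<epsilon> \<times> ?Q') (\<lambda>(x, y). blinfun_inner_right (?w x y))"
      unfolding case_prod_beta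
      by (intro bounded_linear.continuous_on[OF bounded_linear_blinfun_inner_right] continuous_intros a_snd dk_shift)
  next
    fix x
    show "(\<lambda>y. k (y - x) * a y) integrable_on ?Q'"
      by (intro integrable_continuous continuous_intros k_shift' a')
  qed (use eps_pos in auto)
  moreover have "integral ?Q' (\<lambda>y. blinfun_inner_right (?w x0 y)) = blinfun_inner_right (moll_grad a x0)"
  proof -
    have "(\<lambda>y. ?w x0 y) integrable_on ?Q'"
      by (intro integrable_continuous continuous_intros dk_shift' a')
    from integral_linear[OF this bounded_linear_blinfun_inner_right] show ?thesis
      unfolding g by (simp add: o_def)
  qed
  ultimately have "((\<lambda>x. integral ?Q' (\<lambda>y. k (y - x) * a y)) has_derivative
      (\<lambda>h. moll_grad a x0 \<bullet> h)) (at x0)"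
    using eps_pos by (simp add: at_within_open[of x0 "ball x0 \<epsilon>"])
  then show ?thesis
    by (rule has_derivative_transform_within_open[where s="ball x0 \<epsilon>"]) (use m eps_pos in auto)
qed

text \<open>The kernel is nonnegative with mass 1, so a pointwise inequality survives averaging. The
  base points differ because domination compares the two ends of a segment.\<close>

lemma moll_mono:
  assumes a: "continuous_on UNIV a" and b: "continuous_on UNIV b"
    and le: "\<And>z. norm z < \<epsilon> \<Longrightarrow> b (y + z) \<le> a (x + z) + c"
  shows "moll b y \<le> moll a x + c"
proof -
  have i: "(\<lambda>z. k z * f (x + z)) integrable_on Q" if "continuous_on UNIV f" for f x
    using that by (intro integrable_continuous continuous_intros cont_shift continuous_on_subset[OF k_cont]) auto
  have ik: "k integrable_on Q"
    by (intro integrable_continuous continuous_on_subset[OF k_cont]) auto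
  have "integral Q (\<lambda>z. k z * b (y + z)) \<le> integral Q (\<lambda>z. k z * a (x + z) + k z * c)"
  proof (rule integral_le)
    fix z
    show "k z * b (y + z) \<le> k z * a (x + z) + k z * c"
    proof (cases "norm z < \<epsilon>")
      case True
      from mult_left_mono[OF le[OF True] k_nonneg[of z]] show ?thesis by (simp add: distrib_left)
    qed (simp add: k_supp)
  qed (use i[OF a] i[OF b] ik in \<open>auto intro!: integrable_add integrable_on_mult_left\<close>)
  also have "\<dots> = integral Q (\<lambda>z. k z * a (x + z)) + integral Q (\<lambda>z. k z * c)"
    using i[OF a] ik by (intro integral_add integrable_on_mult_left)
  also have "integral Q (\<lambda>z. k z * c) = c" using k_int by (simp add: integral_mult_left)
  finally show ?thesis by (simp add: moll_def)
qed

lemma moll_periodic: "periodic_fun a \<Longrightarrow> periodic_fun (moll a)"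
proof -
  assume a: "periodic_fun a"
  have "a (x + j + z) = a (x + z)" if "j \<in> Zlat" for x j z
    using a that unfolding periodic_fun_def by (metis add.assoc add.commute)
  then show ?thesis unfolding periodic_fun_def moll_def by simp
qed

context
  fixes a :: "real^'n \<Rightarrow> real" and K :: real
  assumes a_lip: "K-lipschitz_on UNIV a"
begin

lemma lip_le: "a x \<le> a y + K * norm (x - y)"
  using lipschitz_onD[OF a_lip, of x y] by (auto simp: dist_norm)

lemma lip_cont: "continuous_on UNIV a"
  using a_lip by (rule lipschitz_on_continuous_on)

lemma moll_close: "\<bar>moll a x - a x\<bar> \<le> K * \<epsilon>"
proof -
  have K0: "K \<ge> 0" using a_lip by (rule lipschitz_on_nonneg)
  have *: "norm z < \<epsilon> \<Longrightarrow> K * norm z \<le> K * \<epsilon>" for z :: "real^'n" using K0 by (intro mult_left_mono) auto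
  have c: "moll (\<lambda>y. a x) x = a x" using k_int by (simp add: moll_def integral_mult_left)
  have "moll a x \<le> moll (\<lambda>y. a x) x + K * \<epsilon>"
  proof (rule moll_mono[OF continuous_on_const lip_cont])
    fix z :: "real^'n" assume "norm z < \<epsilon>"
    then show "a (x + z) \<le> a x + K * \<epsilon>" using lip_le[of "x + z" x] *[of z] by simp
  qed
  moreover have "moll (\<lambda>y. a x) x \<le> moll a x + K * \<epsilon>"
  proof (rule moll_mono[OF lip_cont continuous_on_const])
    fix z :: "real^'n" assume "norm z < \<epsilon>"
    then show "a x \<le> a (x + z) + K * \<epsilon>" using lip_le[of x "x + z"] *[of z] by simp
  qed
  ultimately show ?thesis using c by linarith
qed

text \<open>The difference falls on \<open>a\<close>, the derivative on the kernel. The constant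
  grows as \<epsilon> shrinks, which is harmless: in \<open>regularization\<close> it multiplies the
  square of the step.\<close>

lemma moll_grad_lipschitz:
  "norm (moll_grad a x - moll_grad a y) \<le> K * integral Q (\<lambda>z. norm (dk z)) * norm (x - y)"
proof -
  have i: "(\<lambda>z. a (x + z) *\<^sub>R dk z) integrable_on Q" for x
    by (intro integrable_continuous continuous_intros cont_shift[OF lip_cont] continuous_on_subset[OF dk_cont]) auto
  have "norm (moll_grad a x - moll_grad a y) = norm (integral Q (\<lambda>z. a (x + z) *\<^sub>R dk z - a (y + z) *\<^sub>R dk z))"
    unfolding moll_grad_def by (subst integral_diff[OF i i]) (simp add: norm_minus_commute)
  also have "\<dots> \<le> integral Q (\<lambda>z. (K * norm (x - y)) * norm (dk z))"
  proof (rule integral_norm_bound_integral)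
    show "(\<lambda>z. a (x + z) *\<^sub>R dk z - a (y + z) *\<^sub>R dk z) integrable_on Q" by (intro integrable_diff i)
    show "(\<lambda>z. (K * norm (x - y)) * norm (dk z)) integrable_on Q"
      by (intro integrable_continuous continuous_intros continuous_on_subset[OF dk_cont]) auto
    fix z
    have "\<bar>a (x + z) - a (y + z)\<bar> \<le> K * norm (x - y)"
      using lip_le[of "x + z" "y + z"] lip_le[of "y + z" "x + z"] by (simp add: norm_minus_commute)
    then show "norm (a (x + z) *\<^sub>R dk z - a (y + z) *\<^sub>R dk z) \<le> (K * norm (x - y)) * norm (dk z)"
      by (simp flip: scaleR_diff_left add: mult_right_mono)
  qed
  finally show ?thesis by (simp add: mult_ac)
qed

lemma moll_grad_C1: "C1_grad (moll a) (moll_grad a)"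
proof -
  have i: "integral Q (\<lambda>z. norm (dk z)) \<ge> 0"
    by (intro integral_nonneg integrable_continuous continuous_intros continuous_on_subset[OF dk_cont]) auto
  have "(K * integral Q (\<lambda>z. norm (dk z)))-lipschitz_on UNIV (moll_grad a)"
    using moll_grad_lipschitz i lipschitz_on_nonneg[OF a_lip] by (intro lipschitz_onI) (auto simp: dist_norm)
  then show ?thesis
    unfolding C1_grad_def using moll_has_derivative[OF lip_cont] lipschitz_on_continuous_on by blast
qed

lemma moll_directional_mvt:
  assumes "t \<ge> 0"
  obtains s where "0 \<le> s" "s \<le> t" "moll a (x + t *\<^sub>R q) - moll a x = t * (moll_grad a (x + s *\<^sub>R q) \<bullet> q)"
proof -
  have "\<exists>s\<in>{0..t}. moll a (x + t *\<^sub>R q) - moll a (x + 0 *\<^sub>R q) = moll_grad a (x + s *\<^sub>R q) \<bullet> ((t - 0) *\<^sub>R q)"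
  proof (rule mvt_very_simple[OF assms])
    fix s
    show "((\<lambda>t. moll a (x + t *\<^sub>R q)) has_derivative (\<lambda>h. moll_grad a (x + s *\<^sub>R q) \<bullet> (h *\<^sub>R q))) (at s within {0..t})"
      by (rule has_derivative_compose[OF _ moll_has_derivative[OF lip_cont]]) (auto intro!: derivative_eq_intros)
  qed
  then show ?thesis using that by auto
qed

text \<open>Keeps momenta bounded independently of \<epsilon>, so that conjugate velocities stay in
  one ball. With a gradient longer than \<open>K\<close>, moving along it would increase the
  mollification faster than the Lipschitz bound allows.\<close>

lemma moll_grad_bound: "norm (moll_grad a x) \<le> K"
proof (rule ccontr)
  let ?g = "moll_grad a x"
  assume n: "\<not> norm ?g \<le> K"
  let ?f = "\<lambda>t. moll a (x + t *\<^sub>R ?g) - K * norm ?g * t"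
  have "((\<lambda>t. moll a (x + t *\<^sub>R ?g)) has_derivative (\<lambda>h. ?g \<bullet> (h *\<^sub>R ?g))) (at 0)"
    using moll_has_derivative[OF lip_cont, of x]
    by (intro has_derivative_compose[of "\<lambda>t. x + t *\<^sub>R ?g" "\<lambda>t. t *\<^sub>R ?g" 0 UNIV "moll a"]) (auto intro!: derivative_eq_intros)
  then have "DERIV ?f 0 :> ?g \<bullet> ?g - K * norm ?g"
    unfolding has_field_derivative_def by (auto intro!: derivative_eq_intros simp: algebra_simps)
  moreover have "?g \<bullet> ?g - K * norm ?g > 0"
  proof -
    have "norm ?g > 0" using n lipschitz_on_nonneg[OF a_lip] by linarith
    then have "norm ?g * norm ?g > K * norm ?g" using n by simp
    then show ?thesis by (simp add: power2_norm_eq_inner[symmetric] power2_eq_square)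
  qed
  ultimately obtain d where d: "d > 0" "\<And>h. h > 0 \<Longrightarrow> h < d \<Longrightarrow> ?f h > ?f 0"
    using DERIV_pos_inc_right[of ?f "?g \<bullet> ?g - K * norm ?g" 0] by auto
  have "moll a (x + (d/2) *\<^sub>R ?g) \<le> moll a x + K * norm ((d/2) *\<^sub>R ?g)"
  proof (rule moll_mono)
    fix z
    show "a (x + (d/2) *\<^sub>R ?g + z) \<le> a (x + z) + K * norm ((d/2) *\<^sub>R ?g)"
      using lip_le[of "x + (d/2) *\<^sub>R ?g + z" "x + z"] by (simp add: algebra_simps)
  qed (rule lip_cont)+
  then show False using d(2)[of "d/2"] d(1) by (simp add: mult_ac)
qed

end
end

lemma mollifier_exists:
  fixes \<epsilon> :: real
  assumes e: "\<epsilon> > 0"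
  obtains k dk where "mollifier (k :: real^'n \<Rightarrow> real) dk \<epsilon>"
proof -
  let ?Q = "cbox (- \<epsilon> *\<^sub>R One) (\<epsilon> *\<^sub>R One) :: (real^'n) set"
  \<comment> \<open>Squaring the positive part makes the kernel C^1 across the sphere of radius
    \<epsilon>.\<close>
  let ?k = "\<lambda>z::real^'n. (max 0 (\<epsilon>\<^sup>2 - z \<bullet> z))\<^sup>2"
  let ?I = "integral ?Q ?k"
  have kc: "continuous_on S ?k" for S by (intro continuous_intros)
  have ki: "?k integrable_on ?Q" by (intro integrable_continuous kc)
  have "?I \<noteq> 0"
  proof
    assume "?I = 0"
    then have "(?k has_integral 0) ?Q" using integrable_integral[OF ki] by simp
    then have "?k 0 = 0"
      by (rule has_integral_0_cbox_imp_0[rotated 2]) (use e in \<open>auto simp: kc mem_box box_eq_empty\<close>)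
    then show False using e by simp
  qed
  moreover have "?I \<ge> 0" by (intro integral_nonneg ki) auto
  ultimately have I: "?I > 0" by simp
  have z: "max 0 (\<epsilon>\<^sup>2 - z \<bullet> z) = 0" if "norm z \<ge> \<epsilon>" for z :: "real^'n"
    using that e power_mono[of \<epsilon> "norm z" 2] by (simp add: power2_norm_eq_inner)
  have "mollifier (\<lambda>z. ?k z / ?I) (\<lambda>z. (- 4 * max 0 (\<epsilon>\<^sup>2 - z \<bullet> z) / ?I) *\<^sub>R z) \<epsilon>"
  proof
    show "integral ?Q (\<lambda>z. ?k z / ?I) = 1" using I by (simp add: integral_divide)
    fix z :: "real^'n"
    show "((\<lambda>z. ?k z / ?I) has_derivative (\<lambda>h. ((- 4 * max 0 (\<epsilon>\<^sup>2 - z \<bullet> z) / ?I) *\<^sub>R z) \<bullet> h)) (at z)"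
      using I by (auto intro!: derivative_eq_intros simp: fun_eq_iff inner_commute field_simps)
    show "continuous_on UNIV (\<lambda>z::real^'n. (- 4 * max 0 (\<epsilon>\<^sup>2 - z \<bullet> z) / ?I) *\<^sub>R z)"
      using I by (intro continuous_intros) auto
  qed (use e I z in auto)
  then show ?thesis by (rule that)
qed

section \<open>From one-step domination to almost classical subsolutions\<close>

context superlinear_hamiltonian
begin

text \<open>A velocity \<open>q\<close> conjugate to the gradient of the mollification turns the one-step domination
  into a discrete Hamilton-Jacobi inequality.\<close>

lemma regularization:
  assumes e: "e > 0" and K: "K \<ge> 0"
  obtains M G C \<tau>0 where "\<tau>0 > 0" "C \<ge> (0::real)"
    "\<And>a. K-lipschitz_on UNIV a \<Longrightarrow> C1_grad (M a) (G a)"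
    "\<And>a x. K-lipschitz_on UNIV a \<Longrightarrow> \<bar>M a x - a x\<bar> \<le> e"
    "\<And>a. periodic_fun a \<Longrightarrow> periodic_fun (M a)"
    "\<And>a b \<tau> x. K-lipschitz_on UNIV a \<Longrightarrow> K-lipschitz_on UNIV b \<Longrightarrow> 0 < \<tau> \<Longrightarrow> \<tau> < \<tau>0 \<Longrightarrow> step_dom H \<tau> a b \<Longrightarrow>
        M b x \<le> M a x - \<tau> * H x (G a x) + \<tau> * e + C * \<tau>\<^sup>2"
proof -
  obtain R' where R': "\<And>x p. norm p \<le> K \<Longrightarrow> \<exists>q. norm q \<le> R' \<and> H x p + L x q \<le> p \<bullet> q"
    using Lag_conj by blast
  define R where "R = max 0 R'"
  have R0: "R \<ge> 0" by (simp add: R_def)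
  have R: "\<And>x p. norm p \<le> K \<Longrightarrow> \<exists>q. norm q \<le> R \<and> H x p + L x q \<le> p \<bullet> q"
    using R' unfolding R_def by (meson max.coboundedI2)
  obtain d where d: "d > 0" "\<And>x y q. norm q \<le> R \<Longrightarrow> dist x y < d \<Longrightarrow> L x q \<le> L y q + e"
    using Lag_uniform[OF e] by blast
  \<comment> \<open>The averaging radius uses half of \<open>d\<close>; the other half is left for
    the step, as \<open>\<tau> * R \<le> d / 2\<close>. The second bound makes the mollification
    \<open>e\<close>-close.\<close>
  define \<epsilon> where "\<epsilon> = min (d/2) (e / (K + 1))"
  have eps: "\<epsilon> > 0" using d(1) e K by (simp add: \<epsilon>_def)
  have Ke: "K * \<epsilon> \<le> e"
  proof -
    have "K * \<epsilon> \<le> K * (e / (K + 1))" using K unfolding \<epsilon>_def by (intro mult_left_mono) auto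
    also have "\<dots> \<le> e" using K e by (simp add: field_simps)
    finally show ?thesis .
  qed
  obtain k :: "real^'n \<Rightarrow> real" and dk where "mollifier k dk \<epsilon>" using mollifier_exists[OF eps] by blast
  then interpret mollifier k dk \<epsilon> .
  define \<tau>0 where "\<tau>0 = d / (2 * (R + 1))"
  \<comment> \<open>Lipschitz constant of the mollified gradient times the squared velocity bound:
    it controls the second-order remainder of one step.\<close>
  define C where "C = K * integral Q (\<lambda>z. norm (dk z)) * R\<^sup>2"
  have i: "integral Q (\<lambda>z. norm (dk z)) \<ge> 0"
    by (intro integral_nonneg integrable_continuous continuous_intros continuous_on_subset[OF dk_cont]) auto
  have step: "moll b x \<le> moll a x - \<tau> * H x (moll_grad a x) + \<tau> * e + C * \<tau>\<^sup>2"
    if a: "K-lipschitz_on UNIV a" and b: "K-lipschitz_on UNIV b" and \<tau>: "0 < \<tau>" "\<tau> < \<tau>0"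
      and dom: "step_dom H \<tau> a b" for a b \<tau> x
  proof -
    let ?g = "moll_grad a x"
    obtain q where q: "norm q \<le> R" "H x ?g + L x q \<le> ?g \<bullet> q" using R[OF moll_grad_bound[OF a]] by blast
    let ?y = "x - \<tau> *\<^sub>R q"
    have \<tau>R: "\<tau> * R \<le> d / 2"
    proof -
      have "\<tau> * R \<le> \<tau>0 * (R + 1)" using \<tau> R0 by (intro mult_mono) auto
      also have "\<dots> = d / 2" using R0 by (simp add: \<tau>0_def field_simps)
      finally show ?thesis .
    qed
    \<comment> \<open>Domination is averaged over the segments parallel to the one from
      \<open>?y\<close> to \<open>x\<close>.\<close>
    have "moll b x \<le> moll a ?y + (L x q + e) * \<tau>"
    proof (rule moll_mono[OF lip_cont[OF a] lip_cont[OF b]])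
      fix z :: "real^'n" assume z: "norm z < \<epsilon>"
      have "b ((?y + z) + \<tau> *\<^sub>R q) \<le> a (?y + z) + (L x q + e) * \<tau>"
      proof (rule step_domD[OF dom])
        fix s assume s: "0 \<le> s" "s \<le> \<tau>"
        have "dist (?y + z + s *\<^sub>R q) x = norm (z - (\<tau> - s) *\<^sub>R q)"
          by (simp add: dist_norm algebra_simps)
        also have "\<dots> \<le> norm z + (\<tau> - s) * norm q"
          using norm_triangle_ineq4[of z "(\<tau> - s) *\<^sub>R q"] s by simp
        also have "(\<tau> - s) * norm q \<le> \<tau> * R" using s q \<tau> by (intro mult_mono) auto
        also have "norm z + \<tau> * R < d" using z \<tau>R by (simp add: \<epsilon>_def)
        finally show "L (?y + z + s *\<^sub>R q) q \<le> L x q + e" using d(2) q by simp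
      qed
      then show "b (x + z) \<le> a (?y + z) + (L x q + e) * \<tau>" by (simp add: algebra_simps)
    qed
    also have "moll a ?y \<le> moll a x - \<tau> * (?g \<bullet> q) + C * \<tau>\<^sup>2"
    proof -
      obtain s where s: "0 \<le> s" "s \<le> \<tau>" "moll a (x + \<tau> *\<^sub>R (- q)) - moll a x = \<tau> * (moll_grad a (x + s *\<^sub>R (- q)) \<bullet> (- q))"
        using moll_directional_mvt[OF a, of \<tau> x "- q"] \<tau> by auto
      let ?h = "moll_grad a (x - s *\<^sub>R q)"
      have "norm (?h - ?g) \<le> K * integral Q (\<lambda>z. norm (dk z)) * norm (s *\<^sub>R q)"
        using moll_grad_lipschitz[OF a, of "x - s *\<^sub>R q" x] by simp
      also have "\<dots> \<le> K * integral Q (\<lambda>z. norm (dk z)) * (\<tau> * R)"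
        using s q R0 K i \<tau> by (intro mult_left_mono) (auto intro!: mult_mono)
      finally have "norm (?h - ?g) * norm q \<le> (K * integral Q (\<lambda>z. norm (dk z)) * (\<tau> * R)) * R"
        using q K i R0 \<tau> by (intro mult_mono) auto
      moreover have "(?g - ?h) \<bullet> q \<le> norm (?h - ?g) * norm q"
        using norm_cauchy_schwarz[of "?g - ?h" q] by (simp add: norm_minus_commute)
      ultimately have "\<tau> * ((?g - ?h) \<bullet> q) \<le> \<tau> * ((K * integral Q (\<lambda>z. norm (dk z)) * (\<tau> * R)) * R)"
        using \<tau> by (intro mult_left_mono) auto
      then show ?thesis using s(3) unfolding C_def by (simp add: power2_eq_square algebra_simps inner_diff_left)
    qed
    finally have "moll b x \<le> moll a x - \<tau> * (?g \<bullet> q - L x q) + \<tau> * e + C * \<tau>\<^sup>2"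
      by (simp add: algebra_simps)
    moreover have "\<tau> * H x ?g \<le> \<tau> * (?g \<bullet> q - L x q)" using q \<tau> by (intro mult_left_mono) auto
    ultimately show ?thesis by linarith
  qed
  show ?thesis
  proof (rule that[of \<tau>0 C moll moll_grad])
    show "\<tau>0 > 0" using d R0 by (simp add: \<tau>0_def)
    show "C \<ge> 0" using K i by (simp add: C_def)
    show "\<And>a x. K-lipschitz_on UNIV a \<Longrightarrow> \<bar>moll a x - a x\<bar> \<le> e" using moll_close Ke by (rule order_trans)
  qed (rule moll_grad_C1 moll_periodic step; assumption)+
qed

text \<open>With \<open>a = b = v\<close> the inequality of \<open>regularization\<close> carries
  \<open>M v x\<close> on both sides; dividing by \<open>\<tau>\<close> leaves
  \<open>H x (G v x) \<le> e + C * \<tau>\<close> with \<open>\<tau>\<close> arbitrarily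
  small.\<close>

lemma dominated_regularization:
  assumes v: "dominated H v" "periodic_fun v" and e: "e > 0"
  obtains f g where "C1_grad f g" "periodic_fun f" "\<And>x. \<bar>f x - v x\<bar> \<le> e" "\<And>x. H x (g x) \<le> e"
proof -
  obtain K where K: "K \<ge> 0" "\<And>v x y. dominated H v \<Longrightarrow> \<bar>v x - v y\<bar> \<le> K * norm (x - y)"
    using dominated_lipschitz by blast
  have lip: "K-lipschitz_on UNIV v" using K v by (intro lipschitz_onI) (auto simp: dist_norm)
  obtain M G C \<tau>0 where M: "\<tau>0 > 0" "C \<ge> (0::real)"
    "\<And>a. K-lipschitz_on UNIV a \<Longrightarrow> C1_grad (M a) (G a)"
    "\<And>a x. K-lipschitz_on UNIV a \<Longrightarrow> \<bar>M a x - a x\<bar> \<le> e"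
    "\<And>a. periodic_fun a \<Longrightarrow> periodic_fun (M a)"
    "\<And>a b \<tau> x. K-lipschitz_on UNIV a \<Longrightarrow> K-lipschitz_on UNIV b \<Longrightarrow> 0 < \<tau> \<Longrightarrow> \<tau> < \<tau>0 \<Longrightarrow> step_dom H \<tau> a b \<Longrightarrow>
        M b x \<le> M a x - \<tau> * H x (G a x) + \<tau> * e + C * \<tau>\<^sup>2"
    by (rule regularization[OF e K(1)]) (rule that; assumption)
  have "H x (G v x) \<le> e" for x
  proof (rule field_le_epsilon)
    fix \<eta> :: real assume \<eta>: "\<eta> > 0"
    define \<tau> where "\<tau> = min (\<tau>0 / 2) (\<eta> / (C + 1))"
    have \<tau>: "0 < \<tau>" "\<tau> < \<tau>0" using M(1,2) \<eta> by (auto simp: \<tau>_def intro!: min.strict_coboundedI1)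
    have "C * \<tau> \<le> C * (\<eta> / (C + 1))" using M(2) unfolding \<tau>_def by (intro mult_left_mono) auto
    also have "\<dots> \<le> \<eta>" using M(2) \<eta> by (simp add: field_simps)
    finally have C\<tau>: "C * \<tau> \<le> \<eta>" .
    have "M v x \<le> M v x - \<tau> * H x (G v x) + \<tau> * e + C * \<tau>\<^sup>2"
      using v \<tau> by (intro M(6) lip) (auto simp: dominated_def)
    then have "\<tau> * H x (G v x) \<le> \<tau> * (e + C * \<tau>)" by (simp add: power2_eq_square algebra_simps)
    then have "H x (G v x) \<le> e + C * \<tau>" using \<tau> by simp
    then show "H x (G v x) \<le> e + \<eta>" using C\<tau> by simp
  qed
  then show ?thesis by (intro that[of "M v" "G v"] M(3-5) lip v(2))
qed

end

section \<open>The asymptotic profile on the Mather set\<close>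

lemma integrable_periodic_fst:
  fixes f :: "real^'n \<Rightarrow> real"
  assumes "torus_prob \<mu>" "continuous_on UNIV f" "periodic_fun f"
  shows "integrable \<mu> (\<lambda>z. f (fst z))"
proof -
  interpret prob_space \<mu> using assms(1) by (simp add: torus_prob_def)
  have s: "sets \<mu> = sets borel" using assms(1) by (simp add: torus_prob_def)
  obtain B where B: "\<And>x. \<bar>f x\<bar> \<le> B" using periodic_continuous_bounded assms(2,3) by blast
  have "continuous_on UNIV (\<lambda>z::(real^'n) \<times> (real^'n). f (fst z))"
    by (rule continuous_on_compose2[OF assms(2)]) (auto intro!: continuous_intros)
  then have "(\<lambda>z. f (fst z)) \<in> borel_measurable \<mu>"
    unfolding measurable_cong_sets[OF s refl] by (rule borel_measurable_continuous_onI)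
  then show ?thesis using B by (intro integrable_const_bound[of _ B]) auto
qed

text \<open>Where \<open>h x > 0\<close>, continuity and periodicity give
  \<open>h \<ge> h x / 2\<close> on a neighbourhood of \<open>x\<close> and on all its lattice
  translates. Their union has positive measure by the definition of \<open>proj_supp\<close>, so the
  integral would be positive.\<close>

lemma zero_on_proj_supp:
  fixes h :: "real^'n \<Rightarrow> real"
  assumes \<mu>: "torus_prob \<mu>" and h: "continuous_on UNIV h" "periodic_fun h" "\<And>x. h x \<ge> 0"
    and int: "(\<integral>z. h (fst z) \<partial>\<mu>) \<le> 0" and x: "x \<in> proj_supp \<mu>"
  shows "h x = 0"
proof (rule ccontr)
  assume "h x \<noteq> 0"
  then have hx: "h x > 0" using h(3)[of x] by simp
  interpret prob_space \<mu> using \<mu> by (simp add: torus_prob_def)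
  have s: "sets \<mu> = sets borel" using \<mu> by (simp add: torus_prob_def)
  obtain e where e: "e > 0" "\<And>y. dist y x < e \<Longrightarrow> dist (h y) (h x) < h x / 2"
    using h(1)[unfolded continuous_on_iff, rule_format, of x "h x / 2"] hx by auto
  let ?S = "{z. \<exists>k\<in>Zlat. dist (fst z + k) x < e} :: ((real^'n) \<times> (real^'n)) set"
  have "?S = (\<Union>k\<in>Zlat. {z. dist (fst z + k) x < e})" by auto
  moreover have "open {z::(real^'n) \<times> (real^'n). dist (fst z + k) x < e}" for k
    by (intro open_Collect_less continuous_intros)
  ultimately have "open ?S" by auto
  then have Sm: "?S \<in> sets \<mu>" using s by simp
  have "emeasure \<mu> ?S > 0" using x e(1) unfolding proj_supp_def by simp
  then have pos: "measure \<mu> ?S > 0" by (simp add: emeasure_eq_measure)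
  have hi: "integrable \<mu> (\<lambda>z. h (fst z))" by (rule integrable_periodic_fst[OF \<mu> h(1,2)])
  have "(\<integral>z. (h x / 2) * indicator ?S z \<partial>\<mu>) \<le> (\<integral>z. h (fst z) \<partial>\<mu>)"
  proof (rule integral_mono[OF _ hi])
    show "integrable \<mu> (\<lambda>z. (h x / 2) * indicator ?S z)"
      using Sm by (intro integrable_mult_right integrable_real_indicator) (auto simp: emeasure_eq_measure)
    fix z
    show "(h x / 2) * indicator ?S z \<le> h (fst z)"
    proof (cases "z \<in> ?S")
      case True
      then obtain k where k: "k \<in> Zlat" "dist (fst z + k) x < e" by auto
      have "h (fst z + k) = h (fst z)" using h(2) k(1) by (simp add: periodic_fun_def)
      moreover have "\<bar>h (fst z + k) - h x\<bar> < h x / 2" using e(2)[OF k(2)] by (simp add: dist_real_def)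
      ultimately have "h x / 2 \<le> h (fst z)" unfolding abs_less_iff by linarith
      then show ?thesis using True by (simp add: indicator_def)
    qed (use h(3) in auto)
  qed
  also have "(\<integral>z. (h x / 2) * indicator ?S z \<partial>\<mu>) = (h x / 2) * measure \<mu> ?S"
    using Sm by simp
  finally show False using int pos hx by (smt (verit) mult_pos_pos half_gt_zero)
qed

context superlinear_hamiltonian
begin

text \<open>Fenchel's inequality at the gradient of a smooth almost subsolution is integrated;
  closedness removes the gradient term and leaves action \<ge> \<open>- e\<close>.\<close>

lemma closed_measure_Lag_nonneg:
  assumes v: "dominated H v" "periodic_fun v"
    and \<nu>: "\<nu> \<in> closed_measures" and Li: "integrable \<nu> (\<lambda>z. L (fst z) (snd z))"
  shows "(\<integral>z. L (fst z) (snd z) \<partial>\<nu>) \<ge> 0"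
proof (rule field_le_epsilon)
  fix e :: real assume e: "e > 0"
  interpret prob_space \<nu> using \<nu> by (simp add: closed_measures_def torus_prob_def)
  obtain f g where fg: "C1_grad f g" "periodic_fun f" "\<And>x. \<bar>f x - v x\<bar> \<le> e" "\<And>x. H x (g x) \<le> e"
    using dominated_regularization[OF v e] by metis
  have i: "integrable \<nu> (\<lambda>z. snd z \<bullet> g (fst z))" "(\<integral>z. snd z \<bullet> g (fst z) \<partial>\<nu>) = 0"
    using \<nu> fg(1,2) unfolding closed_measures_def by auto
  have "(\<integral>z. snd z \<bullet> g (fst z) \<partial>\<nu>) \<le> (\<integral>z. L (fst z) (snd z) + e \<partial>\<nu>)"
  proof (rule integral_mono[OF i(1)])
    fix z
    show "snd z \<bullet> g (fst z) \<le> L (fst z) (snd z) + e"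
      using fenchel[of "g (fst z)" "snd z" "fst z"] fg(4)[of "fst z"] by (simp add: inner_commute)
  qed (use Li in auto)
  then show "0 \<le> (\<integral>z. L (fst z) (snd z) \<partial>\<nu>) + e" using i(2) Li by (simp add: prob_space)
qed

end

section \<open>The solution, its limit and its infimum over future times\<close>

locale convergent_cauchy_solution = superlinear_hamiltonian H
  for H :: "real^'n \<Rightarrow> real^'n \<Rightarrow> real" +
  fixes u0 :: "real^'n \<Rightarrow> real" and u :: "real^'n \<Rightarrow> real \<Rightarrow> real" and uinf :: "real^'n \<Rightarrow> real"
  assumes u_sol: "visc_sol_cauchy H u0 u"
    and u_lim: "\<And>e. e > 0 \<Longrightarrow> \<exists>T. \<forall>t\<ge>T. \<forall>x. \<bar>u x t - uinf x\<bar> < e"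
begin

lemma u_sub: "cauchy_sub H u"
  using u_sol unfolding visc_sol_cauchy_def cauchy_sub_def by (elim conjE) (intro conjI; assumption)

lemma u_cont: "continuous_on (UNIV \<times> {0..}) (\<lambda>z. u (fst z) (snd z))"
  using u_sol by (simp add: visc_sol_cauchy_def)

lemma u_periodic: "t \<ge> 0 \<Longrightarrow> periodic_fun (\<lambda>x. u x t)"
  using u_sol by (simp add: visc_sol_cauchy_def)

lemma u_init: "u x 0 = u0 x"
  using u_sol by (simp add: visc_sol_cauchy_def)

lemma u_super:
  assumes "C1_grad_time \<phi> gx gt" "t > 0" "e > 0"
    and "\<And>y s. s > 0 \<Longrightarrow> dist (y, s) (x, t) < e \<Longrightarrow> u y s - \<phi> y s \<ge> u x t - \<phi> x t"
  shows "gt x t + H x (gx x t) \<ge> 0"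
proof -
  have "C1_grad_time \<phi> gx gt \<and> t > 0 \<and>
      (\<exists>e>0. \<forall>y s. s > 0 \<and> dist (y, s) (x, t) < e \<longrightarrow> u y s - \<phi> y s \<ge> u x t - \<phi> x t)"
    using assms by auto
  then show ?thesis
    by (rule u_sol[unfolded visc_sol_cauchy_def, THEN conjunct2, THEN conjunct2, THEN conjunct2, THEN conjunct2,
        THEN spec, THEN spec, THEN spec, THEN spec, THEN spec, THEN mp])
qed

lemma u_lim_nonneg:
  assumes "e > 0"
  obtains T where "T \<ge> 0" "\<And>t x. t \<ge> T \<Longrightarrow> \<bar>u x t - uinf x\<bar> < e"
proof -
  obtain T where "\<forall>t\<ge>T. \<forall>x. \<bar>u x t - uinf x\<bar> < e" using u_lim[OF assms] by blast
  then show ?thesis using that[of "max T 0"] by simp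
qed

lemma u_bounded:
  obtains B where "\<And>x t. t \<ge> 0 \<Longrightarrow> \<bar>u x t\<bar> \<le> B"
proof -
  obtain T where T: "T \<ge> 0" "\<And>t x. t \<ge> T \<Longrightarrow> \<bar>u x t - uinf x\<bar> < 1" using u_lim_nonneg[of 1] by auto
  have "compact ((\<lambda>z. u (fst z) (snd z)) ` (cbox 0 1 \<times> {0..T}))"
    by (intro compact_continuous_image compact_Times continuous_on_subset[OF u_cont]) auto
  then obtain B where B: "\<And>y. y \<in> (\<lambda>z. u (fst z) (snd z)) ` (cbox 0 1 \<times> {0..T}) \<Longrightarrow> \<bar>y\<bar> \<le> B"
    by (meson bounded_real compact_imp_bounded)
  have 1: "\<bar>u x t\<bar> \<le> B" if "0 \<le> t" "t \<le> T" for x t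
  proof -
    have "u (frac_vec x) t \<in> (\<lambda>z. u (fst z) (snd z)) ` (cbox 0 1 \<times> {0..T})"
      using frac_vec_in_cbox[of x] that by (intro image_eqI[where x="(frac_vec x, t)"]) auto
    then show ?thesis using B periodic_frac_vec[OF u_periodic[OF that(1)], of x] by simp
  qed
  have "\<bar>u x t\<bar> \<le> B + 2" if "0 \<le> t" for x t
  proof (cases "t \<le> T")
    case True then show ?thesis using 1[OF that True, of x] by simp
  next
    case False
    then show ?thesis using T(2)[of t x] T(2)[of T x] 1[of T x] T(1) by linarith
  qed
  then show ?thesis by (rule that)
qed

lemma uinf_periodic: "periodic_fun uinf"
  unfolding periodic_fun_def
proof (intro allI ballI)
  fix x k :: "real^'n" assume k: "k \<in> Zlat"
  have "\<bar>uinf (x + k) - uinf x\<bar> \<le> 0"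
  proof (rule field_le_epsilon)
    fix e :: real assume "e > 0"
    then obtain T where T: "T \<ge> 0" "\<And>t x. t \<ge> T \<Longrightarrow> \<bar>u x t - uinf x\<bar> < e/2" using u_lim_nonneg[of "e/2"] by auto
    have "u (x + k) T = u x T" using u_periodic[OF T(1)] k by (simp add: periodic_fun_def)
    then show "\<bar>uinf (x + k) - uinf x\<bar> \<le> 0 + e" using T(2)[of T x] T(2)[of T "x + k"] by linarith
  qed
  then show "uinf (x + k) = uinf x" by simp
qed

text \<open>Domination between the times \<open>T\<close> and \<open>T + t\<close> is inherited by
  the limit, which is the same at both ends.\<close>

lemma uinf_dominated: "dominated H uinf"
  unfolding dominated_def step_dom_def
proof (intro allI impI)
  fix t :: real and x q c assume t: "0 \<le> t" and c: "\<forall>s\<in>{0..t}. L (x + s *\<^sub>R q) q \<le> c"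
  show "uinf (x + t *\<^sub>R q) \<le> uinf x + c * t"
  proof (rule field_le_epsilon)
    fix e :: real assume "e > 0"
    then obtain T where T: "T \<ge> 0" "\<And>t x. t \<ge> T \<Longrightarrow> \<bar>u x t - uinf x\<bar> < e/2" using u_lim_nonneg[of "e/2"] by auto
    have "u (x + t *\<^sub>R q) (T + t) \<le> u x T + c * t"
      using step_domD[OF cauchy_sub_step[OF u_sub T(1) t]] c by simp
    then show "uinf (x + t *\<^sub>R q) \<le> uinf x + c * t + e"
      using T(2)[of T x] T(2)[of "T + t" "x + t *\<^sub>R q"] t by linarith
  qed
qed

lemma uinf_visc_sub: "visc_sub H uinf"
  using dominated_imp_visc_sub uinf_dominated uinf_periodic .

definition V :: "real \<Rightarrow> real^'n \<Rightarrow> real" where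
  "V t x = (INF s\<in>{t..}. u x s)"

lemma V_bdd: "t \<ge> 0 \<Longrightarrow> bdd_below (u x ` {t..})"
proof -
  assume "t \<ge> 0"
  obtain B where B: "\<And>x t. t \<ge> 0 \<Longrightarrow> \<bar>u x t\<bar> \<le> B" using u_bounded by blast
  have "- B \<le> u x s" if "s \<in> {t..}" for s using B[of s x] that \<open>t \<ge> 0\<close> by auto
  then show ?thesis by (rule bdd_belowI2)
qed

lemma V_le: "0 \<le> t \<Longrightarrow> t \<le> s \<Longrightarrow> V t x \<le> u x s"
  unfolding V_def using V_bdd by (intro cINF_lower) auto

lemma V_greatest: "(\<And>s. t \<le> s \<Longrightarrow> c \<le> u x s) \<Longrightarrow> c \<le> V t x"
  unfolding V_def by (intro cINF_greatest) auto

lemma V_mono: "0 \<le> s \<Longrightarrow> s \<le> t \<Longrightarrow> V s x \<le> V t x"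
  by (intro V_greatest V_le) auto

text \<open>Each competitor \<open>u x r\<close> in the infimum at time \<open>s\<close> is carried
  by domination of \<open>u\<close> to a competitor at time \<open>r + t\<close> in the infimum at
  \<open>s + t\<close>.\<close>

lemma V_step: "0 \<le> s \<Longrightarrow> 0 \<le> t \<Longrightarrow> step_dom H t (V s) (V (s + t))"
  unfolding step_dom_def
proof (intro allI impI)
  fix x q c assume s: "0 \<le> s" and t: "0 \<le> t" and c: "\<forall>r\<in>{0..t}. L (x + r *\<^sub>R q) q \<le> c"
  have "V (s + t) (x + t *\<^sub>R q) - c * t \<le> V s x"
  proof (rule V_greatest)
    fix r assume r: "s \<le> r"
    have "V (s + t) (x + t *\<^sub>R q) \<le> u (x + t *\<^sub>R q) (r + t)" using r s t by (intro V_le) auto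
    also have "\<dots> \<le> u x r + c * t"
      using step_domD[OF cauchy_sub_step[OF u_sub _ t, of r]] c r s by simp
    finally show "V (s + t) (x + t *\<^sub>R q) - c * t \<le> u x r" by simp
  qed
  then show "V (s + t) (x + t *\<^sub>R q) \<le> V s x + c * t" by simp
qed

text \<open>Monotonicity in time makes every slice dominated, hence Lipschitz with a universal constant:
  no regularity of \<open>u\<close> itself is needed.\<close>

lemma V_dominated: "0 \<le> s \<Longrightarrow> dominated H (V s)"
  unfolding dominated_def step_dom_def
proof (intro allI impI)
  fix t :: real and x q c assume s: "0 \<le> s" and t: "0 \<le> t" and c: "\<forall>r\<in>{0..t}. L (x + r *\<^sub>R q) q \<le> c"
  have "V s (x + t *\<^sub>R q) \<le> V (s + t) (x + t *\<^sub>R q)" using s t by (intro V_mono) auto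
  also have "\<dots> \<le> V s x + c * t" using step_domD[OF V_step[OF s t]] c by simp
  finally show "V s (x + t *\<^sub>R q) \<le> V s x + c * t" .
qed

lemma V_periodic: "0 \<le> s \<Longrightarrow> periodic_fun (V s)"
  unfolding periodic_fun_def V_def using u_periodic unfolding periodic_fun_def
  by (intro allI ballI INF_cong) auto

lemma V0_le_u0: "V 0 x \<le> u0 x"
  using V_le[of 0 0 x] u_init by simp

lemma V0_le_uinf: "V 0 x \<le> uinf x"
proof (rule field_le_epsilon)
  fix e :: real assume "e > 0"
  then obtain T where T: "T \<ge> 0" "\<And>t x. t \<ge> T \<Longrightarrow> \<bar>u x t - uinf x\<bar> < e" using u_lim_nonneg[of e] by auto
  then show "V 0 x \<le> uinf x + e" using V_le[of 0 T x] T(2)[of T x] by linarith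
qed

text \<open>The subsolution is replaced by a smooth \<open>f\<close> with
  \<open>H x (g x) \<le> e\<close>. Tilted in time to make it strict, \<open>f\<close> is itself the
  test function for the supersolution property of \<open>u\<close>.\<close>

lemma subsolution_le_u:
  assumes v: "visc_sub H v" "\<And>y. v y \<le> u0 y" and T: "T \<ge> 0"
  shows "v x \<le> u x T"
proof -
  \<comment> \<open>One \<open>e\<close> for replacing \<open>v\<close> by \<open>f\<close>, one for
    the initial gap, and \<open>2 * e * T\<close> for the tilt.\<close>
  have main: "v x \<le> u x T + e * (2 + 2 * T)" if e: "e > 0" for e
  proof -
    obtain f g where fg: "C1_grad f g" "periodic_fun f" "\<And>x. \<bar>f x - v x\<bar> \<le> e" "\<And>x. H x (g x) \<le> e"
      using dominated_regularization[OF visc_sub_imp_dominated[OF v(1)] _ e] v(1) unfolding visc_sub_def by metis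
    have fder: "(f has_derivative (\<lambda>h. g y \<bullet> h)) (at y)" for y using fg(1) by (simp add: C1_grad_def)
    have gc: "continuous_on UNIV g" using fg(1) by (simp add: C1_grad_def)
    have fc: "continuous_on UNIV f"
      by (intro continuous_at_imp_continuous_on ballI has_derivative_continuous[OF fder])
    obtain B' where B': "\<And>x. \<bar>f x\<bar> \<le> B'" using periodic_continuous_bounded[OF fc fg(2)] by blast
    obtain B where B: "\<And>x t. t \<ge> 0 \<Longrightarrow> \<bar>u x t\<bar> \<le> B" using u_bounded by blast
    have B0: "B \<ge> 0" "B' \<ge> 0" using B[of 0 x] B'[of x] by linarith+
    \<comment> \<open>At \<open>s = T + 1\<close> the barrier outweighs the bounds of
      \<open>f\<close> and \<open>u\<close>, which excludes a maximum on the final face; it starts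
      only at \<open>T\<close>, where the estimate is read off.\<close>
    define A where "A = B + B' + 1"
    let ?P = "\<lambda>w. f (fst w) - u (fst w) (snd w) - 2 * e * snd w - A * (max 0 (snd w - T))\<^sup>2"
    let ?C = "cbox 0 1 \<times> {0..T + 1} :: ((real^'n) \<times> real) set"
    have "continuous_on ?C ?P"
      by (intro continuous_intros continuous_on_compose2[OF fc] continuous_on_subset[OF u_cont]) auto
    moreover have "(0, 0) \<in> ?C" using T by (auto simp: mem_box_cart)
    moreover have "compact ?C" by (intro compact_Times) auto
    ultimately have "\<exists>w\<in>?C. \<forall>w'\<in>?C. ?P w' \<le> ?P w"
      by (intro continuous_attains_sup) auto
    then obtain w where w: "w \<in> ?C" "\<And>w'. w' \<in> ?C \<Longrightarrow> ?P w' \<le> ?P w" by auto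
    \<comment> \<open>Periodicity turns the maximum over the cube into one over all of space, so no
      lateral boundary has to be excluded.\<close>
    have glob: "?P (y, s) \<le> ?P w" if "0 \<le> s" "s \<le> T + 1" for y s
    proof -
      have "?P (frac_vec y, s) \<le> ?P w" using frac_vec_in_cbox[of y] that by (intro w(2)) auto
      moreover have "f (frac_vec y) = f y" "u (frac_vec y) s = u y s"
        using periodic_frac_vec[OF fg(2)] periodic_frac_vec[OF u_periodic[OF that(1)]] by auto
      ultimately show ?thesis by simp
    qed
    have "?P w \<le> e"
    proof (rule ccontr)
      assume n: "\<not> ?P w \<le> e"
      obtain x1 t1 where xt: "w = (x1, t1)" by force
      have t1: "0 \<le> t1" "t1 \<le> T + 1" using w(1) xt by auto
      have "t1 \<noteq> 0"
      proof
        assume t: "t1 = 0"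
        have "?P w = f x1 - u0 x1" using T by (simp add: xt t u_init)
        then show False using n fg(3)[of x1] v(2)[of x1] by linarith
      qed
      moreover have "t1 \<noteq> T + 1"
      proof
        assume t: "t1 = T + 1"
        have "?P w = f x1 - u x1 t1 - 2 * e * t1 - A" by (simp add: xt t)
        moreover have "2 * e * t1 \<ge> 0" using e t1 by simp
        ultimately show False using n B[OF t1(1), of x1] B'[of x1] e unfolding A_def by linarith
      qed
      ultimately have t1': "0 < t1" "t1 < T + 1" using t1 by auto
      let ?\<phi> = "\<lambda>y s. f y - 2 * e * s - A * (max 0 (s - T))\<^sup>2"
      have "C1_grad_time ?\<phi> (\<lambda>y s. g y) (\<lambda>y s. - 2 * e - 2 * A * max 0 (s - T))"
        unfolding C1_grad_time_def
      proof (intro conjI allI)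
        fix y :: "real^'n" and s :: real
        have "((\<lambda>z. f (fst z)) has_derivative (\<lambda>z. g y \<bullet> fst z)) (at (y, s))"
          by (rule has_derivative_compose[OF has_derivative_fst[OF has_derivative_ident]]) (simp add: fder)
        then show "((\<lambda>z. ?\<phi> (fst z) (snd z)) has_derivative
           (\<lambda>z. g y \<bullet> fst z + (- 2 * e - 2 * A * max 0 (s - T)) * snd z)) (at (y, s))"
          by (auto intro!: derivative_eq_intros simp: fun_eq_iff algebra_simps)
      qed (auto intro!: continuous_intros continuous_on_compose2[OF gc])
      moreover have "u y s - ?\<phi> y s \<ge> u x1 t1 - ?\<phi> x1 t1"
        if "s > 0" "dist (y, s) (x1, t1) < T + 1 - t1" for y s
      proof -
        have "dist s t1 < T + 1 - t1" using that(2) dist_snd_le[of "(y,s)" "(x1,t1)"] by simp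
        then have "s \<le> T + 1" by (simp add: dist_real_def)
        then show ?thesis using glob[of s y] that(1) xt by simp
      qed
      ultimately have "(- 2 * e - 2 * A * max 0 (t1 - T)) + H x1 (g x1) \<ge> 0"
        using t1' by (intro u_super[where e="T + 1 - t1"]) auto
      moreover have "2 * A * max 0 (t1 - T) \<ge> 0" using B0 by (simp add: A_def)
      ultimately show False using fg(4)[of x1] e by linarith
    qed
    then have "?P (x, T) \<le> e" using glob[of T x] T by simp
    then show ?thesis using fg(3)[of x] by (simp add: algebra_simps)
  qed
  show ?thesis
  proof (rule field_le_epsilon)
    fix \<eta> :: real assume "\<eta> > 0"
    then show "v x \<le> u x T + \<eta>" using main[of "\<eta> / (2 + 2 * T)"] T by simp
  qed
qed

lemma subsolution_le_uinf:
  assumes "visc_sub H v" "\<And>y. v y \<le> u0 y"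
  shows "v x \<le> uinf x"
proof (rule field_le_epsilon)
  fix e :: real assume "e > 0"
  then obtain T where "T \<ge> 0" "\<And>t x. t \<ge> T \<Longrightarrow> \<bar>u x t - uinf x\<bar> < e" using u_lim_nonneg[of e] by auto
  then show "v x \<le> uinf x + e" using subsolution_le_u[OF assms, of T x] by (smt (verit, best))
qed

lemma V0_visc_sub: "visc_sub H (V 0)"
  by (rule dominated_imp_visc_sub[OF V_dominated V_periodic]) auto

text \<open>\<open>V 0\<close> belongs to the competing subsolutions and the comparison bounds all
  of them by \<open>uinf\<close>; this also makes the \<open>Sup\<close> genuine.\<close>

lemma u0_minus_bounds: "V 0 x \<le> u0_minus H u0 x" "u0_minus H u0 x \<le> uinf x"
proof -
  let ?S = "{v x | v. visc_sub H v \<and> (\<forall>y. v y \<le> u0 y)}"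
  have V: "V 0 x \<in> ?S" using V0_visc_sub V0_le_u0 by blast
  have up: "s \<le> uinf x" if "s \<in> ?S" for s using that subsolution_le_uinf by blast
  show "V 0 x \<le> u0_minus H u0 x"
    unfolding u0_minus_def using V up by (intro cSup_upper bdd_aboveI) auto
  show "u0_minus H u0 x \<le> uinf x"
    unfolding u0_minus_def using V up by (intro cSup_least) auto
qed

text \<open>The regularized one-step inequality is integrated over \<open>n\<close> steps of length
  \<open>T / n\<close>. Fenchel's inequality replaces the Hamiltonian term by \<open>L\<close> minus
  a gradient term; the latter integrates to 0, and the action is nonpositive.\<close>

lemma V_integral_le:
  assumes \<mu>: "\<mu> \<in> closed_measures" and Li: "integrable \<mu> (\<lambda>z. L (fst z) (snd z))"
    and L0: "(\<integral>z. L (fst z) (snd z) \<partial>\<mu>) \<le> 0" and T: "T \<ge> 0"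
  shows "(\<integral>z. V T (fst z) \<partial>\<mu>) \<le> (\<integral>z. V 0 (fst z) \<partial>\<mu>)"
proof -
  have tp: "torus_prob \<mu>" using \<mu> by (simp add: closed_measures_def)
  then interpret prob_space \<mu> by (simp add: torus_prob_def)
  obtain K where K: "K \<ge> 0" "\<And>v x y. dominated H v \<Longrightarrow> \<bar>v x - v y\<bar> \<le> K * norm (x - y)"
    using dominated_lipschitz by blast
  have lip: "K-lipschitz_on UNIV v" if "dominated H v" for v
    using K that by (intro lipschitz_onI) (auto simp: dist_norm)
  \<comment> \<open>\<open>T * e\<close> accumulates over the steps, one \<open>e\<close> covers the
    quadratic remainders, and two cover the mollifications at times \<open>0\<close> and
    \<open>T\<close>.\<close>
  have main: "(\<integral>z. V T (fst z) \<partial>\<mu>) \<le> (\<integral>z. V 0 (fst z) \<partial>\<mu>) + e * (T + 3)" if e: "e > 0" for e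
  proof -
    obtain M G C \<tau>0 where M: "\<tau>0 > 0" "C \<ge> (0::real)"
      "\<And>a. K-lipschitz_on UNIV a \<Longrightarrow> C1_grad (M a) (G a)"
      "\<And>a x. K-lipschitz_on UNIV a \<Longrightarrow> \<bar>M a x - a x\<bar> \<le> e"
      "\<And>a. periodic_fun a \<Longrightarrow> periodic_fun (M a)"
      "\<And>a b \<tau> x. K-lipschitz_on UNIV a \<Longrightarrow> K-lipschitz_on UNIV b \<Longrightarrow> 0 < \<tau> \<Longrightarrow> \<tau> < \<tau>0 \<Longrightarrow> step_dom H \<tau> a b \<Longrightarrow>
          M b x \<le> M a x - \<tau> * H x (G a x) + \<tau> * e + C * \<tau>\<^sup>2"
      by (rule regularization[OF e K(1)]) (rule that; assumption)
    have Mc: "continuous_on UNIV (M a)" if "K-lipschitz_on UNIV a" for a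
    proof -
      have "(M a has_derivative (\<lambda>h. G a x \<bullet> h)) (at x)" for x using M(3)[OF that] by (simp add: C1_grad_def)
      then show ?thesis by (intro continuous_at_imp_continuous_on ballI) (rule has_derivative_continuous)
    qed
    have Mi: "integrable \<mu> (\<lambda>z. M (V t) (fst z))" if "t \<ge> 0" for t
      using that by (intro integrable_periodic_fst tp Mc lip V_dominated M(5) V_periodic)
    obtain n :: nat where n: "n > 0" "T / real n < \<tau>0" "C * T\<^sup>2 / real n \<le> e"
    proof -
      obtain n where n: "real n > max (T / \<tau>0) (C * T\<^sup>2 / e)" using reals_Archimedean2 by blast
      then have "real n > 0" using T M(1) by (smt (verit) divide_nonneg_pos max.cobounded1)
      then show ?thesis using n M(1) e that[of n] by (auto simp: field_simps)
    qed
    define \<tau> where "\<tau> = T / real n"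
    have \<tau>: "0 \<le> \<tau>" "\<tau> < \<tau>0" using n T by (auto simp: \<tau>_def)
    have step: "(\<integral>z. M (V (s + \<tau>)) (fst z) \<partial>\<mu>) \<le> (\<integral>z. M (V s) (fst z) \<partial>\<mu>) + \<tau> * e + C * \<tau>\<^sup>2"
      if s: "s \<ge> 0" for s
    \<comment> \<open>The step has length 0 exactly if \<open>T = 0\<close>.\<close>
    proof (cases "\<tau> = 0")
      case False
      then have \<tau>': "\<tau> > 0" using \<tau> by simp
      let ?g = "G (V s)"
      have C1: "C1_grad (M (V s)) ?g" "periodic_fun (M (V s))"
        using M(3)[OF lip[OF V_dominated[OF s]]] M(5)[OF V_periodic[OF s]] by auto
      then have gi: "integrable \<mu> (\<lambda>z. snd z \<bullet> ?g (fst z))" "(\<integral>z. snd z \<bullet> ?g (fst z) \<partial>\<mu>) = 0"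
        using \<mu> unfolding closed_measures_def by blast+
      have "(\<integral>z. M (V (s + \<tau>)) (fst z) \<partial>\<mu>) \<le>
          (\<integral>z. M (V s) (fst z) + \<tau> * (L (fst z) (snd z) - snd z \<bullet> ?g (fst z)) + (\<tau> * e + C * \<tau>\<^sup>2) \<partial>\<mu>)"
      proof (rule integral_mono)
        show "integrable \<mu> (\<lambda>z. M (V (s + \<tau>)) (fst z))" using s \<tau> by (intro Mi) auto
        show "integrable \<mu> (\<lambda>z. M (V s) (fst z) + \<tau> * (L (fst z) (snd z) - snd z \<bullet> ?g (fst z)) + (\<tau> * e + C * \<tau>\<^sup>2))"
          using Mi[OF s] Li gi(1) by (intro Bochner_Integration.integrable_add integrable_mult_right Bochner_Integration.integrable_diff) auto
        fix z :: "(real^'n) \<times> (real^'n)"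
        have "M (V (s + \<tau>)) (fst z) \<le> M (V s) (fst z) - \<tau> * H (fst z) (?g (fst z)) + \<tau> * e + C * \<tau>\<^sup>2"
          using s \<tau> \<tau>' by (intro M(6) lip V_dominated V_step) auto
        moreover have "- \<tau> * H (fst z) (?g (fst z)) \<le> \<tau> * (L (fst z) (snd z) - snd z \<bullet> ?g (fst z))"
        proof -
          have "- H (fst z) (?g (fst z)) \<le> L (fst z) (snd z) - snd z \<bullet> ?g (fst z)"
            using fenchel[of "?g (fst z)" "snd z" "fst z"] by (simp add: inner_commute)
          from mult_left_mono[OF this \<tau>(1)] show ?thesis by simp
        qed
        ultimately show "M (V (s + \<tau>)) (fst z) \<le>
            M (V s) (fst z) + \<tau> * (L (fst z) (snd z) - snd z \<bullet> ?g (fst z)) + (\<tau> * e + C * \<tau>\<^sup>2)" by linarith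
      qed
      also have "\<dots> = (\<integral>z. M (V s) (fst z) \<partial>\<mu>) + \<tau> * (\<integral>z. L (fst z) (snd z) \<partial>\<mu>) + (\<tau> * e + C * \<tau>\<^sup>2)"
        using Mi[OF s] Li gi by (simp add: prob_space)
      also have "\<tau> * (\<integral>z. L (fst z) (snd z) \<partial>\<mu>) \<le> 0" using \<tau>(1) L0 by (rule mult_nonneg_nonpos)
      finally show ?thesis by simp
    qed simp
    have "(\<integral>z. M (V (real k * \<tau>)) (fst z) \<partial>\<mu>) \<le> (\<integral>z. M (V 0) (fst z) \<partial>\<mu>) + real k * (\<tau> * e + C * \<tau>\<^sup>2)" for k
    proof (induction k)
      case (Suc k)
      have "real (Suc k) * \<tau> = real k * \<tau> + \<tau>" by (simp add: algebra_simps)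
      then show ?case using step[of "real k * \<tau>"] Suc \<tau>(1) by (simp add: algebra_simps)
    qed simp
    moreover have "real n * \<tau> = T" "real n * (\<tau> * e + C * \<tau>\<^sup>2) = T * e + C * T\<^sup>2 / real n"
      using n(1) by (simp_all add: \<tau>_def field_simps power2_eq_square)
    ultimately have "(\<integral>z. M (V T) (fst z) \<partial>\<mu>) \<le> (\<integral>z. M (V 0) (fst z) \<partial>\<mu>) + (T * e + C * T\<^sup>2 / real n)"
      by metis
    then have 1: "(\<integral>z. M (V T) (fst z) \<partial>\<mu>) \<le> (\<integral>z. M (V 0) (fst z) \<partial>\<mu>) + (T * e + e)" using n(3) by linarith
    have Vi: "integrable \<mu> (\<lambda>z. V t (fst z))" if "t \<ge> 0" for t
      using that by (intro integrable_periodic_fst tp dominated_continuous V_dominated V_periodic)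
    have "(\<integral>z. V T (fst z) \<partial>\<mu>) \<le> (\<integral>z. M (V T) (fst z) + e \<partial>\<mu>)"
    proof (rule integral_mono[OF Vi[OF T]])
      fix z show "V T (fst z) \<le> M (V T) (fst z) + e"
        using M(4)[OF lip[OF V_dominated[OF T]], of "fst z"] by linarith
    qed (use Mi[OF T] in auto)
    moreover have "(\<integral>z. M (V 0) (fst z) \<partial>\<mu>) \<le> (\<integral>z. V 0 (fst z) + e \<partial>\<mu>)"
    proof (rule integral_mono)
      fix z show "M (V 0) (fst z) \<le> V 0 (fst z) + e"
        using M(4)[OF lip[OF V_dominated[of 0]], of "fst z"] by (simp add: abs_le_iff)
    qed (use Mi[of 0] Vi[of 0] in auto)
    ultimately show ?thesis using 1 Mi[OF T] Vi[of 0] by (simp add: prob_space algebra_simps)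
  qed
  show ?thesis
  proof (rule field_le_epsilon)
    fix \<eta> :: real assume "\<eta> > 0"
    then show "(\<integral>z. V T (fst z) \<partial>\<mu>) \<le> (\<integral>z. V 0 (fst z) \<partial>\<mu>) + \<eta>"
      using main[of "\<eta> / (T + 3)"] T by simp
  qed
qed

text \<open>For large \<open>T\<close> the function \<open>V T\<close> is at least
  \<open>uinf - e\<close>, so \<open>uinf - V 0\<close>, which is nonnegative, has nonpositive
  integral. The equality is stated with the continuous function \<open>V 0\<close> so that it
  extends to the closure in \<open>mather_set\<close>; \<open>u0_minus\<close> is then
  squeezed.\<close>

lemma uinf_eq_u0_minus_on_supp:
  assumes \<mu>: "\<mu> \<in> closed_measures" and Li: "integrable \<mu> (\<lambda>z. L (fst z) (snd z))"
    and L0: "(\<integral>z. L (fst z) (snd z) \<partial>\<mu>) \<le> 0" and x: "x \<in> proj_supp \<mu>"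
  shows "uinf x = V 0 x"
proof -
  have tp: "torus_prob \<mu>" using \<mu> by (simp add: closed_measures_def)
  then interpret prob_space \<mu> by (simp add: torus_prob_def)
  have Vi: "integrable \<mu> (\<lambda>z. V t (fst z))" if "t \<ge> 0" for t
    using that by (intro integrable_periodic_fst tp dominated_continuous V_dominated V_periodic)
  have ui: "integrable \<mu> (\<lambda>z. uinf (fst z))"
    by (intro integrable_periodic_fst tp dominated_continuous uinf_dominated uinf_periodic)
  have "(\<integral>z. uinf (fst z) \<partial>\<mu>) \<le> (\<integral>z. V 0 (fst z) \<partial>\<mu>)"
  proof (rule field_le_epsilon)
    fix e :: real assume "e > 0"
    then obtain T where T: "T \<ge> 0" "\<And>t x. t \<ge> T \<Longrightarrow> \<bar>u x t - uinf x\<bar> < e" using u_lim_nonneg[of e] by auto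
    have "uinf y - e \<le> V T y" for y
    proof (rule V_greatest)
      fix s assume "T \<le> s" then show "uinf y - e \<le> u y s" using T(2)[of s y] by linarith
    qed
    then have "(\<integral>z. uinf (fst z) \<partial>\<mu>) \<le> (\<integral>z. V T (fst z) + e \<partial>\<mu>)"
      using ui Vi[OF T(1)] by (intro integral_mono) (auto simp: diff_le_eq)
    also have "\<dots> = (\<integral>z. V T (fst z) \<partial>\<mu>) + e" using Vi[OF T(1)] by (simp add: prob_space)
    finally show "(\<integral>z. uinf (fst z) \<partial>\<mu>) \<le> (\<integral>z. V 0 (fst z) \<partial>\<mu>) + e"
      using V_integral_le[OF \<mu> Li L0 T(1)] by linarith
  qed
  then have int: "(\<integral>z. uinf (fst z) - V 0 (fst z) \<partial>\<mu>) \<le> 0" using ui Vi[of 0] by simp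
  have "uinf x - V 0 x = 0"
  proof (rule zero_on_proj_supp[OF tp _ _ _ int x])
    show "continuous_on UNIV (\<lambda>y. uinf y - V 0 y)"
      by (intro continuous_intros dominated_continuous uinf_dominated V_dominated) auto
    show "periodic_fun (\<lambda>y. uinf y - V 0 y)"
      using uinf_periodic V_periodic[of 0] by (simp add: periodic_fun_def)
  qed (use V0_le_uinf in simp)
  then show ?thesis by simp
qed

end

section \<open>Almost calibrated discrete curves\<close>

context superlinear_hamiltonian
begin

text \<open>The Lipschitz constant common to all subsolutions bounds the set under
  \<open>Sup\<close>.\<close>

lemma dH_upper: "visc_sub H v \<Longrightarrow> v x - v y \<le> dH H x y"
proof -
  assume v: "visc_sub H v"
  obtain K where K: "K \<ge> 0" "\<And>v x y. dominated H v \<Longrightarrow> \<bar>v x - v y\<bar> \<le> K * norm (x - y)"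
    using dominated_lipschitz by blast
  have "bdd_above {v x - v y | v. visc_sub H v}"
    using K(2)[OF visc_sub_imp_dominated] by (intro bdd_aboveI[of _ "K * norm (x - y)"]) (auto simp: abs_le_iff)
  then show ?thesis unfolding dH_def using v by (intro cSup_upper) auto
qed

lemma dH_least:
  assumes "visc_sub H w" "\<And>v. visc_sub H v \<Longrightarrow> v x - v y \<le> c"
  shows "dH H x y \<le> c"
  unfolding dH_def using assms by (intro cSup_least) auto

lemma dH_continuous:
  assumes w: "visc_sub H w"
  shows "continuous_on UNIV (dH H x)"
proof -
  obtain K where K: "K \<ge> 0" "\<And>v x y. dominated H v \<Longrightarrow> \<bar>v x - v y\<bar> \<le> K * norm (x - y)"
    using dominated_lipschitz by blast
  have le: "dH H x y \<le> dH H x z + K * norm (y - z)" for y z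
  proof (rule dH_least[OF w])
    fix v assume v: "visc_sub H v"
    show "v x - v y \<le> dH H x z + K * norm (y - z)"
      using dH_upper[OF v, of x z] K(2)[OF visc_sub_imp_dominated[OF v], of y z] by linarith
  qed
  have "\<bar>dH H x y - dH H x z\<bar> \<le> K * norm (y - z)" for y z
    using le[of y z] le[of z y] by (simp add: norm_minus_commute abs_le_iff)
  then have "K-lipschitz_on UNIV (dH H x)"
    using K(1) by (intro lipschitz_onI) (auto simp: dist_norm)
  then show ?thesis by (rule lipschitz_on_continuous_on)
qed

lemma dH_periodic: "periodic_fun (dH H x)"
proof -
  have "{v x - v (y + k) | v. visc_sub H v} = {v x - v y | v. visc_sub H v}" if "k \<in> Zlat" for y k
  proof -
    have "v (y + k) = v y" if "visc_sub H v" for v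
      using that \<open>k \<in> Zlat\<close> by (simp add: visc_sub_def periodic_fun_def)
    then show ?thesis by (metis (no_types, lifting))
  qed
  then show ?thesis unfolding periodic_fun_def dH_def by simp
qed

end

section \<open>Almost minimizers and backward chains\<close>

context convergent_cauchy_solution
begin

text \<open>The supersolution property of \<open>u\<close> is used here at an almost-minimum point of a quadratic
  penalization at a large time, where the time derivative of the test function is small.\<close>

lemma uinf_almost_minimizer:
  assumes \<delta>: "\<delta> > 0" and \<kappa>: "\<kappa> > 0"
  obtains y where "H y ((1/\<delta>) *\<^sub>R (x - y)) \<ge> - \<kappa>"
    "\<And>z. uinf y + (norm (x - y))\<^sup>2 / (2*\<delta>) \<le> uinf z + (norm (x - z))\<^sup>2 / (2*\<delta>) + \<kappa>"
proof -
  \<comment> \<open>The time penalty contributes at most \<open>4 * \<kappa>'\<close> to the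
    viscosity inequality, and exchanging \<open>u\<close> for \<open>uinf\<close> at two points
    costs \<open>2 * \<kappa>'\<close> in the almost-minimality.\<close>
  define \<kappa>' where "\<kappa>' = \<kappa> / 8"
  have \<kappa>': "\<kappa>' > 0" using \<kappa> by (simp add: \<kappa>'_def)
  obtain T where T: "T \<ge> 0" "\<And>t x. t \<ge> T \<Longrightarrow> \<bar>u x t - uinf x\<bar> < \<kappa>'" using u_lim_nonneg[OF \<kappa>'] by auto
  obtain B where B: "\<And>x t. t \<ge> 0 \<Longrightarrow> \<bar>u x t\<bar> \<le> B" using u_bounded by blast
  have B0: "B \<ge> 0" using B[of 0 x] by simp
  \<comment> \<open>Beyond \<open>r\<close> the quadratic term exceeds the oscillation of
    \<open>u\<close>: the minimizer is interior, and points \<open>z\<close> outside the ball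
    satisfy the conclusion anyway. The final \<open>+ 1\<close> yields
    \<open>s \<le> s * s\<close>.\<close>
  define r where "r = 2 * \<delta> * (2 * B + 1 + 4 * \<kappa>') + 1"
  have r1: "r \<ge> 1" using \<delta> B0 \<kappa>' by (simp add: r_def)
  have far: "s\<^sup>2 / (2*\<delta>) \<ge> 2 * B + 1 + 4 * \<kappa>'" if "s \<ge> r" for s
  proof -
    have "s * 1 \<le> s * s" using that r1 by (intro mult_left_mono) auto
    then have "s\<^sup>2 \<ge> 2 * \<delta> * (2 * B + 1 + 4 * \<kappa>')" using that by (simp add: r_def power2_eq_square)
    then show ?thesis using \<delta> by (simp add: field_simps)
  qed
  \<comment> \<open>The window is centred at \<open>T + 2\<close>. At its ends the penalty is
    \<open>4 * \<kappa>'\<close>, more than \<open>u y\<close> can vary after \<open>T\<close>, so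
    the minimizing time is interior.\<close>
  let ?C = "cball x r \<times> {T..T + 4}"
  let ?P = "\<lambda>w. u (fst w) (snd w) + (norm (x - fst w))\<^sup>2 / (2*\<delta>) + \<kappa>' * (snd w - T - 2)\<^sup>2"
  have "continuous_on ?C ?P"
    using \<delta> T(1) by (intro continuous_intros continuous_on_subset[OF u_cont]) auto
  moreover have "compact ?C" by (intro compact_Times) auto
  moreover have "(x, T) \<in> ?C" using r1 by simp
  ultimately have "\<exists>w\<in>?C. \<forall>w'\<in>?C. ?P w \<le> ?P w'" by (intro continuous_attains_inf) auto
  then obtain w where w: "w \<in> ?C" "\<And>w'. w' \<in> ?C \<Longrightarrow> ?P w \<le> ?P w'" by auto
  obtain y t where yt: "w = (y, t)" by force
  have in1: "norm (x - y) \<le> r" "T \<le> t" "t \<le> T + 4" using w(1) yt by (auto simp: dist_norm)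
  have pen: "\<kappa>' * (t - T - 2)\<^sup>2 \<ge> 0" using \<kappa>' by simp
  have "norm (x - y) \<noteq> r"
  proof
    assume n: "norm (x - y) = r"
    have "?P w \<le> ?P (x, T + 2)" using r1 by (intro w(2)) auto
    then have "?P w \<le> u x (T + 2)" by simp
    moreover have "?P w = u y t + r\<^sup>2 / (2*\<delta>) + \<kappa>' * (t - T - 2)\<^sup>2" using n by (simp add: yt)
    moreover have "\<bar>u x (T + 2)\<bar> \<le> B" "\<bar>u y t\<bar> \<le> B" using T(1) in1 by (auto intro!: B)
    ultimately show False using far[OF order_refl] pen \<kappa>' by linarith
  qed
  then have y1: "norm (x - y) < r" using in1 by simp
  have tne: "t \<noteq> T \<and> t \<noteq> T + 4"
  proof (rule ccontr)
    assume "\<not> (t \<noteq> T \<and> t \<noteq> T + 4)"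
    then have t: "(t - T - 2)\<^sup>2 = 4" by auto
    have "?P w \<le> ?P (y, T + 2)" using in1 by (intro w(2)) (auto simp: dist_norm)
    then have "u y t + \<kappa>' * 4 \<le> u y (T + 2)" using t by (simp add: yt)
    then show False using T(2)[of t y] T(2)[of "T + 2" y] in1 \<kappa>' by auto
  qed
  then have t1: "T < t" "t < T + 4" using in1 by auto
  let ?\<phi> = "\<lambda>z s. - ((x - z) \<bullet> (x - z)) / (2*\<delta>) - \<kappa>' * (s - T - 2)\<^sup>2"
  have C1: "C1_grad_time ?\<phi> (\<lambda>z s. (1/\<delta>) *\<^sub>R (x - z)) (\<lambda>z s. - 2 * \<kappa>' * (s - T - 2))"
    unfolding C1_grad_time_def
  proof (intro conjI allI)
    fix z :: "real^'n" and s :: real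
    show "((\<lambda>w. ?\<phi> (fst w) (snd w)) has_derivative
       (\<lambda>w. ((1/\<delta>) *\<^sub>R (x - z)) \<bullet> fst w + (- 2 * \<kappa>' * (s - T - 2)) * snd w)) (at (z, s))"
      using \<delta> by (auto intro!: derivative_eq_intros simp: fun_eq_iff inner_commute inner_diff_left inner_diff_right field_simps)
  qed (auto intro!: continuous_intros)
  have "u z s - ?\<phi> z s \<ge> u y t - ?\<phi> y t"
    if "s > 0" "dist (z, s) (y, t) < min (r - norm (x - y)) (min (t - T) (T + 4 - t))" for z s
  proof -
    have d: "dist z y < r - norm (x - y)" "dist s t < t - T" "dist s t < T + 4 - t"
      using that(2) dist_fst_le[of "(z,s)" "(y,t)"] dist_snd_le[of "(z,s)" "(y,t)"] by auto
    have "norm (x - z) \<le> norm (x - y) + dist z y"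
      using norm_triangle_ineq[of "x - y" "y - z"] by (simp add: dist_norm norm_minus_commute)
    then have "(z, s) \<in> ?C" using d by (auto simp: dist_real_def dist_norm)
    from w(2)[OF this] show ?thesis by (simp add: yt power2_norm_eq_inner)
  qed
  then have "- 2 * \<kappa>' * (t - T - 2) + H y ((1/\<delta>) *\<^sub>R (x - y)) \<ge> 0"
    using t1 T(1) y1 by (intro u_super[OF C1, where e="min (r - norm (x - y)) (min (t - T) (T + 4 - t))"]) auto
  moreover have "\<kappa>' * (t - T - 2) \<ge> \<kappa>' * (-2)" using t1 \<kappa>' by (intro mult_left_mono) auto
  ultimately have "H y ((1/\<delta>) *\<^sub>R (x - y)) \<ge> - \<kappa>" using \<kappa> unfolding \<kappa>'_def by simp
  moreover have near: "uinf y + (norm (x - y))\<^sup>2 / (2*\<delta>) \<le> uinf z + (norm (x - z))\<^sup>2 / (2*\<delta>) + 2 * \<kappa>'"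
    if "norm (x - z) \<le> r" for z
  proof -
    have "?P w \<le> ?P (z, T + 2)" using that by (intro w(2)) (auto simp: dist_norm)
    then have "u y t + (norm (x - y))\<^sup>2 / (2*\<delta>) + \<kappa>' * (t - T - 2)\<^sup>2
        \<le> u z (T + 2) + (norm (x - z))\<^sup>2 / (2*\<delta>)" by (simp add: yt)
    moreover have "\<bar>u y t - uinf y\<bar> < \<kappa>'" "\<bar>u z (T + 2) - uinf z\<bar> < \<kappa>'"
      using in1 by (auto intro: T(2))
    ultimately show ?thesis using pen by linarith
  qed
  have "uinf y + (norm (x - y))\<^sup>2 / (2*\<delta>) \<le> uinf z + (norm (x - z))\<^sup>2 / (2*\<delta>) + \<kappa>" for z
  proof (cases "norm (x - z) \<le> r")
    case True then show ?thesis using near[OF True] \<kappa> by (simp add: \<kappa>'_def)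
  next
    case False
    have "uinf y + (norm (x - y))\<^sup>2 / (2*\<delta>) \<le> uinf x + 2 * \<kappa>'" using near[of x] r1 by simp
    moreover have "uinf x \<le> B + \<kappa>'" "uinf z \<ge> - B - \<kappa>'"
      using T(2)[of T x] T(2)[of T z] B[of T x] B[of T z] T(1) by auto
    ultimately show ?thesis using far[of "norm (x - z)"] False \<kappa>' \<kappa> by linarith
  qed
  ultimately show ?thesis by (intro that)
qed

text \<open>Calibration is approximated through the inf-convolution of \<open>uinf\<close>, whose semiconcavity turns the
  supersolution inequality into a discrete dynamic programming inequality, with an error per unit time
  that tends to \<open>0\<close> if the step is small compared with the parameter of the inf-convolution.\<close>

lemma calibrated_step:
  obtains R where "R \<ge> 0" "\<And>e. e > 0 \<Longrightarrow> \<exists>\<tau>0>0. \<forall>\<tau>. 0 < \<tau> \<and> \<tau> < \<tau>0 \<longrightarrow>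
    (\<exists>f. (\<forall>x. \<bar>f x - uinf x\<bar> \<le> e) \<and>
         (\<forall>x. \<exists>q. norm q \<le> R \<and> f (x - \<tau> *\<^sub>R q) \<le> f x - \<tau> * L x q + \<tau> * e))"
proof -
  obtain K where K: "K \<ge> 0" "\<And>v x y. dominated H v \<Longrightarrow> \<bar>v x - v y\<bar> \<le> K * norm (x - y)"
    using dominated_lipschitz by blast
  \<comment> \<open>Bound for the momentum \<open>|x - y| / \<delta>\<close> at an almost minimizer,
    which satisfies \<open>s * s \<le> 2 * K * s + 2\<close>. It does not depend on
    \<open>e\<close>, so neither does \<open>R\<close>: all chains share one ball of
    velocities.\<close>
  define P where "P = 2 * K + 2"
  have P: "P \<ge> 2" using K(1) by (simp add: P_def)
  obtain R' where R': "\<And>x p. norm p \<le> P \<Longrightarrow> \<exists>q. norm q \<le> R' \<and> H x p + L x q \<le> p \<bullet> q"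
    using Lag_conj by blast
  define R where "R = max 0 R'"
  have R0: "R \<ge> 0" by (simp add: R_def)
  have R: "\<And>x p. norm p \<le> P \<Longrightarrow> \<exists>q. norm q \<le> R \<and> H x p + L x q \<le> p \<bullet> q"
    using R' unfolding R_def by (meson max.coboundedI2)
  have "\<exists>\<tau>0>0. \<forall>\<tau>. 0 < \<tau> \<and> \<tau> < \<tau>0 \<longrightarrow>
    (\<exists>f. (\<forall>x. \<bar>f x - uinf x\<bar> \<le> e) \<and>
         (\<forall>x. \<exists>q. norm q \<le> R \<and> f (x - \<tau> *\<^sub>R q) \<le> f x - \<tau> * L x q + \<tau> * e))" if e: "e > 0" for e
  proof -
    obtain d where d: "d > 0" "\<And>x y q. norm q \<le> R \<Longrightarrow> dist x y < d \<Longrightarrow> L x q \<le> L y q + e/4"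
      using Lag_uniform[of "e/4" R] e by auto
    \<comment> \<open>The first bound puts the almost minimizer within \<open>d\<close> of
      \<open>x\<close>, the second makes the inf-convolution \<open>e\<close>-close to
      \<open>uinf\<close>.\<close>
    define \<delta> where "\<delta> = min (d / (2 * P)) (e / (K\<^sup>2 + 1))"
    have K2: "K\<^sup>2 + 1 > 0" by (smt (verit) zero_le_power2)
    have \<delta>: "\<delta> > 0" using d(1) P e K2 by (simp add: \<delta>_def)
    have P\<delta>: "P * \<delta> < d"
    proof -
      have "P * \<delta> \<le> P * (d / (2 * P))" using P unfolding \<delta>_def by (intro mult_left_mono) auto
      also have "\<dots> < d" using P d(1) by simp
      finally show ?thesis .
    qed
    have K\<delta>: "K\<^sup>2 * \<delta> \<le> e"
    proof -
      have "K\<^sup>2 * \<delta> \<le> K\<^sup>2 * (e / (K\<^sup>2 + 1))" unfolding \<delta>_def by (intro mult_left_mono) auto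
      also have "\<dots> \<le> e" using K2 e by (simp add: field_simps)
      finally show ?thesis .
    qed
    have low: "uinf z + (norm (x - z))\<^sup>2 / (2*\<delta>) \<ge> uinf x - e" for x z
    proof -
      have "(norm (x - z) - K * \<delta>)\<^sup>2 \<ge> 0" by simp
      then have "K * norm (x - z) * (2 * \<delta>) \<le> (norm (x - z))\<^sup>2 + K\<^sup>2 * \<delta> * \<delta>"
        by (simp add: power2_eq_square algebra_simps)
      then have "K * norm (x - z) \<le> (norm (x - z))\<^sup>2 / (2*\<delta>) + K\<^sup>2 * \<delta> / 2"
        using \<delta> by (simp add: field_simps)
      moreover have "K\<^sup>2 * \<delta> / 2 \<le> e" using K\<delta> e by simp
      ultimately show ?thesis using K(2)[OF uinf_dominated, of x z] by linarith
    qed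
    define f where "f = (\<lambda>x. INF z. uinf z + (norm (x - z))\<^sup>2 / (2*\<delta>))"
    have bdd: "bdd_below (range (\<lambda>z. uinf z + (norm (x - z))\<^sup>2 / (2*\<delta>)))" for x
      using low[of x] by (intro bdd_belowI2)
    have f_le: "f x \<le> uinf z + (norm (x - z))\<^sup>2 / (2*\<delta>)" for x z
      unfolding f_def using bdd by (intro cINF_lower) auto
    have f_ge: "c \<le> f x" if "\<And>z. c \<le> uinf z + (norm (x - z))\<^sup>2 / (2*\<delta>)" for c x
      unfolding f_def using that by (intro cINF_greatest) auto
    \<comment> \<open>Makes the quadratic remainder of a step at most a quarter of the allowed error
      \<open>\<tau> * e\<close>.\<close>
    define \<tau>0 where "\<tau>0 = e * \<delta> / (2 * (R\<^sup>2 + 1))"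
    have R2: "R\<^sup>2 + 1 > 0" by (smt (verit) zero_le_power2)
    have step: "\<exists>q. norm q \<le> R \<and> f (x - \<tau> *\<^sub>R q) \<le> f x - \<tau> * L x q + \<tau> * e" if \<tau>: "0 < \<tau>" "\<tau> < \<tau>0" for \<tau> x
    proof -
      \<comment> \<open>\<open>\<delta>\<close> serves the momentum bound and \<open>e/4\<close> the
        Hamiltonian inequality; \<open>\<tau> * e / 4\<close> is there because the minimization
        error is paid at every step.\<close>
      define \<kappa> where "\<kappa> = min \<delta> (min (e/4) (\<tau> * e / 4))"
      have \<kappa>: "\<kappa> > 0" "\<kappa> \<le> \<delta>" "\<kappa> \<le> e/4" "\<kappa> \<le> \<tau> * e / 4" using \<delta> e \<tau> by (auto simp: \<kappa>_def)
      obtain y where y: "H y ((1/\<delta>) *\<^sub>R (x - y)) \<ge> - \<kappa>"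
        "\<And>z. uinf y + (norm (x - y))\<^sup>2 / (2*\<delta>) \<le> uinf z + (norm (x - z))\<^sup>2 / (2*\<delta>) + \<kappa>"
        using uinf_almost_minimizer[OF \<delta> \<kappa>(1)] by blast
      let ?p = "(1/\<delta>) *\<^sub>R (x - y)"
      let ?s = "norm ?p"
      have s: "norm (x - y) = \<delta> * ?s" using \<delta> by simp
      have np: "?s \<le> P"
      proof (rule ccontr)
        assume n: "\<not> ?s \<le> P"
        have "uinf y + (norm (x - y))\<^sup>2 / (2*\<delta>) \<le> uinf x + \<delta>" using y(2)[of x] \<kappa>(2) by simp
        then have "(norm (x - y))\<^sup>2 / (2*\<delta>) \<le> K * norm (x - y) + \<delta>"
          using K(2)[OF uinf_dominated, of x y] by linarith
        then have "\<delta> * (?s * ?s) \<le> \<delta> * (2 * K * ?s + 2)"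
          unfolding s using \<delta> by (simp add: power2_eq_square field_simps)
        then have "?s * ?s \<le> 2 * K * ?s + 2" by (rule mult_left_le_imp_le[OF _ \<delta>])
        moreover have "P * ?s \<le> ?s * ?s" using n by (intro mult_right_mono) auto
        ultimately have "2 * ?s \<le> 2" unfolding P_def by (simp add: algebra_simps)
        then show False using n P by linarith
      qed
      obtain q where q: "norm q \<le> R" "H y ?p + L y q \<le> ?p \<bullet> q" using R[OF np] by blast
      have xy: "dist x y < d"
      proof -
        have "\<delta> * ?s \<le> \<delta> * P" using np \<delta> by (intro mult_left_mono) auto
        then have "\<delta> * ?s < d" using P\<delta> by (simp only: mult.commute[of \<delta> P])
        then show ?thesis unfolding dist_norm by (simp only: s)
      qed
      have pq: "?p \<bullet> q \<ge> L x q - e/2" using d(2)[OF q(1) xy] q(2) y(1) \<kappa>(3) by linarith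
      have "\<tau> * R\<^sup>2 \<le> \<tau>0 * (R\<^sup>2 + 1)" using \<tau> by (intro mult_mono) auto
      also have "\<dots> = e * \<delta> / 2" using R2 by (simp add: \<tau>0_def field_simps)
      finally have "\<tau> * R\<^sup>2 / (2 * \<delta>) \<le> e / 4" using \<delta> by (simp add: field_simps)
      then have "\<tau> * (\<tau> * R\<^sup>2 / (2 * \<delta>)) \<le> \<tau> * (e / 4)" using \<tau> by (intro mult_left_mono) auto
      moreover have "\<tau>\<^sup>2 * (norm q)\<^sup>2 / (2 * \<delta>) \<le> \<tau>\<^sup>2 * R\<^sup>2 / (2 * \<delta>)"
        using q(1) \<delta> by (intro divide_right_mono mult_left_mono power_mono) auto
      moreover have "\<tau> * (\<tau> * R\<^sup>2 / (2 * \<delta>)) = \<tau>\<^sup>2 * R\<^sup>2 / (2 * \<delta>)" by (simp add: power2_eq_square)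
      ultimately have quad: "\<tau>\<^sup>2 * (norm q)\<^sup>2 / (2 * \<delta>) \<le> \<tau> * e / 4" by linarith
      \<comment> \<open>The point \<open>y\<close> chosen for \<open>x\<close> also competes at the
        moved point; expanding the square produces the momentum \<open>?p\<close> and the
        remainder.\<close>
      have "f (x - \<tau> *\<^sub>R q) \<le> uinf y + (norm (x - \<tau> *\<^sub>R q - y))\<^sup>2 / (2*\<delta>)" by (rule f_le)
      also have "(norm (x - \<tau> *\<^sub>R q - y))\<^sup>2 = (norm (x - y))\<^sup>2 - 2 * \<tau> * ((x - y) \<bullet> q) + \<tau>\<^sup>2 * (norm q)\<^sup>2"
        unfolding power2_norm_eq_inner by (simp add: algebra_simps inner_diff_left inner_diff_right inner_commute power2_eq_square)
      also have "\<dots> / (2*\<delta>) = (norm (x - y))\<^sup>2 / (2*\<delta>) - \<tau> * (?p \<bullet> q) + \<tau>\<^sup>2 * (norm q)\<^sup>2 / (2 * \<delta>)"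
        using \<delta> by (simp add: add_divide_distrib diff_divide_distrib)
      finally have "f (x - \<tau> *\<^sub>R q) \<le> (uinf y + (norm (x - y))\<^sup>2 / (2*\<delta>)) - \<tau> * (?p \<bullet> q) + \<tau> * e / 4"
        using quad by linarith
      moreover have "uinf y + (norm (x - y))\<^sup>2 / (2*\<delta>) - \<kappa> \<le> f x"
      proof (rule f_ge)
        fix z show "uinf y + (norm (x - y))\<^sup>2 / (2*\<delta>) - \<kappa> \<le> uinf z + (norm (x - z))\<^sup>2 / (2*\<delta>)"
          using y(2)[of z] by simp
      qed
      moreover have "\<tau> * (L x q - e/2) \<le> \<tau> * (?p \<bullet> q)" using pq \<tau> by (intro mult_left_mono) auto
      ultimately have "f (x - \<tau> *\<^sub>R q) \<le> f x - \<tau> * L x q + \<tau> * e"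
        using \<kappa>(4) by (simp add: algebra_simps)
      then show ?thesis using q(1) by blast
    qed
    have close: "\<bar>f x - uinf x\<bar> \<le> e" for x
      using f_le[of x x] f_ge[of "uinf x - e" x] low[of x] e by (simp add: abs_le_iff)
    show ?thesis
    proof (intro exI[of _ \<tau>0] conjI allI impI)
      show "\<tau>0 > 0" using e \<delta> R2 by (simp add: \<tau>0_def)
      fix \<tau> assume "0 < \<tau> \<and> \<tau> < \<tau>0"
      then show "\<exists>f. (\<forall>x. \<bar>f x - uinf x\<bar> \<le> e) \<and>
         (\<forall>x. \<exists>q. norm q \<le> R \<and> f (x - \<tau> *\<^sub>R q) \<le> f x - \<tau> * L x q + \<tau> * e)"
        using close step by (intro exI[of _ f]) simp
    qed
  qed
  then show ?thesis using R0 that by simp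
qed

text \<open>The backward step is iterated over a total time between \<open>m\<close> and
  \<open>m + 1\<close>. Telescoping bounds the action by a difference of values of
  \<open>uinf\<close>, which is bounded, so its time average is of order
  \<open>1 / m\<close>.\<close>

lemma calibrated_chain:
  obtains R C where "R \<ge> 0" "\<And>x0 (m::nat). m > 0 \<Longrightarrow> \<exists>\<tau> N X Q. 0 < \<tau> \<and> \<tau> \<le> 1 / real m \<and> N > 0 \<and>
      real m \<le> real N * \<tau> \<and> (\<forall>k<N. norm (Q k) \<le> R \<and> X (Suc k) = X k - \<tau> *\<^sub>R Q k) \<and>
      (\<Sum>k<N. L (X k) (Q k)) / real N \<le> C / real m \<and>
      (\<forall>k<N. dH H x0 (X k) \<le> uinf x0 - uinf (X k) + 1 / real m)"
proof -
  obtain R where R: "R \<ge> 0" "\<And>e. e > 0 \<Longrightarrow> \<exists>\<tau>0>0. \<forall>\<tau>. 0 < \<tau> \<and> \<tau> < \<tau>0 \<longrightarrow>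
    (\<exists>f. (\<forall>x. \<bar>f x - uinf x\<bar> \<le> e) \<and>
         (\<forall>x. \<exists>q. norm q \<le> R \<and> f (x - \<tau> *\<^sub>R q) \<le> f x - \<tau> * L x q + \<tau> * e))"
    by (rule calibrated_step) (rule that; assumption)
  obtain B where B: "\<And>x. \<bar>uinf x\<bar> \<le> B"
    using periodic_continuous_bounded[OF dominated_continuous[OF uinf_dominated] uinf_periodic] by blast
  have B0: "B \<ge> 0" using B[of 0] by simp
  have "\<exists>\<tau> N X Q. 0 < \<tau> \<and> \<tau> \<le> 1 / real m \<and> N > 0 \<and>
      real m \<le> real N * \<tau> \<and> (\<forall>k<N. norm (Q k) \<le> R \<and> X (Suc k) = X k - \<tau> *\<^sub>R Q k) \<and>
      (\<Sum>k<N. L (X k) (Q k)) / real N \<le> (2 * B + 3) / real m \<and>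
      (\<forall>k<N. dH H x0 (X k) \<le> uinf x0 - uinf (X k) + 1 / real m)"
    if m: "m > 0" for x0 and m :: nat
  proof -
    \<comment> \<open>Action and domination each lose at most \<open>(m + 1) * e\<close> over the
      chain, and replacing \<open>f\<close> by \<open>uinf\<close> at two points loses
      \<open>2 * e\<close>; the sum is \<open>1 / m\<close>.\<close>
    define e where "e = 1 / (2 * real m * (real m + 2))"
    have m1: "real m \<ge> 1" using m by simp
    have e: "e > 0" using m by (simp add: e_def)
    have "real m + 2 \<noteq> 0" by linarith
    then have em: "2 * e * (real m + 2) = 1 / real m" by (simp add: e_def)
    have "e * 1 \<le> e * (2 * (real m + 2))" using e by (intro mult_left_mono) auto
    then have e1: "e \<le> 1 / real m" using em by (simp add: mult_ac)
    obtain d where d: "d > 0" "\<And>x y q. norm q \<le> R \<Longrightarrow> dist x y < d \<Longrightarrow> L x q \<le> L y q + e"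
      using Lag_uniform[OF e, of R] by auto
    let ?good = "\<lambda>\<tau> f. (\<forall>x. \<bar>f x - uinf x\<bar> \<le> e) \<and>
         (\<forall>x. \<exists>q. norm q \<le> R \<and> f (x - \<tau> *\<^sub>R q) \<le> f x - \<tau> * L x q + \<tau> * e)"
    from R(2)[OF e] obtain \<tau>0 where \<tau>0: "\<tau>0 > 0 \<and> (\<forall>\<tau>. 0 < \<tau> \<and> \<tau> < \<tau>0 \<longrightarrow> (\<exists>f. ?good \<tau> f))" ..
    define \<tau> where "\<tau> = min (\<tau>0 / 2) (min (1 / real m) (d / (2 * (R + 1))))"
    have \<tau>: "0 < \<tau>" "\<tau> < \<tau>0" "\<tau> \<le> 1 / real m" "\<tau> \<le> 1"
    proof -
      show "0 < \<tau>" using \<tau>0 m d(1) R(1) by (simp add: \<tau>_def)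
      have "\<tau> \<le> \<tau>0 / 2" unfolding \<tau>_def by (rule min.cobounded1)
      then show "\<tau> < \<tau>0" using conjunct1[OF \<tau>0] by simp
      show "\<tau> \<le> 1 / real m" by (simp add: \<tau>_def)
      also have "\<dots> \<le> 1" using m1 by simp
      finally show "\<tau> \<le> 1" .
    qed
    have \<tau>R: "\<tau> * R < d"
    proof -
      have "\<tau> * R \<le> d / (2 * (R + 1)) * (R + 1)" using R(1) \<tau>(1) d(1) unfolding \<tau>_def by (intro mult_mono) auto
      also have "\<dots> = d / 2" using R(1) by (simp add: field_simps)
      finally show ?thesis using d(1) by simp
    qed
    have "\<exists>f. ?good \<tau> f" using conjunct2[OF \<tau>0] \<tau>(1,2) by (elim allE impE) (rule conjI)
    then obtain f where f: "?good \<tau> f" ..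
    then have f1: "\<bar>f x - uinf x\<bar> \<le> e" for x by (rule conjunct1[THEN spec])
    obtain q where q: "\<And>x. norm (q x) \<le> R" "\<And>x. f (x - \<tau> *\<^sub>R q x) \<le> f x - \<tau> * L x (q x) + \<tau> * e"
      using conjunct2[OF f] by metis
    define X where "X = (\<lambda>k. ((\<lambda>x. x - \<tau> *\<^sub>R q x) ^^ k) x0)"
    define Q where "Q = (\<lambda>k. q (X k))"
    have X: "X 0 = x0" "X (Suc k) = X k - \<tau> *\<^sub>R Q k" for k by (simp_all add: X_def Q_def)
    define N where "N = nat \<lceil>real m / \<tau>\<rceil>"
    have "real m / \<tau> > 0" using m \<tau>(1) by simp
    then have N: "real m / \<tau> \<le> real N" "real N < real m / \<tau> + 1" unfolding N_def by linarith+
    have N0: "N > 0" using N(1) \<open>real m / \<tau> > 0\<close> by (metis gr0I not_le of_nat_0)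
    have N\<tau>: "real m \<le> real N * \<tau>" "real N * \<tau> \<le> real m + 1"
    proof -
      show "real m \<le> real N * \<tau>" using N(1) \<tau>(1) by (simp add: pos_divide_le_eq)
      have "real N * \<tau> \<le> (real m / \<tau> + 1) * \<tau>" using N(2) \<tau>(1) by (intro mult_right_mono) auto
      then show "real N * \<tau> \<le> real m + 1" using \<tau> by (simp add: distrib_right)
    qed
    have act: "(\<Sum>j<k. \<tau> * L (X j) (Q j)) \<le> f x0 - f (X k) + real k * \<tau> * e" for k
    proof (induction k)
      case (Suc k)
      have "\<tau> * L (X k) (Q k) \<le> f (X k) - f (X (Suc k)) + \<tau> * e"
        using q(2)[of "X k"] X(2)[of k] by (simp add: Q_def)
      then show ?case using Suc by (simp add: algebra_simps)
    qed (simp add: X)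
    \<comment> \<open>Every subsolution is dominated by the action of the same chain; eliminating
      the action by means of \<open>act\<close> leaves the bound on \<open>dH\<close>.\<close>
    have dom: "v x0 - v (X k) \<le> (\<Sum>j<k. \<tau> * L (X j) (Q j)) + real k * \<tau> * e" if v: "visc_sub H v" for v k
    proof (induction k)
      case (Suc k)
      have "v (X (Suc k) + \<tau> *\<^sub>R Q k) \<le> v (X (Suc k)) + (L (X k) (Q k) + e) * \<tau>"
      proof (rule step_domD)
        show "step_dom H \<tau> v v" using visc_sub_imp_dominated[OF v] \<tau>(1) by (simp add: dominated_def)
        fix s assume s: "0 \<le> s" "s \<le> \<tau>"
        have "X (Suc k) + s *\<^sub>R Q k - X k = - ((\<tau> - s) *\<^sub>R Q k)" by (simp add: X(2) algebra_simps)
        then have "dist (X (Suc k) + s *\<^sub>R Q k) (X k) = (\<tau> - s) * norm (Q k)"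
          using s by (simp add: dist_norm)
        also have "\<dots> \<le> \<tau> * R" using s \<tau>(1) q(1) by (intro mult_mono) (auto simp: Q_def)
        finally show "L (X (Suc k) + s *\<^sub>R Q k) (Q k) \<le> L (X k) (Q k) + e"
          using \<tau>R q(1) by (intro d(2)) (auto simp: Q_def)
      qed
      then show ?case using Suc by (simp add: X(2) algebra_simps)
    qed (simp add: X)
    have dHX: "dH H x0 (X k) \<le> uinf x0 - uinf (X k) + 1 / real m" if k: "k < N" for k
    proof (rule dH_least[OF uinf_visc_sub])
      fix v assume v: "visc_sub H v"
      have "real k * \<tau> \<le> real N * \<tau>" using k \<tau>(1) by (intro mult_right_mono) auto
      then have "real k * \<tau> * e \<le> (real m + 1) * e" using N\<tau>(2) e by (intro mult_right_mono) auto
      moreover have "v x0 - v (X k) \<le> f x0 - f (X k) + 2 * (real k * \<tau> * e)"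
        using dom[OF v, of k] act[of k] by simp
      moreover have "f x0 - f (X k) \<le> uinf x0 - uinf (X k) + 2 * e"
        using f1[of x0] f1[of "X k"] by (simp add: abs_le_iff)
      moreover have "2 * ((real m + 1) * e) + 2 * e = 1 / real m" using em by (simp add: algebra_simps)
      ultimately show "v x0 - v (X k) \<le> uinf x0 - uinf (X k) + 1 / real m" by linarith
    qed
    have "(\<Sum>k<N. L (X k) (Q k)) / real N \<le> (2 * B + 3) / real m"
    proof -
      have "(\<Sum>j<N. \<tau> * L (X j) (Q j)) \<le> 2 * B + 2 * e + real N * \<tau> * e"
        using act[of N] f1[of x0] f1[of "X N"] B[of x0] B[of "X N"] by (simp add: abs_le_iff)
      then have "\<tau> * (\<Sum>j<N. L (X j) (Q j)) \<le> 2 * B + 2 * e + real N * \<tau> * e" by (simp add: sum_distrib_left)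
      then have "\<tau> * (\<Sum>j<N. L (X j) (Q j)) / (real N * \<tau>) \<le> (2 * B + 2 * e + real N * \<tau> * e) / (real N * \<tau>)"
        using N0 \<tau>(1) by (intro divide_right_mono) auto
      moreover have "\<tau> * (\<Sum>j<N. L (X j) (Q j)) / (real N * \<tau>) = (\<Sum>j<N. L (X j) (Q j)) / real N"
        using \<tau>(1) by simp
      moreover have "(2 * B + 2 * e + real N * \<tau> * e) / (real N * \<tau>) = (2 * B + 2 * e) / (real N * \<tau>) + e"
        using \<tau>(1) N0 by (simp add: field_simps)
      moreover have "(2 * B + 2 * e) / (real N * \<tau>) \<le> (2 * B + 2) / real m"
      proof -
        have "1 / real m \<le> 1" using m1 by simp
        then have "e \<le> 1" using e1 by linarith
        then show ?thesis using N\<tau>(1) m1 B0 e by (intro frac_le) auto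
      qed
      ultimately have "(\<Sum>j<N. L (X j) (Q j)) / real N \<le> (2 * B + 2) / real m + 1 / real m" using e1 by linarith
      moreover have "(2 * B + 2) / real m + 1 / real m = (2 * B + 3) / real m"
        by (simp add: add_divide_distrib[symmetric] add_ac)
      ultimately show ?thesis by simp
    qed
    then show ?thesis
      using \<tau> N0 N\<tau>(1) q(1) X(2) dHX
      by (intro exI[of _ \<tau>] exI[of _ N] exI[of _ X] exI[of _ Q]) (auto simp: Q_def)
  qed
  then show ?thesis by (rule that[OF R(1)])
qed

end

section \<open>Weak limits of empirical measures\<close>

text \<open>A clipped cosine in place of the usual piecewise linear wave: of period 2, equal to 0 on
  \<open>[0, 1/3]\<close> and to 1 on \<open>[2/3, 1]\<close>.\<close>

definition schoenberg_wave :: "real \<Rightarrow> real" where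
  "schoenberg_wave t = max 0 (min 1 (1/2 - cos (pi * t)))"

lemma schoenberg_wave_range: "0 \<le> schoenberg_wave t" "schoenberg_wave t \<le> 1"
  by (auto simp: schoenberg_wave_def)

lemma schoenberg_wave_cont: "continuous_on S schoenberg_wave"
  unfolding schoenberg_wave_def by (intro continuous_intros)

lemma schoenberg_wave_periodic: "schoenberg_wave (2 * of_int k + s) = schoenberg_wave s"
proof -
  have "cos (pi * (2 * of_int k + s)) = cos (pi * s + of_int k * (2 * pi))" by (simp add: algebra_simps)
  also have "\<dots> = cos (pi * s)" using cos.plus_of_int[of "pi * s" k] by simp
  finally show ?thesis by (simp add: schoenberg_wave_def)
qed

lemma schoenberg_wave_digit:
  assumes "d = 0 \<or> d = 1" "0 \<le> s" "s \<le> 1"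
  shows "schoenberg_wave (2 * d / 3 + s / 3) = d"
proof (cases "d = 0")
  case True
  have "pi * (s / 3) \<le> pi * (1 / 3)" using assms by (intro mult_left_mono) auto
  then have "cos (pi / 3) \<le> cos (pi * (s / 3))"
    using assms by (intro cos_monotone_0_pi_le) (auto simp: field_simps)
  then have "cos (pi * (s / 3)) \<ge> 1 / 2" by (simp add: cos_60)
  then show ?thesis using True by (simp add: schoenberg_wave_def)
next
  case False
  then have d: "d = 1" using assms(1) by simp
  have le: "pi * (2/3) \<le> pi * (2/3 + s/3)" "pi * (2/3 + s/3) \<le> pi * 1"
    using assms by (intro mult_left_mono; simp)+
  have "cos (pi * (2/3 + s/3)) \<le> cos (pi * (2/3))"
    using le by (intro cos_monotone_0_pi_le) auto
  also have "cos (pi * (2/3)) = - (1/2)" using cos_pi_minus[of "pi / 3"] by (simp add: cos_60 field_simps)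
  finally show ?thesis by (simp add: schoenberg_wave_def d)
qed

text \<open>\<open>T k\<close> has the ternary digits \<open>2 * d k, 2 * d (k + 1), ...\<close>.
  Multiplication by 3 moves one digit before the point; as the digits are even, the period 2 of the
  wave discards it, and the plateaus read the next one.\<close>

lemma schoenberg_wave_decode:
  assumes d: "\<And>n. d n = 0 \<or> d n = (1::real)"
  obtains t where "0 \<le> t" "t \<le> 1" "\<And>k. schoenberg_wave (3 ^ k * t) = d k"
proof -
  define T where "T = (\<lambda>k. \<Sum>m. 2 * d (k + m) * (1/3) ^ Suc m)"
  have dr: "0 \<le> d n" "d n \<le> 1" for n using d[of n] by auto
  have g: "(\<lambda>m. 2 * (1/3) ^ Suc m :: real) sums 1"
    using sums_mult[OF geometric_sums[of "1/3::real"], of "2/3"] by simp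
  have s: "summable (\<lambda>m. 2 * d (k + m) * (1/3) ^ Suc m)" for k
    by (rule summable_comparison_test'[OF sums_summable[OF g], of 0]) (use dr in \<open>auto simp: abs_mult mult_left_le\<close>)
  have T0: "T k \<ge> 0" for k unfolding T_def using dr by (intro suminf_nonneg s) auto
  have T1: "T k \<le> 1" for k
  proof -
    have "T k \<le> (\<Sum>m. 2 * (1/3) ^ Suc m)"
      unfolding T_def using dr by (intro suminf_le s sums_summable[OF g]) (auto simp: mult_left_le)
    then show ?thesis by (simp only: sums_unique[OF g, symmetric])
  qed
  have Tstep: "T k = 2 * d k / 3 + T (Suc k) / 3" for k
  proof -
    have "T k = (\<Sum>m. 2 * d (k + Suc m) * (1/3) ^ Suc (Suc m)) + 2 * d (k + 0) * (1/3) ^ Suc 0"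
      unfolding T_def using suminf_split_head[OF s[of k]] by simp
    also have "(\<Sum>m. 2 * d (k + Suc m) * (1/3) ^ Suc (Suc m)) = (\<Sum>m. (2 * d (Suc k + m) * (1/3) ^ Suc m) * (1/3))"
      by (intro suminf_cong) simp
    also have "\<dots> = T (Suc k) * (1/3)" unfolding T_def by (rule suminf_mult2[symmetric, OF s])
    finally show ?thesis by simp
  qed
  have "\<exists>j::int. 3 ^ k * T 0 = 2 * of_int j + T k" for k
  proof (induction k)
    case 0 show ?case by (intro exI[of _ 0]) simp
  next
    case (Suc k)
    then obtain j :: int where j: "3 ^ k * T 0 = 2 * of_int j + T k" by blast
    obtain b :: int where b: "d k = of_int b" using d[of k] by (metis of_int_0 of_int_1)
    have "3 ^ Suc k * T 0 = 2 * of_int (3 * j + b) + T (Suc k)"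
      using j Tstep[of k] b by (simp add: algebra_simps)
    then show ?case by blast
  qed
  then have "schoenberg_wave (3 ^ k * T 0) = d k" for k
    by (metis schoenberg_wave_periodic Tstep schoenberg_wave_digit d T0 T1)
  then show ?thesis using T0 T1 that by blast
qed

lemma binary_expansion:
  assumes "0 \<le> y" "y \<le> (1::real)"
  obtains d where "\<And>n. d n = 0 \<or> d n = (1::real)" "(\<lambda>n. d n * (1/2) ^ Suc n) sums y"
proof (cases "y = 1")
  \<comment> \<open>The digits defined by floors below would all be 0 for \<open>y = 1\<close>, so
    the expansion with all digits 1 is used.\<close>
  case True
  have "(\<lambda>n. 1 * (1/2::real) ^ Suc n) sums 1"
    using power_half_series by simp
  then show ?thesis using True by (intro that[of "\<lambda>n. 1"]) auto
next
  case False
  then have y: "0 \<le> y" "y < 1" using assms by auto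
  define d :: "nat \<Rightarrow> real" where "d = (\<lambda>n. of_int (\<lfloor>2 ^ Suc n * y\<rfloor> - 2 * \<lfloor>2 ^ n * y\<rfloor>))"
  have "d n = 0 \<or> d n = 1" for n
  proof -
    have "\<lfloor>2 ^ Suc n * y\<rfloor> - 2 * \<lfloor>2 ^ n * y\<rfloor> \<in> {0, 1}"
      using floor_correct[of "2 ^ n * y"] floor_correct[of "2 ^ Suc n * y"] by simp linarith
    then show ?thesis unfolding d_def by auto
  qed
  moreover have "(\<lambda>n. d n * (1/2) ^ Suc n) sums y"
  proof -
    have part: "(\<Sum>i<n. d i * (1/2) ^ Suc i) = of_int \<lfloor>2 ^ n * y\<rfloor> / 2 ^ n" for n
    proof (induction n)
      case 0
      have "\<lfloor>y\<rfloor> = 0" using y by (simp add: floor_eq_iff)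
      then show ?case by simp
    next
      case (Suc n)
      then show ?case by (simp add: d_def field_simps)
    qed
    have "(\<lambda>n. of_int \<lfloor>2 ^ n * y\<rfloor> / 2 ^ n) \<longlonglongrightarrow> y"
    proof (rule tendsto_sandwich)
      have "y - (1/2) ^ n \<le> of_int \<lfloor>2 ^ n * y\<rfloor> / 2 ^ n" for n
      proof -
        have "2 ^ n * y - 1 \<le> of_int \<lfloor>2 ^ n * y\<rfloor>" by linarith
        then have "(2 ^ n * y - 1) / 2 ^ n \<le> of_int \<lfloor>2 ^ n * y\<rfloor> / 2 ^ n" by (intro divide_right_mono) auto
        then show ?thesis by (simp add: diff_divide_distrib power_one_over)
      qed
      then show "\<forall>\<^sub>F n in sequentially. y - (1/2) ^ n \<le> of_int \<lfloor>2 ^ n * y\<rfloor> / 2 ^ n" by simp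
      have "of_int \<lfloor>2 ^ n * y\<rfloor> / 2 ^ n \<le> y" for n
        using of_int_floor_le[of "2 ^ n * y"] by (simp add: divide_le_eq mult.commute)
      then show "\<forall>\<^sub>F n in sequentially. of_int \<lfloor>2 ^ n * y\<rfloor> / 2 ^ n \<le> y" by simp
      have "(\<lambda>n. (1/2::real) ^ n) \<longlonglongrightarrow> 0" by (intro LIMSEQ_realpow_zero) auto
      from tendsto_diff[OF tendsto_const[of y] this] show "(\<lambda>n. y - (1/2) ^ n) \<longlonglongrightarrow> y" by simp
    qed simp
    then show ?thesis unfolding sums_def part .
  qed
  ultimately show ?thesis by (rule that)
qed

text \<open>Schoenberg's space-filling curve: the coordinate with number \<open>j\<close> reads its \<open>i\<close>-th binary digit
  from the ternary digit of the parameter at position \<open>prod_encode (i, j)\<close>.\<close>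

lemma continuous_surjection_onto_cbox:
  fixes a b :: "'a::euclidean_space"
  assumes ab: "\<And>i. i \<in> Basis \<Longrightarrow> a \<bullet> i \<le> b \<bullet> i"
  obtains g :: "real \<Rightarrow> 'a" where "continuous_on UNIV g" "\<And>t. g t \<in> cbox a b"
    "\<And>x. x \<in> cbox a b \<Longrightarrow> \<exists>t\<in>{0..1}. g t = x"
proof -
  obtain e :: "'a \<Rightarrow> nat" where e: "inj_on e Basis"
    using finite_imp_inj_to_nat_seg[of "Basis::'a set"] by auto
  define c where "c = (\<lambda>j t. \<Sum>i. schoenberg_wave (3 ^ prod_encode (i, j) * t) * (1/2) ^ Suc i)"
  have half: "(\<lambda>i. (1/2::real) ^ Suc i) sums 1" by (rule power_half_series)
  have bnd: "norm (schoenberg_wave s * (1/2) ^ Suc i) \<le> (1/2) ^ Suc i" for s i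
    using schoenberg_wave_range[of s] by (simp add: abs_mult mult_left_le)
  have sm: "summable (\<lambda>i. schoenberg_wave (3 ^ prod_encode (i, j) * t) * (1/2) ^ Suc i)" for j t
    by (rule summable_comparison_test'[OF sums_summable[OF half], of 0]) (rule bnd)
  have c_cont: "continuous_on UNIV (c j)" for j
  proof (rule uniform_limit_theorem)
    show "uniform_limit UNIV (\<lambda>n t. \<Sum>i<n. schoenberg_wave (3 ^ prod_encode (i, j) * t) * (1/2) ^ Suc i) (c j) sequentially"
      unfolding c_def by (rule Weierstrass_m_test[OF bnd sums_summable[OF half]])
    show "\<forall>\<^sub>F n in sequentially. continuous_on UNIV (\<lambda>t. \<Sum>i<n. schoenberg_wave (3 ^ prod_encode (i, j) * t) * (1/2) ^ Suc i)"
      by (intro always_eventually allI continuous_intros continuous_on_compose2[OF schoenberg_wave_cont]) auto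
  qed simp
  have c_range: "0 \<le> c j t" "c j t \<le> 1" for j t
  proof -
    show "0 \<le> c j t" unfolding c_def using schoenberg_wave_range by (intro suminf_nonneg sm) auto
    have "c j t \<le> (\<Sum>i. (1/2) ^ Suc i)"
      unfolding c_def using schoenberg_wave_range
      by (intro suminf_le sm sums_summable[OF half]) (auto simp: mult_left_le_one_le)
    then show "c j t \<le> 1" by (simp only: sums_unique[OF half, symmetric])
  qed
  define g where "g = (\<lambda>t. \<Sum>i\<in>Basis. (a \<bullet> i + (b \<bullet> i - a \<bullet> i) * c (e i) t) *\<^sub>R i)"
  have g_inner: "g t \<bullet> i = a \<bullet> i + (b \<bullet> i - a \<bullet> i) * c (e i) t" if "i \<in> Basis" for t i
    unfolding g_def using that by simp
  show ?thesis
  proof (rule that[of g])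
    show "continuous_on UNIV g" unfolding g_def by (intro continuous_intros c_cont)
    show "g t \<in> cbox a b" for t
      unfolding mem_box
    proof (intro ballI conjI)
      fix i :: 'a assume i: "i \<in> Basis"
      have "0 \<le> (b \<bullet> i - a \<bullet> i) * c (e i) t" using ab[OF i] c_range by (intro mult_nonneg_nonneg) auto
      then show "a \<bullet> i \<le> g t \<bullet> i" using g_inner[OF i] by simp
      have "(b \<bullet> i - a \<bullet> i) * c (e i) t \<le> (b \<bullet> i - a \<bullet> i) * 1" using ab[OF i] c_range by (intro mult_left_mono) auto
      then show "g t \<bullet> i \<le> b \<bullet> i" using g_inner[OF i] by simp
    qed
    fix x assume x: "x \<in> cbox a b"
    have "\<exists>y. 0 \<le> y \<and> y \<le> 1 \<and> x \<bullet> i = a \<bullet> i + (b \<bullet> i - a \<bullet> i) * y" if i: "i \<in> Basis" for i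
    proof (cases "b \<bullet> i = a \<bullet> i")
      case True
      then show ?thesis using x i by (intro exI[of _ 0]) (force simp: mem_box)
    next
      case False
      then have "b \<bullet> i - a \<bullet> i > 0" using ab[OF i] by simp
      then show ?thesis using x i
        by (intro exI[of _ "(x \<bullet> i - a \<bullet> i) / (b \<bullet> i - a \<bullet> i)"]) (auto simp: mem_box)
    qed
    then obtain y where y: "\<And>i. i \<in> Basis \<Longrightarrow> 0 \<le> y i" "\<And>i. i \<in> Basis \<Longrightarrow> y i \<le> 1"
      "\<And>i. i \<in> Basis \<Longrightarrow> x \<bullet> i = a \<bullet> i + (b \<bullet> i - a \<bullet> i) * y i" by metis
    have "\<exists>d. (\<forall>n. d n = 0 \<or> d n = (1::real)) \<and> (\<lambda>n. d n * (1/2) ^ Suc n) sums y i" if "i \<in> Basis" for i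
      using binary_expansion[OF y(1)[OF that] y(2)[OF that]] by metis
    then obtain d where d: "\<And>i n. i \<in> Basis \<Longrightarrow> d i n = 0 \<or> d i n = (1::real)"
      "\<And>i. i \<in> Basis \<Longrightarrow> (\<lambda>n. d i n * (1/2) ^ Suc n) sums y i" by metis
    \<comment> \<open>All digit sequences are interleaved into one; positions that belong to no
      basis vector get the digit 0.\<close>
    define D where "D = (\<lambda>m. case prod_decode m of (n, j) \<Rightarrow> if j \<in> e ` Basis then d (inv_into Basis e j) n else 0)"
    have "D m = 0 \<or> D m = 1" for m
    proof -
      obtain n j where m: "prod_decode m = (n, j)" by force
      show ?thesis
        using d(1)[of "inv_into Basis e j" n] inv_into_into[of j e Basis] by (simp add: D_def m)
    qed
    then obtain t where t: "0 \<le> t" "t \<le> 1" "\<And>k. schoenberg_wave (3 ^ k * t) = D k"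
      using schoenberg_wave_decode[of D] by blast
    have "c (e i) t = y i" if i: "i \<in> Basis" for i
    proof -
      have "D (prod_encode (n, e i)) = d i n" for n
        using i by (simp add: D_def inv_into_f_f[OF e])
      then have "c (e i) t = (\<Sum>n. d i n * (1/2) ^ Suc n)" by (simp add: c_def t(3))
      then show ?thesis using sums_unique[OF d(2)[OF i]] by simp
    qed
    then have "g t \<bullet> i = x \<bullet> i" if "i \<in> Basis" for i using g_inner[OF that, of t] y(3)[OF that] that by metis
    then have "g t = x" by (rule euclidean_eqI)
    then show "\<exists>t\<in>{0..1}. g t = x" using t by (intro bexI[of _ t]) auto
  qed
qed

text \<open>Lifting the points through a space-filling curve reduces the weak compactness of probability
  measures on a box to Helly's selection theorem on the line.\<close>

lemma empirical_measures_weak_limit: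
  fixes Z :: "nat \<Rightarrow> nat \<Rightarrow> 'a::euclidean_space" and N :: "nat \<Rightarrow> nat"
  assumes N: "\<And>m. N m > 0" and Z: "\<And>m k. k < N m \<Longrightarrow> Z m k \<in> cbox a b"
  obtains \<mu> r where "prob_space \<mu>" "sets \<mu> = sets borel" "AE z in \<mu>. z \<in> cbox a b" "strict_mono (r :: nat \<Rightarrow> nat)"
    "\<And>f :: 'a \<Rightarrow> real. continuous_on UNIV f \<Longrightarrow>
       (\<lambda>m. (\<Sum>k<N (r m). f (Z (r m) k)) / real (N (r m))) \<longlonglongrightarrow> (\<integral>z. f z \<partial>\<mu>)"
proof -
  have "cbox a b \<noteq> {}" using Z[OF N] by blast
  then have ab: "\<And>i. i \<in> Basis \<Longrightarrow> a \<bullet> i \<le> b \<bullet> i" by (simp add: box_ne_empty)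
  obtain g :: "real \<Rightarrow> 'a" where g: "continuous_on UNIV g" "\<And>t. g t \<in> cbox a b"
    "\<And>x. x \<in> cbox a b \<Longrightarrow> \<exists>t\<in>{0..1}. g t = x"
    using continuous_surjection_onto_cbox[OF ab] by metis
  have "\<forall>m k. \<exists>t. k < N m \<longrightarrow> t \<in> {0..1} \<and> g t = Z m k" using g(3)[OF Z] by blast
  then obtain t where t: "\<And>m k. k < N m \<Longrightarrow> t m k \<in> {0..1} \<and> g (t m k) = Z m k" by metis
  let ?U = "\<lambda>m. uniform_count_measure {..<N m}"
  define \<nu> where "\<nu> = (\<lambda>m. distr (?U m) borel (t m))"
  have Up: "prob_space (?U m)" for m using N[of m] by (intro prob_space_uniform_count_measure) auto
  have tm: "t m \<in> measurable (?U m) borel" for m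
    by (auto simp: measurable_def space_uniform_count_measure sets_uniform_count_measure)
  have rd: "real_distribution (\<nu> m)" for m
    unfolding \<nu>_def real_distribution_def real_distribution_axioms_def
    using prob_space.prob_space_distr[OF Up tm] by simp
  have "tight \<nu>"
    unfolding tight_def
  proof (intro conjI allI impI rd)
    fix \<epsilon> :: real assume \<epsilon>: "\<epsilon> > 0"
    \<comment> \<open>\<open>tight\<close> speaks of half-open intervals, so the left end must lie
      below the possible parameter 0.\<close>
    have "1 - \<epsilon> < measure (\<nu> m) {-1<..1}" for m
    proof -
      have "t m -` {-1<..1} \<inter> space (?U m) = space (?U m)"
        using t by (force simp: space_uniform_count_measure)
      then have "measure (\<nu> m) {-1<..1} = measure (?U m) (space (?U m))"
        unfolding \<nu>_def by (subst measure_distr[OF tm]) auto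
      then show ?thesis using prob_space.prob_space[OF Up] \<epsilon> by simp
    qed
    then show "\<exists>a b. a < b \<and> (\<forall>m. 1 - \<epsilon> < measure (\<nu> m) {a<..b})"
      by (intro exI[of _ "-1"] exI[of _ 1]) simp
  qed
  from tight_imp_convergent_subsubsequence[OF this strict_mono_id] obtain r M where
    r: "strict_mono (r :: nat \<Rightarrow> nat)" and M: "real_distribution M" and wc: "weak_conv_m (\<nu> \<circ> r) M"
    by (auto simp: id_def o_def)
  interpret M: real_distribution M by (rule M)
  have gm: "g \<in> borel_measurable M"
    unfolding measurable_cong_sets[OF M.events_eq_borel refl] using g(1) by (rule borel_measurable_continuous_onI)
  show ?thesis
  proof (rule that[of "distr M borel g" r])
    show "prob_space (distr M borel g)" by (rule M.prob_space_distr[OF gm])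
    show "sets (distr M borel g) = sets borel" by simp
    show "AE z in distr M borel g. z \<in> cbox a b"
      by (subst AE_distr_iff[OF gm]) (use g(2) in auto)
    show "strict_mono r" by (rule r)
    fix f :: "'a \<Rightarrow> real" assume f: "continuous_on UNIV f"
    have "compact (f ` cbox a b)" using f by (intro compact_continuous_image) (auto intro: continuous_on_subset)
    then obtain B where B: "\<And>y. y \<in> f ` cbox a b \<Longrightarrow> \<bar>y\<bar> \<le> B" by (meson bounded_real compact_imp_bounded)
    have fg: "continuous_on UNIV (\<lambda>s. f (g s))" by (rule continuous_on_compose2[OF f g(1)]) simp
    \<comment> \<open>Convergence on the line is tested with \<open>f\<close> composed with
      \<open>g\<close>, which is bounded because \<open>g\<close> stays in the box; the limit on the
      box is the image of \<open>M\<close> under \<open>g\<close>.\<close>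
    have "(\<lambda>n. integral\<^sup>L ((\<nu> \<circ> r) n) (\<lambda>s. f (g s))) \<longlonglongrightarrow> integral\<^sup>L M (\<lambda>s. f (g s))"
    proof (rule weak_conv_imp_integral_bdd_continuous_conv[OF _ M wc])
      show "real_distribution ((\<nu> \<circ> r) n)" for n using rd by simp
      show "isCont (\<lambda>s. f (g s)) x" for x using fg by (simp add: continuous_on_eq_continuous_at)
      show "norm (f (g x)) \<le> B" for x using B g(2) by simp
    qed
    moreover have "integral\<^sup>L ((\<nu> \<circ> r) n) (\<lambda>s. f (g s)) = (\<Sum>k<N (r n). f (Z (r n) k)) / real (N (r n))" for n
    proof -
      have "integral\<^sup>L (\<nu> (r n)) (\<lambda>s. f (g s)) = integral\<^sup>L (?U (r n)) (\<lambda>k. f (g (t (r n) k)))"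
        unfolding \<nu>_def by (rule integral_distr[OF tm borel_measurable_continuous_onI[OF fg]])
      also have "\<dots> = (\<Sum>k<N (r n). f (g (t (r n) k))) / real (N (r n))"
        by (simp add: integral_uniform_count_measure)
      also have "(\<Sum>k<N (r n). f (g (t (r n) k))) = (\<Sum>k<N (r n). f (Z (r n) k))"
        using t by (intro sum.cong) auto
      finally show ?thesis by simp
    qed
    moreover have "integral\<^sup>L (distr M borel g) f = integral\<^sup>L M (\<lambda>s. f (g s))"
      by (rule integral_distr[OF gm borel_measurable_continuous_onI[OF f]])
    ultimately show "(\<lambda>m. (\<Sum>k<N (r m). f (Z (r m) k)) / real (N (r m))) \<longlonglongrightarrow> integral\<^sup>L (distr M borel g) f"
      by simp
  qed
qed

section \<open>Mather measures from calibrated curves\<close>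

text \<open>\<open>closed_measures\<close> asks for periodicity of the test function only; with a
  periodic gradient the integrand lives on the torus.\<close>

lemma C1_grad_periodic:
  fixes \<phi> :: "real^'n \<Rightarrow> real"
  assumes "C1_grad \<phi> g" "periodic_fun \<phi>"
  shows "periodic_fun g"
  unfolding periodic_fun_def
proof (intro allI ballI)
  fix x k :: "real^'n" assume k: "k \<in> Zlat"
  have der: "(\<phi> has_derivative (\<lambda>h. g y \<bullet> h)) (at y)" for y using assms(1) by (simp add: C1_grad_def)
  have "((\<lambda>y. \<phi> (y + k)) has_derivative (\<lambda>h. g (x + k) \<bullet> h)) (at x)"
    by (rule has_derivative_compose[OF _ der]) (auto intro!: derivative_eq_intros)
  moreover have "(\<lambda>y. \<phi> (y + k)) = \<phi>" using assms(2) k by (simp add: periodic_fun_def fun_eq_iff)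
  ultimately have "(\<lambda>h. g (x + k) \<bullet> h) = (\<lambda>h. g x \<bullet> h)" using has_derivative_unique[OF _ der] by simp
  then show "g (x + k) = g x" by (metis vector_eq_rdot inner_commute)
qed

text \<open>Otherwise every point has a null neighbourhood; finitely many of them cover the cube,
  and with their lattice translates all of space.\<close>

lemma proj_supp_nonempty:
  assumes \<mu>: "torus_prob (\<mu> :: ((real^'n) \<times> (real^'n)) measure)"
  shows "proj_supp \<mu> \<noteq> {}"
proof
  assume empty: "proj_supp \<mu> = {}"
  interpret prob_space \<mu> using \<mu> by (simp add: torus_prob_def)
  have s: "sets \<mu> = sets borel" using \<mu> by (simp add: torus_prob_def)
  then have sp: "space \<mu> = UNIV" using sets_eq_imp_space_eq[OF s] by simp
  let ?S = "\<lambda>y e. {z. \<exists>k\<in>Zlat. dist (fst z + k) y < e} :: ((real^'n) \<times> (real^'n)) set"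
  have "\<forall>y. \<exists>e>0. emeasure \<mu> (?S y e) = 0"
  proof
    fix y
    have "y \<notin> proj_supp \<mu>" using empty by simp
    then show "\<exists>e>0. emeasure \<mu> (?S y e) = 0" unfolding proj_supp_def by (simp add: not_gr_zero)
  qed
  then have "\<exists>e. \<forall>y. e y > 0 \<and> emeasure \<mu> (?S y (e y)) = 0" by (rule choice)
  then obtain e where e: "\<And>y. e y > 0" "\<And>y. emeasure \<mu> (?S y (e y)) = 0" by blast
  have Sm: "?S y r \<in> sets \<mu>" for y r
  proof -
    have "?S y r = (\<Union>k\<in>Zlat. {z. dist (fst z + k) y < r})" by auto
    moreover have "open {z::(real^'n) \<times> (real^'n). dist (fst z + k) y < r}" for k
      by (intro open_Collect_less continuous_intros)
    ultimately have "open (?S y r)" by auto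
    then show ?thesis using s by simp
  qed
  obtain Y where Y: "finite Y" "cbox 0 1 \<subseteq> (\<Union>y\<in>Y. ball y (e y))"
  proof (rule compactE_image[of "cbox (0::real^'n) 1" UNIV "\<lambda>y. ball y (e y)"])
    show "cbox 0 1 \<subseteq> (\<Union>y\<in>UNIV. ball y (e y))"
    proof
      fix y show "y \<in> (\<Union>y\<in>UNIV. ball y (e y))" using e(1)[of y] by (intro UN_I[of y]) auto
    qed
  qed auto
  have cover: "UNIV \<subseteq> (\<Union>y\<in>Y. ?S y (e y))"
  proof
    fix z :: "(real^'n) \<times> (real^'n)"
    obtain y where y: "y \<in> Y" "frac_vec (fst z) \<in> ball y (e y)" using Y(2) frac_vec_in_cbox by blast
    have "fst z + - (fst z - frac_vec (fst z)) = frac_vec (fst z)" by simp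
    then have "dist (fst z + - (fst z - frac_vec (fst z))) y < e y" using y(2) by (simp add: dist_commute)
    then have "z \<in> ?S y (e y)" using Zlat_uminus[OF diff_frac_vec_in_Zlat] by blast
    then show "z \<in> (\<Union>y\<in>Y. ?S y (e y))" using y(1) by blast
  qed
  have "(\<Union>y\<in>Y. ?S y (e y)) \<in> null_sets \<mu>"
    using Y(1) e(2) Sm by (intro null_sets.finite_UN null_setsI)
  then have "space \<mu> \<in> null_sets \<mu>" unfolding sp using cover by (simp only: top.extremum_unique)
  then have "emeasure \<mu> (space \<mu>) = 0" by (rule null_setsD1)
  then show False using emeasure_space_1 by simp
qed

lemma frac_vec_measurable: "(frac_vec :: real^'n \<Rightarrow> real^'n) \<in> borel_measurable borel"
proof (rule borel_measurable_euclidean_space[THEN iffD2], intro ballI)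
  fix b :: "real^'n" assume "b \<in> Basis"
  then obtain i where b: "b = axis i 1" by (auto simp: Basis_vec_def)
  have "(\<lambda>x::real^'n. x $ i) \<in> borel_measurable borel"
    by (intro borel_measurable_continuous_onI continuous_intros)
  moreover have "(frac :: real \<Rightarrow> real) \<in> borel_measurable borel" unfolding frac_def by measurable
  ultimately have "(\<lambda>x::real^'n. frac (x $ i)) \<in> borel_measurable borel" by (rule measurable_compose)
  then show "(\<lambda>x::real^'n. frac_vec x \<bullet> b) \<in> borel_measurable borel"
    by (simp add: b inner_axis frac_vec_def)
qed

section \<open>Limit measures of chains and the two assertions\<close>

context convergent_cauchy_solution
begin

text \<open>Each property is the limit of an average along the chains: closedness from telescoping a
  test function, nonpositive action from the \<open>C / m\<close> bound, and equality on the support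
  from the \<open>1 / m\<close> bound for \<open>dH\<close>.\<close>

lemma calibrated_closed_measure:
  obtains \<mu> where "\<mu> \<in> closed_measures" "integrable \<mu> (\<lambda>z. L (fst z) (snd z))"
    "(\<integral>z. L (fst z) (snd z) \<partial>\<mu>) \<le> 0"
    "\<And>y. y \<in> proj_supp \<mu> \<Longrightarrow> uinf x0 = dH H x0 y + uinf y"
proof -
  obtain R C where R0: "R \<ge> 0" and RC: "\<And>x0 (m::nat). m > 0 \<Longrightarrow> \<exists>\<tau> N X Q. 0 < \<tau> \<and> \<tau> \<le> 1 / real m \<and> N > 0 \<and>
      real m \<le> real N * \<tau> \<and> (\<forall>k<N. norm (Q k) \<le> R \<and> X (Suc k) = X k - \<tau> *\<^sub>R Q k) \<and>
      (\<Sum>k<N. L (X k) (Q k)) / real N \<le> C / real m \<and>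
      (\<forall>k<N. dH H x0 (X k) \<le> uinf x0 - uinf (X k) + 1 / real m)"
    by (rule calibrated_chain) (rule that; assumption)
  have "\<forall>m. \<exists>\<tau> N X Q. 0 < \<tau> \<and> \<tau> \<le> 1 / real (Suc m) \<and> N > 0 \<and>
      real (Suc m) \<le> real N * \<tau> \<and> (\<forall>k<N. norm (Q k) \<le> R \<and> X (Suc k) = X k - \<tau> *\<^sub>R Q k) \<and>
      (\<Sum>k<N. L (X k) (Q k)) / real N \<le> C / real (Suc m) \<and>
      (\<forall>k<N. dH H x0 (X k) \<le> uinf x0 - uinf (X k) + 1 / real (Suc m))"
    by (intro allI RC) simp
  from this[THEN choice] obtain \<tau> where "\<forall>m. \<exists>N X Q. 0 < \<tau> m \<and> \<tau> m \<le> 1 / real (Suc m) \<and> N > 0 \<and>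
      real (Suc m) \<le> real N * \<tau> m \<and> (\<forall>k<N. norm (Q k) \<le> R \<and> X (Suc k) = X k - \<tau> m *\<^sub>R Q k) \<and>
      (\<Sum>k<N. L (X k) (Q k)) / real N \<le> C / real (Suc m) \<and>
      (\<forall>k<N. dH H x0 (X k) \<le> uinf x0 - uinf (X k) + 1 / real (Suc m))" ..
  from this[THEN choice] obtain N where "\<forall>m. \<exists>X Q. 0 < \<tau> m \<and> \<tau> m \<le> 1 / real (Suc m) \<and> N m > 0 \<and>
      real (Suc m) \<le> real (N m) * \<tau> m \<and> (\<forall>k<N m. norm (Q k) \<le> R \<and> X (Suc k) = X k - \<tau> m *\<^sub>R Q k) \<and>
      (\<Sum>k<N m. L (X k) (Q k)) / real (N m) \<le> C / real (Suc m) \<and>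
      (\<forall>k<N m. dH H x0 (X k) \<le> uinf x0 - uinf (X k) + 1 / real (Suc m))" ..
  from this[THEN choice] obtain X where "\<forall>m. \<exists>Q. 0 < \<tau> m \<and> \<tau> m \<le> 1 / real (Suc m) \<and> N m > 0 \<and>
      real (Suc m) \<le> real (N m) * \<tau> m \<and> (\<forall>k<N m. norm (Q k) \<le> R \<and> X m (Suc k) = X m k - \<tau> m *\<^sub>R Q k) \<and>
      (\<Sum>k<N m. L (X m k) (Q k)) / real (N m) \<le> C / real (Suc m) \<and>
      (\<forall>k<N m. dH H x0 (X m k) \<le> uinf x0 - uinf (X m k) + 1 / real (Suc m))" ..
  from this[THEN choice] obtain Q where ch: "\<forall>m. 0 < \<tau> m \<and> \<tau> m \<le> 1 / real (Suc m) \<and> N m > 0 \<and>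
      real (Suc m) \<le> real (N m) * \<tau> m \<and> (\<forall>k<N m. norm (Q m k) \<le> R \<and> X m (Suc k) = X m k - \<tau> m *\<^sub>R Q m k) \<and>
      (\<Sum>k<N m. L (X m k) (Q m k)) / real (N m) \<le> C / real (Suc m) \<and>
      (\<forall>k<N m. dH H x0 (X m k) \<le> uinf x0 - uinf (X m k) + 1 / real (Suc m))" ..
  have \<tau>: "0 < \<tau> m" "\<tau> m \<le> 1 / real (Suc m)" and N: "N m > 0" "real (Suc m) \<le> real (N m) * \<tau> m"
    and avgL: "(\<Sum>k<N m. L (X m k) (Q m k)) / real (N m) \<le> C / real (Suc m)" for m
    using ch by blast+
  have Q: "norm (Q m k) \<le> R" and X: "X m (Suc k) = X m k - \<tau> m *\<^sub>R Q m k"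
    and dX: "dH H x0 (X m k) \<le> uinf x0 - uinf (X m k) + 1 / real (Suc m)" if "k < N m" for m k
    using ch that by blast+
  let ?a = "(0, - R *\<^sub>R One) :: (real^'n) \<times> (real^'n)" and ?b = "(1, R *\<^sub>R One) :: (real^'n) \<times> (real^'n)"
  \<comment> \<open>Base points are reduced to the cube for compactness, which periodic integrands
    do not notice.\<close>
  define Z where "Z = (\<lambda>m k. (frac_vec (X m k), Q m k))"
  have Zin: "Z m k \<in> cbox ?a ?b" if "k < N m" for m k
  proof -
    have "- R \<le> Q m k \<bullet> b \<and> Q m k \<bullet> b \<le> R" if b: "b \<in> Basis" for b
      using Basis_le_norm[OF b, of "Q m k"] Q[OF \<open>k < N m\<close>] by linarith
    then have "Q m k \<in> cbox (- R *\<^sub>R One) (R *\<^sub>R One)" by (simp add: mem_box)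
    then show ?thesis using frac_vec_in_cbox by (simp add: Z_def cbox_Pair_eq)
  qed
  obtain \<mu>0 r where \<mu>0: "prob_space \<mu>0" "sets \<mu>0 = sets borel" "AE z in \<mu>0. z \<in> cbox ?a ?b"
    and r: "strict_mono (r :: nat \<Rightarrow> nat)"
    and lim: "\<And>f :: (real^'n) \<times> (real^'n) \<Rightarrow> real. continuous_on UNIV f \<Longrightarrow>
       (\<lambda>m. (\<Sum>k<N (r m). f (Z (r m) k)) / real (N (r m))) \<longlonglongrightarrow> (\<integral>z. f z \<partial>\<mu>0)"
    by (rule empirical_measures_weak_limit[of N Z ?a ?b, OF N(1) Zin]) (assumption | rule that; assumption)+
  interpret \<mu>0: prob_space \<mu>0 by (rule \<mu>0(1))
  \<comment> \<open>The weak limit lives on the closed cube and may charge the faces with a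
    coordinate 1. Reduction modulo the lattice moves that mass into \<open>unit_cube\<close>, as
    \<open>torus_prob\<close> demands.\<close>
  define w where "w = (\<lambda>z::(real^'n) \<times> (real^'n). (frac_vec (fst z), snd z))"
  have w: "w \<in> measurable \<mu>0 borel"
  proof -
    have "(\<lambda>z::(real^'n) \<times> (real^'n). frac_vec (fst z)) \<in> borel_measurable borel"
      by (rule measurable_compose[OF _ frac_vec_measurable]) (intro borel_measurable_continuous_onI continuous_intros)
    moreover have "(snd :: (real^'n) \<times> (real^'n) \<Rightarrow> _) \<in> borel_measurable borel"
      by (intro borel_measurable_continuous_onI continuous_intros)
    ultimately have "w \<in> borel_measurable borel" unfolding w_def by (rule borel_measurable_Pair)
    then show ?thesis unfolding measurable_cong_sets[OF \<mu>0(2) refl] .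
  qed
  define \<mu> where "\<mu> = distr \<mu>0 borel w"
  have tp: "torus_prob \<mu>"
    unfolding torus_prob_def
  proof (intro conjI)
    show "prob_space \<mu>" unfolding \<mu>_def by (rule \<mu>0.prob_space_distr[OF w])
    show "sets \<mu> = sets borel" by (simp add: \<mu>_def)
    \<comment> \<open>The preimage is empty; if the set were not measurable, \<open>emeasure\<close>
      would be 0 by convention, so both cases close.\<close>
    have "w -` (- (unit_cube \<times> UNIV)) = {}" using frac_vec_in_unit_cube by (auto simp: w_def)
    then show "emeasure \<mu> (- (unit_cube \<times> UNIV)) = 0"
      unfolding \<mu>_def
      by (cases "- (unit_cube \<times> UNIV) \<in> sets (borel :: ((real^'n) \<times> (real^'n)) measure)")
        (simp_all add: emeasure_distr[OF w] emeasure_notin_sets)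
  qed
  have key: "integrable \<mu> f"
    "(\<lambda>m. (\<Sum>k<N (r m). f (X (r m) k, Q (r m) k)) / real (N (r m))) \<longlonglongrightarrow> (\<integral>z. f z \<partial>\<mu>)"
    if f: "continuous_on UNIV f" and per: "\<And>q. periodic_fun (\<lambda>x. f (x, q))" for f :: "(real^'n) \<times> (real^'n) \<Rightarrow> real"
  proof -
    have fm: "f \<in> borel_measurable borel" using f by (rule borel_measurable_continuous_onI)
    have fw: "f (frac_vec x, q) = f (x, q)" for x q using periodic_frac_vec[OF per] .
    then have fw': "(\<lambda>z. f (w z)) = f" by (simp add: w_def fun_eq_iff)
    have "compact (f ` cbox ?a ?b)" using f by (intro compact_continuous_image) (auto intro: continuous_on_subset)
    then obtain B where B: "\<And>y. y \<in> f ` cbox ?a ?b \<Longrightarrow> \<bar>y\<bar> \<le> B" by (meson bounded_real compact_imp_bounded)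
    have "AE z in \<mu>0. norm (f z) \<le> B" using \<mu>0(3) by eventually_elim (use B in auto)
    moreover have "f \<in> borel_measurable \<mu>0" unfolding measurable_cong_sets[OF \<mu>0(2) refl] by (rule fm)
    ultimately have "integrable \<mu>0 f" by (rule \<mu>0.integrable_const_bound)
    then show "integrable \<mu> f" unfolding \<mu>_def integrable_distr_eq[OF w fm] fw' .
    have "(\<integral>z. f z \<partial>\<mu>) = (\<integral>z. f z \<partial>\<mu>0)" unfolding \<mu>_def integral_distr[OF w fm] fw' ..
    then show "(\<lambda>m. (\<Sum>k<N (r m). f (X (r m) k, Q (r m) k)) / real (N (r m))) \<longlonglongrightarrow> (\<integral>z. f z \<partial>\<mu>)"
      using lim[OF f] by (simp add: Z_def fw)
  qed
  have inv0: "(\<lambda>m. c / real (Suc (r m))) \<longlonglongrightarrow> 0" for c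
  proof -
    have "(\<lambda>m. c * inverse (real (Suc m))) \<longlonglongrightarrow> c * 0" by (intro tendsto_intros LIMSEQ_inverse_real_of_nat)
    from LIMSEQ_subseq_LIMSEQ[OF this r] show ?thesis by (simp add: o_def divide_inverse)
  qed
  have closed: "\<mu> \<in> closed_measures"
    unfolding closed_measures_def
  proof (intro CollectI conjI allI impI tp)
    fix \<phi> :: "real^'n \<Rightarrow> real" and g assume a: "periodic_fun \<phi> \<and> C1_grad \<phi> g"
    then have der: "(\<phi> has_derivative (\<lambda>h. g x \<bullet> h)) (at x)" for x by (simp add: C1_grad_def)
    have gc: "continuous_on UNIV g" using a by (simp add: C1_grad_def)
    have gp: "periodic_fun g" using a C1_grad_periodic by blast
    let ?f = "\<lambda>z. snd z \<bullet> g (fst z)"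
    have fc: "continuous_on UNIV ?f" by (intro continuous_intros continuous_on_compose2[OF gc]) auto
    have fp: "periodic_fun (\<lambda>x. ?f (x, q))" for q using gp by (simp add: periodic_fun_def)
    show "integrable \<mu> ?f" by (rule key(1)[OF fc fp])
    have "continuous_on UNIV \<phi>"
      by (intro continuous_at_imp_continuous_on ballI has_derivative_continuous[OF der])
    then obtain B where B: "\<And>x. \<bar>\<phi> x\<bar> \<le> B" using periodic_continuous_bounded a by metis
    have "\<bar>\<integral>z. ?f z \<partial>\<mu>\<bar> \<le> 0"
    proof (rule field_le_epsilon)
      fix e :: real assume e: "e > 0"
      \<comment> \<open>The modulus for \<open>g\<close> that makes the error at velocities of size
        \<open>R\<close> at most \<open>e\<close>.\<close>
      define \<omega> where "\<omega> = e / (R + 1)"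
      have \<omega>: "\<omega> > 0" "R * \<omega> \<le> e" using e R0 by (auto simp: \<omega>_def field_simps)
      obtain d where d: "d > 0" "\<And>x y. dist x y < d \<Longrightarrow> dist (g x) (g y) < \<omega>"
        using periodic_uniformly_continuous[OF gc gp \<omega>(1)] by blast
      have bound: "\<bar>(\<Sum>k<N m. ?f (X m k, Q m k)) / real (N m)\<bar> \<le> 2 * B / real (Suc m) + e"
        if m: "R / real (Suc m) < d" for m
      proof -
        \<comment> \<open>The plus sign reflects that chains run backwards,
          \<open>X m (Suc k)\<close> being \<open>X m k\<close> minus \<open>\<tau> m\<close> times
          the velocity.\<close>
        have step: "\<bar>\<phi> (X m (Suc k)) - \<phi> (X m k) + \<tau> m * (Q m k \<bullet> g (X m k))\<bar> \<le> \<tau> m * e" if k: "k < N m" for k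
        proof -
          let ?x = "X m k" and ?q = "Q m k"
          have "\<exists>s\<in>{0..\<tau> m}. \<phi> (?x - \<tau> m *\<^sub>R ?q) - \<phi> (?x - 0 *\<^sub>R ?q) = g (?x - s *\<^sub>R ?q) \<bullet> (- (\<tau> m - 0) *\<^sub>R ?q)"
          proof (rule mvt_very_simple)
            fix s
            show "((\<lambda>t. \<phi> (?x - t *\<^sub>R ?q)) has_derivative (\<lambda>h. g (?x - s *\<^sub>R ?q) \<bullet> (- h *\<^sub>R ?q))) (at s within {0..\<tau> m})"
              by (rule has_derivative_compose[OF _ der]) (auto intro!: derivative_eq_intros)
          qed (use \<tau>(1)[of m] in simp)
          then obtain s where s: "0 \<le> s" "s \<le> \<tau> m"
            "\<phi> (?x - \<tau> m *\<^sub>R ?q) - \<phi> ?x = - \<tau> m * (?q \<bullet> g (?x - s *\<^sub>R ?q))"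
            by (auto simp: inner_commute)
          have "s * norm ?q \<le> (1 / real (Suc m)) * R" using s \<tau>[of m] Q[OF k] by (intro mult_mono) auto
          then have "dist (?x - s *\<^sub>R ?q) ?x < d" using m s by (simp add: dist_norm)
          then have "norm (g ?x - g (?x - s *\<^sub>R ?q)) \<le> \<omega>"
            using d(2)[of "?x - s *\<^sub>R ?q" ?x] by (simp add: dist_norm norm_minus_commute)
          then have "norm ?q * norm (g ?x - g (?x - s *\<^sub>R ?q)) \<le> R * \<omega>"
            using Q[OF k] R0 by (intro mult_mono) auto
          then have "\<bar>?q \<bullet> (g ?x - g (?x - s *\<^sub>R ?q))\<bar> \<le> e"
            using Cauchy_Schwarz_ineq2[of ?q "g ?x - g (?x - s *\<^sub>R ?q)"] \<omega>(2) by linarith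
          then have "\<tau> m * \<bar>?q \<bullet> (g ?x - g (?x - s *\<^sub>R ?q))\<bar> \<le> \<tau> m * e"
            using \<tau>(1)[of m] by (intro mult_left_mono) auto
          moreover have "\<phi> (X m (Suc k)) - \<phi> ?x + \<tau> m * (?q \<bullet> g ?x) = \<tau> m * (?q \<bullet> (g ?x - g (?x - s *\<^sub>R ?q)))"
            unfolding X[OF k] using s(3) by (simp add: inner_diff_right right_diff_distrib)
          ultimately show ?thesis using \<tau>(1)[of m] by (simp add: abs_mult)
        qed
        let ?A = "\<Sum>k<N m. ?f (X m k, Q m k)"
        have "(\<Sum>k<N m. \<phi> (X m (Suc k)) - \<phi> (X m k) + \<tau> m * (Q m k \<bullet> g (X m k))) = \<phi> (X m (N m)) - \<phi> (X m 0) + \<tau> m * ?A"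
          using sum_lessThan_telescope[of "\<lambda>k. \<phi> (X m k)" "N m"] by (simp add: sum.distrib sum_distrib_left)
        moreover have "\<bar>\<Sum>k<N m. \<phi> (X m (Suc k)) - \<phi> (X m k) + \<tau> m * (Q m k \<bullet> g (X m k))\<bar> \<le> (\<Sum>k<N m. \<tau> m * e)"
          using step by (intro order_trans[OF sum_abs] sum_mono) auto
        ultimately have "\<bar>\<tau> m * ?A\<bar> \<le> 2 * B + real (N m) * (\<tau> m * e)"
          using B[of "X m (N m)"] B[of "X m 0"] by simp
        then have "\<bar>\<tau> m * ?A\<bar> / (real (N m) * \<tau> m) \<le> (2 * B + real (N m) * (\<tau> m * e)) / (real (N m) * \<tau> m)"
          using N(1)[of m] \<tau>(1)[of m] by (intro divide_right_mono) auto
        moreover have "\<bar>\<tau> m * ?A\<bar> / (real (N m) * \<tau> m) = \<bar>?A / real (N m)\<bar>"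
          using N(1)[of m] \<tau>(1)[of m] by (simp add: abs_mult)
        moreover have "(2 * B + real (N m) * (\<tau> m * e)) / (real (N m) * \<tau> m) = 2 * B / (real (N m) * \<tau> m) + e"
          using N(1)[of m] \<tau>(1)[of m] by (simp add: field_simps)
        moreover have "2 * B / (real (N m) * \<tau> m) \<le> 2 * B / real (Suc m)"
          using N(2)[of m] B[of 0] by (intro divide_left_mono) (auto intro!: mult_pos_pos \<tau>(1) N(1))
        ultimately show ?thesis by linarith
      qed
      have "\<forall>\<^sub>F m in sequentially. R / real (Suc (r m)) < d" using order_tendstoD(2)[OF inv0 d(1)] .
      then have ev: "\<forall>\<^sub>F m in sequentially.
          \<bar>(\<Sum>k<N (r m). ?f (X (r m) k, Q (r m) k)) / real (N (r m))\<bar> \<le> 2 * B / real (Suc (r m)) + e"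
        by eventually_elim (rule bound)
      have "(\<lambda>m. 2 * B / real (Suc (r m)) + e) \<longlonglongrightarrow> 0 + e" by (intro tendsto_intros inv0)
      from tendsto_le[OF _ this tendsto_rabs[OF key(2)[OF fc fp]] ev]
      show "\<bar>\<integral>z. ?f z \<partial>\<mu>\<bar> \<le> 0 + e" by simp
    qed
    then show "(\<integral>z. ?f z \<partial>\<mu>) = 0" by simp
  qed
  have Lp: "periodic_fun (\<lambda>x. L (fst (x, q)) (snd (x, q)))" for q using Lag_periodic by simp
  have Lint: "integrable \<mu> (\<lambda>z. L (fst z) (snd z))" by (rule key(1)[OF Lag_cont Lp])
  have L0: "(\<integral>z. L (fst z) (snd z) \<partial>\<mu>) \<le> 0"
    using LIMSEQ_le[OF key(2)[OF Lag_cont Lp] inv0[of C]] avgL by auto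
  \<comment> \<open>Nonnegative because \<open>uinf\<close> competes in \<open>dH\<close>; its
    averages along the chains are at most \<open>1 / (m + 1)\<close>.\<close>
  let ?h = "\<lambda>x. dH H x0 x + uinf x - uinf x0"
  have hc: "continuous_on UNIV ?h"
    by (intro continuous_intros dH_continuous[OF uinf_visc_sub] dominated_continuous uinf_dominated)
  have hp: "periodic_fun ?h" using dH_periodic[of x0] uinf_periodic by (simp add: periodic_fun_def)
  have h0: "?h x \<ge> 0" for x using dH_upper[OF uinf_visc_sub, of x0 x] by simp
  have "(\<integral>z. ?h (fst z) \<partial>\<mu>) \<le> 0"
  proof -
    have "continuous_on UNIV (\<lambda>z::(real^'n) \<times> (real^'n). ?h (fst z))"
      by (rule continuous_on_compose2[OF hc]) (auto intro!: continuous_intros)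
    moreover have "periodic_fun (\<lambda>x. ?h (fst (x, q)))" for q :: "real^'n" using hp by simp
    ultimately have "(\<lambda>m. (\<Sum>k<N (r m). ?h (X (r m) k)) / real (N (r m))) \<longlonglongrightarrow> (\<integral>z. ?h (fst z) \<partial>\<mu>)"
      using key(2)[of "\<lambda>z. ?h (fst z)"] by simp
    moreover have "(\<Sum>k<N m. ?h (X m k)) / real (N m) \<le> 1 / real (Suc m)" for m
    proof -
      have "(\<Sum>k<N m. ?h (X m k)) \<le> real (card {..<N m}) * (1 / real (Suc m))"
        using dX by (intro sum_bounded_above) (auto simp: algebra_simps)
      then show ?thesis using N(1)[of m] by (simp add: pos_divide_le_eq mult.commute)
    qed
    ultimately show ?thesis using LIMSEQ_le[OF _ inv0[of 1]] by blast
  qed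
  then have "?h y = 0" if "y \<in> proj_supp \<mu>" for y
    by (intro zero_on_proj_supp[OF tp hc hp h0 _ that])
  then have "\<And>y. y \<in> proj_supp \<mu> \<Longrightarrow> uinf x0 = dH H x0 y + uinf y" by fastforce
  then show ?thesis using closed Lint L0 that by blast
qed

text \<open>A minimizer does no worse than the limit measure of the chains, started from any
  point.\<close>

lemma mather_measure_action:
  assumes "\<mu> \<in> mather_measures H"
  shows "\<mu> \<in> closed_measures" "integrable \<mu> (\<lambda>z. L (fst z) (snd z))" "(\<integral>z. L (fst z) (snd z) \<partial>\<mu>) \<le> 0"
proof -
  show "\<mu> \<in> closed_measures" "integrable \<mu> (\<lambda>z. L (fst z) (snd z))"
    using assms by (auto simp: mather_measures_def)
  obtain \<nu> where \<nu>: "\<nu> \<in> closed_measures" "integrable \<nu> (\<lambda>z. L (fst z) (snd z))" "(\<integral>z. L (fst z) (snd z) \<partial>\<nu>) \<le> 0"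
    using calibrated_closed_measure by blast
  then have "(\<integral>z. L (fst z) (snd z) \<partial>\<mu>) \<le> (\<integral>z. L (fst z) (snd z) \<partial>\<nu>)"
    using assms by (simp add: mather_measures_def)
  then show "(\<integral>z. L (fst z) (snd z) \<partial>\<mu>) \<le> 0" using \<nu>(3) by simp
qed

lemma uinf_eq_u0_minus:
  assumes "y \<in> mather_set H"
  shows "uinf y = u0_minus H u0 y"
proof -
  have "closed {y. uinf y = V 0 y}"
    by (intro closed_Collect_eq dominated_continuous uinf_dominated V_dominated) simp
  moreover have "(\<Union>\<mu>\<in>mather_measures H. proj_supp \<mu>) \<subseteq> {y. uinf y = V 0 y}"
    using uinf_eq_u0_minus_on_supp[OF mather_measure_action] by blast
  ultimately have "uinf y = V 0 y"
    using assms closure_minimal unfolding mather_set_def by blast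
  then show ?thesis using u0_minus_bounds[of y] by simp
qed

lemma uinf_le_on_mather_set:
  "y \<in> mather_set H \<Longrightarrow> uinf x \<le> dH H x y + u0_minus H u0 y"
  using dH_upper[OF uinf_visc_sub, of x y] uinf_eq_u0_minus[of y] by simp

text \<open>The measure obtained from chains starting at \<open>x\<close> has action \<le> 0, the
  least possible by \<open>closed_measure_Lag_nonneg\<close>. So it is a Mather measure, and any
  point of its nonempty support attains the value.\<close>

lemma uinf_attained_on_mather_set:
  "\<exists>y\<in>mather_set H. uinf x = dH H x y + u0_minus H u0 y"
proof -
  obtain \<mu> where \<mu>: "\<mu> \<in> closed_measures" "integrable \<mu> (\<lambda>z. L (fst z) (snd z))" "(\<integral>z. L (fst z) (snd z) \<partial>\<mu>) \<le> 0"
    "\<And>y. y \<in> proj_supp \<mu> \<Longrightarrow> uinf x = dH H x y + uinf y"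
    using calibrated_closed_measure by blast
  have "torus_prob \<mu>" using \<mu>(1) by (simp add: closed_measures_def)
  then obtain y where y: "y \<in> proj_supp \<mu>" using proj_supp_nonempty by blast
  have "\<mu> \<in> mather_measures H"
    unfolding mather_measures_def
    using \<mu>(1,2) order_trans[OF \<mu>(3) closed_measure_Lag_nonneg[OF uinf_dominated uinf_periodic]] by simp
  then have "y \<in> (\<Union>\<mu>\<in>mather_measures H. proj_supp \<mu>)" using y by (intro UN_I[of \<mu>])
  then have "y \<in> mather_set H" unfolding mather_set_def by (rule subsetD[OF closure_subset])
  then show ?thesis using \<mu>(4)[OF y] uinf_eq_u0_minus by auto
qed

end

text \<open>Two applications of the mean value theorem along the segment from \<open>p\<close> to
  \<open>p'\<close>: the increment of \<open>H\<close> is a directional derivative at some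
  \<open>s\<close>, and this exceeds the one at 0 by \<open>s\<close> times a nonnegative second
  derivative.\<close>

lemma convex_C2_subgradient:
  fixes H :: "real^'n \<Rightarrow> real^'n \<Rightarrow> real"
  assumes C2: "C2_with (\<lambda>z. H (fst z) (snd z)) DH D2H"
    and conv: "\<And>p \<xi>. blinfun_apply (blinfun_apply (D2H (x, p)) (0, \<xi>)) (0, \<xi>) \<ge> 0"
  shows "\<exists>q. \<forall>p'. H x p + q \<bullet> (p' - p) \<le> H x p'"
proof -
  have D1: "((\<lambda>z. H (fst z) (snd z)) has_derivative blinfun_apply (DH z)) (at z)" for z
    using C2 unfolding C2_with_def by blast
  have D2: "(DH has_derivative blinfun_apply (D2H z)) (at z)" for z
    using C2 unfolding C2_with_def by blast
  \<comment> \<open>The vector representing the momentum part of the derivative.\<close>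
  define q where "q = (\<Sum>b\<in>Basis. blinfun_apply (DH (x, p)) (0, b) *\<^sub>R b)"
  have q: "q \<bullet> v = blinfun_apply (DH (x, p)) (0, v)" for v
  proof -
    have lin: "linear (\<lambda>v. blinfun_apply (DH (x, p)) (0, v))"
      by (intro bounded_linear.linear bounded_linear_compose[OF blinfun.bounded_linear_right]
          bounded_linear_Pair bounded_linear_zero bounded_linear_ident)
    have "blinfun_apply (DH (x, p)) (0, v) = blinfun_apply (DH (x, p)) (0, \<Sum>b\<in>Basis. (v \<bullet> b) *\<^sub>R b)"
      by (simp add: euclidean_representation)
    also have "\<dots> = (\<Sum>b\<in>Basis. (v \<bullet> b) * blinfun_apply (DH (x, p)) (0, b))"
      using linear_sum[OF lin, of "\<lambda>b. (v \<bullet> b) *\<^sub>R b" Basis] linear_scale[OF lin] by simp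
    finally show ?thesis by (simp add: q_def inner_sum_left inner_commute[of v] mult.commute)
  qed
  have "H x p + q \<bullet> (p' - p) \<le> H x p'" for p'
  proof -
    let ?\<xi> = "p' - p"
    let ?c = "\<lambda>s::real. (x, p + s *\<^sub>R ?\<xi>)"
    have c: "(?c has_derivative (\<lambda>h. (0, h *\<^sub>R ?\<xi>))) (at s within S)" for s S
      by (auto intro!: derivative_eq_intros)
    have d1: "((\<lambda>s. H x (p + s *\<^sub>R ?\<xi>)) has_derivative (\<lambda>h. blinfun_apply (DH (?c s)) (0, h *\<^sub>R ?\<xi>))) (at s within S)" for s S
      using has_derivative_compose[OF c D1] by simp
    have d2: "((\<lambda>s. blinfun_apply (DH (?c s)) (0, ?\<xi>)) has_derivative
        (\<lambda>h. blinfun_apply (blinfun_apply (D2H (?c s)) (0, h *\<^sub>R ?\<xi>)) (0, ?\<xi>))) (at s within S)" for s S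
      by (rule bounded_linear.has_derivative[OF blinfun.bounded_linear_left has_derivative_compose[OF c D2]])
    have "\<exists>s\<in>{0..1}. H x (p + 1 *\<^sub>R ?\<xi>) - H x (p + 0 *\<^sub>R ?\<xi>) = blinfun_apply (DH (?c s)) (0, (1 - 0) *\<^sub>R ?\<xi>)"
      by (rule mvt_very_simple) (use d1 in auto)
    then obtain s where s: "0 \<le> s" "H x p' - H x p = blinfun_apply (DH (?c s)) (0, ?\<xi>)" by auto
    have "\<exists>t\<in>{0..s}. blinfun_apply (DH (?c s)) (0, ?\<xi>) - blinfun_apply (DH (?c 0)) (0, ?\<xi>)
        = blinfun_apply (blinfun_apply (D2H (?c t)) (0, (s - 0) *\<^sub>R ?\<xi>)) (0, ?\<xi>)"
      by (rule mvt_very_simple[OF s(1)]) (rule d2)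
    then obtain t where t: "blinfun_apply (DH (?c s)) (0, ?\<xi>) - blinfun_apply (DH (x, p)) (0, ?\<xi>)
        = blinfun_apply (blinfun_apply (D2H (?c t)) (0, s *\<^sub>R ?\<xi>)) (0, ?\<xi>)" by auto
    have "(0, s *\<^sub>R ?\<xi>) = s *\<^sub>R (0 :: real^'n, ?\<xi>)" by simp
    then have "blinfun_apply (blinfun_apply (D2H (?c t)) (0, s *\<^sub>R ?\<xi>)) (0, ?\<xi>)
        = s * blinfun_apply (blinfun_apply (D2H (?c t)) (0, ?\<xi>)) (0, ?\<xi>)"
      by (simp only: blinfun.scaleR_right blinfun.scaleR_left real_scaleR_def)
    moreover have "\<dots> \<ge> 0" using s(1) conv by simp
    ultimately show ?thesis using s(2) t q[of ?\<xi>] by linarith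
  qed
  then show ?thesis by blast
qed

text \<open>The minimum in (ii) is expressed as attainment at some point of the Mather set together
  with the inequality at all of them.\<close>

theorem mainTheorem6:
  fixes H :: "real^'n \<Rightarrow> real^'n \<Rightarrow> real"
    and DH :: "(real^'n) \<times> (real^'n) \<Rightarrow> ((real^'n) \<times> (real^'n)) \<Rightarrow>\<^sub>L real"
    and D2H :: "(real^'n) \<times> (real^'n) \<Rightarrow> ((real^'n) \<times> (real^'n)) \<Rightarrow>\<^sub>L (((real^'n) \<times> (real^'n)) \<Rightarrow>\<^sub>L real)"
    and \<gamma> :: real
    and u0 :: "real^'n \<Rightarrow> real"
    and u :: "real^'n \<Rightarrow> real \<Rightarrow> real"
    and uinf :: "real^'n \<Rightarrow> real"
  assumes C2: "C2_with (\<lambda>z. H (fst z) (snd z)) DH D2H"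
    and Hper: "\<forall>p. periodic_fun (\<lambda>x. H x p)"
    and H1': "\<gamma> > 0" "\<forall>x p \<xi>. blinfun_apply (blinfun_apply (D2H (x, p)) (0, \<xi>)) (0, \<xi>) \<ge> \<gamma> * (norm \<xi>)\<^sup>2"
    and H2a: "\<forall>M. \<exists>R. \<forall>x p. norm p \<ge> R \<longrightarrow> H x p \<ge> M * norm p"
    and H2b: "\<forall>M. \<exists>R. \<forall>x p. norm p \<ge> R \<longrightarrow> (H x p)\<^sup>2 / 2 + blinfun_apply (DH (x, p)) (p, 0) \<ge> M"
    and ergodic0: "\<exists>w. visc_sol H w"
    and u0_lip: "periodic_fun u0" "\<exists>K. K-lipschitz_on UNIV u0"
    and u_sol: "visc_sol_cauchy H u0 u"
    and u_lim: "\<forall>e>0. \<exists>T. \<forall>t\<ge>T. \<forall>x. \<bar>u x t - uinf x\<bar> < e"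
  shows "(\<forall>y\<in>mather_set H. uinf y = u0_minus H u0 y)
       \<and> (\<forall>x. (\<exists>y\<in>mather_set H. uinf x = dH H x y + u0_minus H u0 y)
              \<and> (\<forall>y\<in>mather_set H. uinf x \<le> dH H x y + u0_minus H u0 y))"
proof -
  interpret convergent_cauchy_solution H u0 u uinf
  proof
    have "((\<lambda>z. H (fst z) (snd z)) has_derivative blinfun_apply (DH z)) (at z)" for z
      using C2 unfolding C2_with_def by blast
    then show "continuous_on UNIV (\<lambda>z. H (fst z) (snd z))"
      by (intro continuous_at_imp_continuous_on ballI) (rule has_derivative_continuous)
    fix x p :: "real^'n"
    have "0 \<le> \<gamma> * (norm \<xi>)\<^sup>2" for \<xi> :: "real^'n" using H1'(1) by simp
    then show "\<exists>q. \<forall>p'. H x p + q \<bullet> (p' - p) \<le> H x p'"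
      using H1'(2) by (intro convex_C2_subgradient[OF C2]) (meson order_trans)
  qed (use Hper H2a u_sol u_lim in auto)
  show ?thesis
    using uinf_eq_u0_minus uinf_attained_on_mather_set uinf_le_on_mather_set by blast
qed

end
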